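(* Consider the Layer Model with Fault with continuous permeability in each layer, let $\mu_0$ be the prior probability measure on $U$ $$\mu_0(du)=\pi_0^{A,g}(a)da\otimes\pi_0^{A,g}(b)db\otimes\pi_0^{C,g}(c)dc\otimes\prod_{i=1}^n\mu_0^i(d\alpha_i),\qquad \alpha_i=\log\kappa_i,$$ with Gaussian $\mu_0^i=N(m_i,C_i)$ satisfying $\mu_0^i(C(\overline{D};\mathbb{R}))=1$, and let $\Phi(u;y)=\frac12|y-\mathcal{G}(u)|_\Gamma^2$. Let $u\sim\mu_0$ and $y=\mathcal{G}(u)+\eta$ with $\eta\sim N(0,\Gamma)$ independent of $u$. Then the posterior distribution $\mu^y$ (the conditional distribution of $u$ given $y$) is well-defined. Moreover $\mu^y\ll\mu_0$ with Radon–Nikodym derivative $$\frac{d\mu^y}{d\mu_0}(u)=\frac1Z\exp(-\Phi(u;y)),\qquad Z=\int_U\exp(-\Phi(u;y))\,\mu_0(du)>0.$$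
   Context: Let $D=(0,1)^2$ with points $(x,y)$, $V=H^1_0(D)$ with norm $\|p\|_V=\|\nabla p\|_{L^2(D)}$, $V^*$ its dual, and $X=\{g\in L^\infty(D;\mathbb{R}) : \operatorname{ess\,inf}_D g>0\}$. Fix $f\in V^*$. For $\kappa\in X$ let $G(\kappa)=p\in V$ be the unique weak solution of $-\nabla\cdot(\kappa\nabla p)=f$ in $D$, $p=0$ on $\partial D$. Let $L:V\to Y=\mathbb{R}^J$, $L(p)=(l_1(p),\dots,l_J(p))^T$ with fixed $l_j\in V^*$. The unknown is $u=(u_g,u_\kappa)\in U=U_g\times U_\kappa$, $F(u)=\kappa=\sum_{i=1}^n\kappa_i\chi_{D_i}$ where the $D_i$ are determined by $u_g$, and $\mathcal{G}=L\circ G\circ F:U\to Y$. $\Gamma$ is a symmetric positive definite $J\times J$ matrix and $|\cdot|_\Gamma=|\Gamma^{-1/2}\cdot|$. Layer Model with Fault ($n\ge 2$ layers): $u_g=(a,b,c)\in U_g=A^2\times C$, $C=[-c^\star,c^\star]$ with $c^\star>0$ and $A=\{\mathbf{x}\in\mathbb{R}^{n-1}:\sum_{i=1}^{n-1}x_i\le1,\ x_i\ge0\}$. Here $a_i$ and $b_i$ are the thicknesses of layer $i$ at the right side $x=1$ and the left side $x=0$ of $D$, with layers numbered from top to bottom. For $1\le i\le n-1$ put $h_i(x)=\sum_{k=1}^i\big(b_k(1-x)+a_kx\big)$, and let the depth (distance below the top of $D$) of the interface between layers $i$ and $i+1$ be $S_i(x)=h_i(x)+c$ for $x<\frac12$ and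 $S_i(x)=h_i(x)$ for $x>\frac12$. With $S_0=-\infty$, $S_n=+\infty$, $D_i=\{(x,y)\in D: x\ne\frac12,\ S_{i-1}(x)<1-y<S_i(x)\}$. Continuous permeability: $u_\kappa=(\alpha_1,\dots,\alpha_n)=(\log\kappa_1,\dots,\log\kappa_n)\in U_\kappa=C(\overline{D};\mathbb{R}^n)$ with the sup norm. $U$ is a subset of the separable Banach space $\mathcal{B}=\mathbb{R}^{2n-1}\times C(\overline{D};\mathbb{R}^n)$ with its Borel $\sigma$-algebra. Prior: $\pi_0^{A,g}$ is the uniform density on $A$, $\pi_0^{C,g}$ the uniform density on $C$; the $\alpha_i$ are independent of each other and of the geometric parameters. As usual for conditional distributions, well-definedness of $\mu^y$ means that a regular conditional distribution of $u$ given $y$ exists, and that the displayed formula gives a version of it. *)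

theory Defs
  imports "HOL-Probability.Probability"
begin

definition D :: "(real \<times> real) set" where
  "D = {0<..<1} \<times> {0<..<1}"

text \<open>
  The closed square as a type, so that \<open>Dbar \<Rightarrow>\<^sub>C 'b\<close> (bounded continuous functions with the sup
  norm; boundedness is automatic by compactness) is the Banach space of continuous functions on
  the closure of \<open>D\<close>.
\<close>

typedef Dbar = "closure D"
proof
  show "(1/2, 1/2) \<in> closure D"
    by (intro subsetD[OF closure_subset]) (simp add: D_def)
qed

instantiation Dbar :: metric_space
begin

definition dist_Dbar :: "Dbar \<Rightarrow> Dbar \<Rightarrow> real" where
  "dist_Dbar s t = dist (Rep_Dbar s) (Rep_Dbar t)"

definition uniformity_Dbar :: "(Dbar \<times> Dbar) filter" where
  "uniformity_Dbar = (INF e\<in>{0<..}. principal {(s, t). dist s t < e})"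

definition open_Dbar :: "Dbar set \<Rightarrow> bool" where
  "open_Dbar W \<longleftrightarrow> (\<forall>s\<in>W. \<forall>\<^sub>F (s', t) in uniformity. s' = s \<longrightarrow> t \<in> W)"

instance
proof
  show "dist s t = 0 \<longleftrightarrow> s = t" for s t :: Dbar
    by (simp add: dist_Dbar_def Rep_Dbar_inject)
  show "dist s t \<le> dist s r + dist t r" for s t r :: Dbar
    by (simp add: dist_Dbar_def dist_triangle2)
qed (simp_all only: uniformity_Dbar_def open_Dbar_def)

end

text \<open>
  Elements of Lebesgue and Sobolev spaces are represented by functions on the plane of which only
  the restriction to \<open>D\<close>, up to null sets, matters.
\<close>

primrec Ck :: "nat \<Rightarrow> (real \<times> real \<Rightarrow> real) \<Rightarrow> bool" where
  "Ck 0 \<phi> \<longleftrightarrow> continuous_on UNIV \<phi>"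
| "Ck (Suc k) \<phi> \<longleftrightarrow> (\<forall>z. \<phi> differentiable (at z)) \<and>
     (\<forall>e\<in>Basis. Ck k (\<lambda>z. frechet_derivative \<phi> (at z) e))"

definition test_function :: "(real \<times> real \<Rightarrow> real) \<Rightarrow> bool" where
  "test_function \<phi> \<longleftrightarrow> (\<forall>k. Ck k \<phi>) \<and>
     compact (closure {z. \<phi> z \<noteq> 0}) \<and> closure {z. \<phi> z \<noteq> 0} \<subseteq> D"

definition L2 :: "(real \<times> real \<Rightarrow> 'b::real_normed_vector) set" where
  "L2 = {h. h \<in> borel_measurable (lebesgue_on D) \<and>
            integrable (lebesgue_on D) (\<lambda>z. (norm (h z))\<^sup>2)}"

definition weak_gradient :: "(real \<times> real \<Rightarrow> real) \<Rightarrow> (real \<times> real \<Rightarrow> real \<times> real) \<Rightarrow> bool" where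
  "weak_gradient p g \<longleftrightarrow> (\<forall>\<phi>. test_function \<phi> \<longrightarrow> (\<forall>e\<in>Basis.
     (LINT z|lebesgue_on D. p z * frechet_derivative \<phi> (at z) e) =
     - (LINT z|lebesgue_on D. (g z \<bullet> e) * \<phi> z)))"

definition H1 :: "(real \<times> real \<Rightarrow> real) set" where
  "H1 = {p \<in> L2. \<exists>g\<in>L2. weak_gradient p g}"

text \<open>Weak gradients are unique up to null sets.\<close>

definition grad :: "(real \<times> real \<Rightarrow> real) \<Rightarrow> (real \<times> real \<Rightarrow> real \<times> real)" where
  "grad p = (SOME g. g \<in> L2 \<and> weak_gradient p g)"

definition H1_norm :: "(real \<times> real \<Rightarrow> real) \<Rightarrow> real" where
  "H1_norm p = sqrt ((LINT z|lebesgue_on D. (p z)\<^sup>2) + (LINT z|lebesgue_on D. (norm (grad p z))\<^sup>2))"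

definition V :: "(real \<times> real \<Rightarrow> real) set" where
  "V = {p \<in> H1. \<exists>\<phi>. (\<forall>k. test_function (\<phi> k)) \<and>
          (\<lambda>k. H1_norm (\<lambda>z. \<phi> k z - p z)) \<longlonglongrightarrow> 0}"

definition V_norm :: "(real \<times> real \<Rightarrow> real) \<Rightarrow> real" where
  "V_norm p = sqrt (LINT z|lebesgue_on D. (norm (grad p z))\<^sup>2)"

text \<open>
  Bounded linear functionals. Boundedness with respect to \<open>V_norm\<close> forces the value at \<open>p\<close> to
  depend only on the class of \<open>p\<close> modulo equality almost everywhere on \<open>D\<close>.
\<close>

definition V_dual :: "((real \<times> real \<Rightarrow> real) \<Rightarrow> real) set" where
  "V_dual = {l. (\<forall>p\<in>V. \<forall>q\<in>V. l (\<lambda>z. p z + q z) = l p + l q) \<and>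
                (\<forall>c. \<forall>p\<in>V. l (\<lambda>z. c * p z) = c * l p) \<and>
                (\<exists>K. \<forall>p\<in>V. \<bar>l p\<bar> \<le> K * V_norm p)}"

definition X :: "(real \<times> real \<Rightarrow> real) set" where
  "X = {g. g \<in> borel_measurable (lebesgue_on D) \<and>
           (\<exists>M. AE z in lebesgue_on D. \<bar>g z\<bar> \<le> M) \<and>
           (\<exists>\<epsilon>>0. AE z in lebesgue_on D. \<epsilon> \<le> g z)}"

definition weak_solution ::
  "((real \<times> real \<Rightarrow> real) \<Rightarrow> real) \<Rightarrow> (real \<times> real \<Rightarrow> real) \<Rightarrow> (real \<times> real \<Rightarrow> real) \<Rightarrow> bool" where
  "weak_solution f \<kappa> p \<longleftrightarrow> \<kappa> \<in> X \<and> p \<in> V \<and>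
     (\<forall>q\<in>V. (LINT z|lebesgue_on D. \<kappa> z * (grad p z \<bullet> grad q z)) = f q)"

text \<open>For \<open>f \<in> V_dual\<close> and \<open>\<kappa> \<in> X\<close> the solution is unique up to null sets.\<close>

definition G :: "((real \<times> real \<Rightarrow> real) \<Rightarrow> real) \<Rightarrow> (real \<times> real \<Rightarrow> real) \<Rightarrow> (real \<times> real \<Rightarrow> real)" where
  "G f \<kappa> = (SOME p. weak_solution f \<kappa> p)"

definition L :: "('J \<Rightarrow> (real \<times> real \<Rightarrow> real) \<Rightarrow> real) \<Rightarrow> (real \<times> real \<Rightarrow> real) \<Rightarrow> real ^ 'J" where
  "L l p = (\<chi> j. l j p)"

text \<open>
  The type \<open>'m\<close> indexes the coordinates of real vectors of length \<open>n - 1\<close> and \<open>'n\<close> the \<open>n\<close>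
  layers. Coordinates and layers are numbered from 1 by the order of the index type.
\<close>

definition coord_no :: "'i::{finite,linorder} \<Rightarrow> nat" where
  "coord_no k = card {j. j \<le> k}"

definition simplex_A :: "(real ^ 'm) set" where
  "simplex_A = {v. (\<Sum>i\<in>UNIV. v $ i) \<le> 1 \<and> (\<forall>i. 0 \<le> v $ i)}"

type_synonym ('m, 'n) params =
  "(real ^ 'm) \<times> (real ^ 'm) \<times> real \<times> (Dbar \<Rightarrow>\<^sub>C (real ^ 'n))"

definition U :: "real \<Rightarrow> ('m::finite, 'n::finite) params set" where
  "U cstar = simplex_A \<times> simplex_A \<times> {-cstar..cstar} \<times> UNIV"

definition cum_thickness ::
  "real ^ ('m::{finite,linorder}) \<Rightarrow> real ^ ('m::{finite,linorder}) \<Rightarrow> nat \<Rightarrow> real \<Rightarrow> real" where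
  "cum_thickness a b i x = (\<Sum>k | coord_no k \<le> i. b $ k * (1 - x) + a $ k * x)"

definition depth ::
  "real ^ ('m::{finite,linorder}) \<Rightarrow> real ^ ('m::{finite,linorder}) \<Rightarrow> real \<Rightarrow> nat \<Rightarrow> real \<Rightarrow> ereal" where
  "depth a b c i x =
     (if i = 0 then -\<infinity>
      else if i > CARD('m) then \<infinity>
      else ereal (cum_thickness a b i x + (if x < 1/2 then c else 0)))"

definition layer ::
  "real ^ ('m::{finite,linorder}) \<Rightarrow> real ^ ('m::{finite,linorder}) \<Rightarrow> real \<Rightarrow> nat \<Rightarrow> (real \<times> real) set" where
  "layer a b c i = {(x, y) \<in> D. x \<noteq> 1/2 \<and>
     depth a b c (i - 1) x < ereal (1 - y) \<and> ereal (1 - y) < depth a b c i x}"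

definition F :: "('m::{finite,linorder}, 'n::{finite,linorder}) params \<Rightarrow> real \<times> real \<Rightarrow> real" where
  "F u = (case u of (a, b, c, \<alpha>) \<Rightarrow> \<lambda>z.
     \<Sum>i\<in>UNIV. exp (apply_bcontfun \<alpha> (Abs_Dbar z) $ i) * indicator (layer a b c (coord_no i)) z)"

definition forward_map ::
  "((real \<times> real \<Rightarrow> real) \<Rightarrow> real) \<Rightarrow> ('J \<Rightarrow> (real \<times> real \<Rightarrow> real) \<Rightarrow> real) \<Rightarrow>
   ('m::{finite,linorder}, 'n::{finite,linorder}) params \<Rightarrow> real ^ 'J" where
  "forward_map f l u = L l (G f (F u))"

definition normal_law :: "real \<Rightarrow> real \<Rightarrow> real measure" where
  "normal_law m v =
     (if v = 0 then return borel m
      else density lborel (\<lambda>x. ennreal (normal_density m (sqrt v) x)))"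

text \<open>
  Gaussian Borel probability measure \<open>N(m, C)\<close> on a normed space, with covariance operator \<open>C\<close>
  from the dual to the space.
\<close>

definition gaussian ::
  "'a::real_normed_vector measure \<Rightarrow> 'a \<Rightarrow> (('a \<Rightarrow>\<^sub>L real) \<Rightarrow> 'a) \<Rightarrow> bool" where
  "gaussian \<mu> m C \<longleftrightarrow> sets \<mu> = sets borel \<and> prob_space \<mu> \<and>
     (\<forall>\<phi>. distr \<mu> borel (blinfun_apply \<phi>) = normal_law (blinfun_apply \<phi> m) (blinfun_apply \<phi> (C \<phi>))) \<and>
     (\<forall>\<phi> \<psi>. (LINT x|\<mu>. blinfun_apply \<phi> (x - m) * blinfun_apply \<psi> (x - m)) =
             blinfun_apply \<psi> (C \<phi>))"

definition sym_pos_def :: "real ^ 'J ^ 'J \<Rightarrow> bool" where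
  "sym_pos_def M \<longleftrightarrow> transpose M = M \<and> (\<forall>v. v \<noteq> 0 \<longrightarrow> 0 < v \<bullet> (M *v v))"

text \<open>The symmetric positive definite square root of the inverse, which is unique.\<close>

definition inv_sqrt :: "real ^ 'J ^ 'J \<Rightarrow> real ^ 'J ^ 'J" where
  "inv_sqrt \<Gamma> = (SOME B. sym_pos_def B \<and> B ** B = matrix_inv \<Gamma>)"

definition noise_law :: "real ^ 'J ^ 'J \<Rightarrow> (real ^ 'J) measure" where
  "noise_law \<Gamma> = density lborel (\<lambda>v. ennreal
     (exp (- (v \<bullet> (matrix_inv \<Gamma> *v v)) / 2) / sqrt ((2 * pi) ^ CARD('J) * det \<Gamma>)))"

definition \<Phi> ::
  "((real \<times> real \<Rightarrow> real) \<Rightarrow> real) \<Rightarrow> ('J \<Rightarrow> (real \<times> real \<Rightarrow> real) \<Rightarrow> real) \<Rightarrow> real ^ 'J ^ 'J \<Rightarrow>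
   ('m::{finite,linorder}, 'n::{finite,linorder}) params \<Rightarrow> real ^ 'J \<Rightarrow> real" where
  "\<Phi> f l \<Gamma> u y = 1/2 * (norm (inv_sqrt \<Gamma> *v (y - forward_map f l u)))\<^sup>2"

definition combine :: "('n \<Rightarrow> (Dbar \<Rightarrow>\<^sub>C real)) \<Rightarrow> (Dbar \<Rightarrow>\<^sub>C (real ^ 'n))" where
  "combine \<alpha> = Bcontfun (\<lambda>s. \<chi> i. apply_bcontfun (\<alpha> i) s)"

text \<open>
  The product of the marginals, transported to the Borel sets of the ambient Banach space
  and then restricted to \<open>U\<close>, on which it is concentrated.
\<close>

definition prior ::
  "real \<Rightarrow> ('n \<Rightarrow> (Dbar \<Rightarrow>\<^sub>C real) measure) \<Rightarrow> ('m::finite, 'n::finite) params measure" where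
  "prior cstar \<mu> = restrict_space
     (distr (uniform_measure lborel simplex_A \<Otimes>\<^sub>M uniform_measure lborel simplex_A \<Otimes>\<^sub>M
             uniform_measure lborel {-cstar..cstar} \<Otimes>\<^sub>M (\<Pi>\<^sub>M i\<in>UNIV. \<mu> i))
        borel (\<lambda>(a, b, c, \<alpha>). (a, b, c, combine \<alpha>)))
     (U cstar)"

definition Z ::
  "((real \<times> real \<Rightarrow> real) \<Rightarrow> real) \<Rightarrow> ('J \<Rightarrow> (real \<times> real \<Rightarrow> real) \<Rightarrow> real) \<Rightarrow> real ^ 'J ^ 'J \<Rightarrow>
   ('m::{finite,linorder}, 'n::{finite,linorder}) params measure \<Rightarrow> real ^ 'J \<Rightarrow> real" where
  "Z f l \<Gamma> \<mu>0 y = (LINT u|\<mu>0. exp (- \<Phi> f l \<Gamma> u y))"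

definition regular_conditional_distribution ::
  "'w measure \<Rightarrow> 'a measure \<Rightarrow> ('w \<Rightarrow> 'a) \<Rightarrow> 'b measure \<Rightarrow> ('w \<Rightarrow> 'b) \<Rightarrow> ('b \<Rightarrow> 'a measure) \<Rightarrow> bool" where
  "regular_conditional_distribution P M u N y K \<longleftrightarrow>
     u \<in> measurable P M \<and> y \<in> measurable P N \<and> K \<in> measurable N (prob_algebra M) \<and>
     (\<forall>A\<in>sets M. \<forall>B\<in>sets N.
        emeasure P {\<omega> \<in> space P. u \<omega> \<in> A \<and> y \<omega> \<in> B} =
        (\<integral>\<^sup>+ t\<in>B. emeasure (K t) A \<partial>distr P N y))"

end

theory Submission
  imports Defs
begin

text \<open>
  Bayes' formula for an observation with independent additive noise holds for every prior as soon
  as the forward map is measurable (\<open>posterior_regular_conditional_distribution\<close>): given \<open>u\<close>, the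
  observation has the density of the noise translated by the forward map, and Fubini's theorem
  gives the joint law, hence the law of the observation and the conditional law of \<open>u\<close>. The
  normalising integral \<open>Z\<close> is positive because its integrand is, and finite because \<open>\<Phi> \<ge> 0\<close>. The exponent of
  the noise density is \<open>\<Phi>\<close> because the covariance matrix has a positive definite inverse square
  root (\<open>norm_inv_sqrt\<close>), which the spectral theorem provides.

  The substance is therefore the Borel measurability of the forward map (\<open>forward_map_borel\<close>). The
  permeability is not continuous in the geometry for the uniform norm, but when the parameters
  converge it converges at every point off the limiting interfaces, which form a null set. Hence
  \<open>\<integral> \<kappa> w\<close> depends continuously on the parameters for every integrable \<open>w\<close>
  (\<open>continuous_weighted_integral_F\<close>), in particular for \<open>w = \<bar>\<nabla>q\<bar>\<^sup>2\<close>. This is enough, because an observation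
  of the solution can be recovered from such integrals: with the dual energy
  \<open>E l = sup\<^sub>q (l q - 1/2 \<integral> \<kappa> \<bar>\<nabla>q\<bar>\<^sup>2)\<close>, completing the square around the solution \<open>p\<close> for the right-hand
  side \<open>f\<close> gives \<open>l p = E (f + l) - E l - E f + E 0\<close> (\<open>functional_of_solution\<close>), and as a function of the
  parameters each \<open>E\<close> is a supremum of continuous functions, hence lower semicontinuous.

  It remains to have a solution \<open>p\<close> for every permeability, which the Dirichlet principle yields
  (\<open>weak_solution_exists\<close>). It rests on the completeness of \<open>V\<close>, that is, on the completeness of \<open>L\<^sup>2\<close> and
  the Poincare inequality, and on the linearity of \<open>grad\<close> almost everywhere, that is, on the uniqueness of
  weak gradients. The latter is the fundamental lemma of the calculus of variations, for which
  smooth functions with compact support are built from \<open>e\<^sup>-\<^sup>1\<^sup>/\<^sup>t\<close>.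
\<close>

section \<open>Square-integrable functions on the unit square\<close>

abbreviation DM :: "(real \<times> real) measure" where "DM \<equiv> lebesgue_on D"

text \<open>
  The squared norm of \<open>L\<^sup>2\<close>. Working with squares avoids Minkowski's inequality: the bound
  \<open>\<bar>h + k\<bar>\<^sup>2 \<le> 2 \<bar>h\<bar>\<^sup>2 + 2 \<bar>k\<bar>\<^sup>2\<close> suffices for every limit taken below.
\<close>
abbreviation nsq :: "(real \<times> real \<Rightarrow> 'b::euclidean_space) \<Rightarrow> real" where
  "nsq h \<equiv> (LINT z|DM. (norm (h z))\<^sup>2)"

lemma D_box: "D = box (0, 0) (1, 1)"
  by (auto simp: D_def box_def Basis_prod_def)

lemma open_D: "open D"
  by (simp add: D_def open_Times)

lemma space_DM [simp]: "space DM = D"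
  by (simp add: space_restrict_space)

lemma D_lmeasurable: "D \<in> lmeasurable"
  by (simp add: D_box)

lemma D_sets [simp, measurable]: "D \<in> sets lebesgue" "D \<in> sets borel"
  using D_lmeasurable open_D by (auto simp: fmeasurableD)

lemma finite_measure_DM: "finite_measure DM"
  using D_lmeasurable by (intro finite_measureI) (auto simp: emeasure_restrict_space fmeasurable_def)

interpretation DM: finite_measure DM by (rule finite_measure_DM)

lemma measure_D: "measure DM D = 1"
proof -
  have "measure lebesgue (box (0, 0) (1, 1) :: (real \<times> real) set) = measure lborel (cbox (0, 0) (1, 1) :: (real \<times> real) set)"
    by (simp add: measure_lborel_box_eq measure_lborel_cbox_eq)
  also have "\<dots> = 1" by (subst content_Pair) simp
  finally show ?thesis by (simp add: measure_restrict_space D_box)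
qed

lemma measurable_lebesgue_on_D:
  "g \<in> borel_measurable borel \<Longrightarrow> g \<in> borel_measurable DM"
  by (intro measurable_restrict_space1 measurable_completion) simp

lemma L2_measurable: "h \<in> L2 \<Longrightarrow> h \<in> borel_measurable DM"
  by (simp add: L2_def)

lemma L2_sq_integrable: "h \<in> L2 \<Longrightarrow> integrable DM (\<lambda>z. (norm (h z))\<^sup>2)"
  by (simp add: L2_def)

lemma nsq_nonneg: "0 \<le> nsq h"
  by (intro integral_nonneg_AE) auto

lemma L2_dominated:
  fixes h :: "real \<times> real \<Rightarrow> 'b::euclidean_space"
  assumes "h \<in> borel_measurable DM" "integrable DM g" "AE z in DM. (norm (h z))\<^sup>2 \<le> g z"
  shows "h \<in> L2"
proof -
  note [measurable] = assms(1)
  have "AE z in DM. norm ((norm (h z))\<^sup>2) \<le> norm (g z)"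
    using assms(3) by eventually_elim (metis abs_ge_self abs_power2 order_trans real_norm_def)
  then have "integrable DM (\<lambda>z. (norm (h z))\<^sup>2)"
    by (rule Bochner_Integration.integrable_bound[OF assms(2), rotated]) measurable
  with assms(1) show ?thesis by (simp add: L2_def)
qed

lemma L2_add:
  fixes h :: "real \<times> real \<Rightarrow> 'b::euclidean_space"
  assumes "h \<in> L2" "k \<in> L2"
  shows "(\<lambda>z. h z + k z) \<in> L2"
proof (rule L2_dominated)
  note [measurable] = assms[THEN L2_measurable]
  show "(\<lambda>z. h z + k z) \<in> borel_measurable DM" by measurable
  show "integrable DM (\<lambda>z. 2 * (norm (h z))\<^sup>2 + 2 * (norm (k z))\<^sup>2)"
    using assms[THEN L2_sq_integrable] by auto
  have "(norm (x + y))\<^sup>2 \<le> 2 * (norm x)\<^sup>2 + 2 * (norm y)\<^sup>2" for x y :: 'b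
  proof -
    have "2 * (x \<bullet> y) \<le> x \<bullet> x + y \<bullet> y"
      using inner_ge_zero[of "x - y"] by (simp add: inner_diff_left inner_diff_right inner_commute)
    then show ?thesis
      by (simp add: power2_norm_eq_inner inner_add_left inner_add_right inner_commute)
  qed
  then show "AE z in DM. (norm (h z + k z))\<^sup>2 \<le> 2 * (norm (h z))\<^sup>2 + 2 * (norm (k z))\<^sup>2" by simp
qed

lemma L2_mult_bounded:
  fixes h :: "real \<times> real \<Rightarrow> 'b::euclidean_space"
  assumes \<kappa>: "\<kappa> \<in> borel_measurable DM" "AE z in DM. \<bar>\<kappa> z\<bar> \<le> K" and h: "h \<in> L2"
  shows "(\<lambda>z. \<kappa> z *\<^sub>R h z) \<in> L2"
proof (rule L2_dominated)
  note [measurable] = h[THEN L2_measurable] \<kappa>(1)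
  show "(\<lambda>z. \<kappa> z *\<^sub>R h z) \<in> borel_measurable DM" by measurable
  show "integrable DM (\<lambda>z. K\<^sup>2 * (norm (h z))\<^sup>2)" using h[THEN L2_sq_integrable] by auto
  show "AE z in DM. (norm (\<kappa> z *\<^sub>R h z))\<^sup>2 \<le> K\<^sup>2 * (norm (h z))\<^sup>2"
    using \<kappa>(2)
  proof eventually_elim
    case (elim z)
    then have "\<bar>\<kappa> z\<bar>\<^sup>2 \<le> K\<^sup>2" by (intro power_mono) auto
    then show ?case by (simp add: power_mult_distrib mult_right_mono)
  qed
qed

lemma L2_scaleR: "h \<in> L2 \<Longrightarrow> (\<lambda>z. c *\<^sub>R h z) \<in> L2" for h :: "real \<times> real \<Rightarrow> 'b::euclidean_space"
  using L2_mult_bounded[of "\<lambda>_. c" "\<bar>c\<bar>" h] by simp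

lemma L2_mult: "h \<in> L2 \<Longrightarrow> (\<lambda>z. c * h z) \<in> L2" for h :: "real \<times> real \<Rightarrow> real"
  using L2_scaleR[of h c] by simp

lemma L2_diff:
  fixes h :: "real \<times> real \<Rightarrow> 'b::euclidean_space"
  assumes "h \<in> L2" "k \<in> L2"
  shows "(\<lambda>z. h z - k z) \<in> L2"
  using L2_add[OF assms(1) L2_scaleR[OF assms(2), of "-1"]] by simp

lemma L2_inner_integrable:
  fixes h :: "real \<times> real \<Rightarrow> 'b::euclidean_space"
  assumes "h \<in> L2" "k \<in> L2"
  shows "integrable DM (\<lambda>z. h z \<bullet> k z)"
proof (rule Bochner_Integration.integrable_bound)
  note [measurable] = assms[THEN L2_measurable]
  show "integrable DM (\<lambda>z. (norm (h z))\<^sup>2 + (norm (k z))\<^sup>2)"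
    using assms[THEN L2_sq_integrable] by auto
  show "(\<lambda>z. h z \<bullet> k z) \<in> borel_measurable DM" by measurable
  have "\<bar>x \<bullet> y\<bar> \<le> (norm x)\<^sup>2 + (norm y)\<^sup>2" for x y :: 'b
  proof -
    have "\<bar>x \<bullet> y\<bar> \<le> norm x * norm y" by (rule Cauchy_Schwarz_ineq2)
    moreover have "2 * norm x * norm y \<le> (norm x)\<^sup>2 + (norm y)\<^sup>2" by (rule sum_squares_bound)
    moreover have "0 \<le> norm x * norm y" by simp
    ultimately show ?thesis by linarith
  qed
  then show "AE z in DM. norm (h z \<bullet> k z) \<le> norm ((norm (h z))\<^sup>2 + (norm (k z))\<^sup>2)" by simp
qed

lemma L2_mult_integrable: "h \<in> L2 \<Longrightarrow> k \<in> L2 \<Longrightarrow> integrable DM (\<lambda>z. h z * k z)"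
  for h k :: "real \<times> real \<Rightarrow> real"
  using L2_inner_integrable[of h k] by simp

lemma L2_const: "(\<lambda>z. c) \<in> L2" for c :: "'b::euclidean_space"
  by (auto simp: L2_def)

lemma nsq_expand:
  fixes h :: "real \<times> real \<Rightarrow> 'b::euclidean_space"
  assumes "h \<in> L2" "k \<in> L2"
  shows "nsq (\<lambda>z. h z + t *\<^sub>R k z) = nsq h + 2 * t * (LINT z|DM. h z \<bullet> k z) + t\<^sup>2 * nsq k"
proof -
  have "nsq (\<lambda>z. h z + t *\<^sub>R k z) = (LINT z|DM. (norm (h z))\<^sup>2 + (2 * t) * (h z \<bullet> k z) + t\<^sup>2 * (norm (k z))\<^sup>2)"
    unfolding power2_norm_eq_inner
    by (intro Bochner_Integration.integral_cong refl)
      (simp add: inner_add_left inner_add_right inner_commute power2_eq_square algebra_simps)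
  then show ?thesis
    using assms[THEN L2_sq_integrable] L2_inner_integrable[OF assms] by simp
qed

lemma nsq_scaleR: "nsq (\<lambda>z. c *\<^sub>R h z) = c\<^sup>2 * nsq h" for h :: "real \<times> real \<Rightarrow> 'b::euclidean_space"
  by (simp add: power_mult_distrib)

text \<open>
  The quadratic polynomial \<open>t \<mapsto> nsq (h + t k)\<close> is nonnegative, so its discriminant is not positive.
\<close>
lemma L2_Cauchy_Schwarz:
  fixes h :: "real \<times> real \<Rightarrow> 'b::euclidean_space"
  assumes "h \<in> L2" "k \<in> L2"
  shows "(LINT z|DM. h z \<bullet> k z)\<^sup>2 \<le> nsq h * nsq k"
proof -
  define c where "c = (LINT z|DM. h z \<bullet> k z)"
  have quad: "0 \<le> nsq h + 2 * t * c + t\<^sup>2 * nsq k" for t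
    using nsq_nonneg[of "\<lambda>z. h z + t *\<^sub>R k z"] by (simp add: nsq_expand[OF assms] c_def)
  show ?thesis
  proof (cases "nsq k = 0")
    case True
    have "c = 0"
    proof (rule ccontr)
      assume "c \<noteq> 0"
      with quad[of "- (nsq h + 1) / (2 * c)"] True show False by (simp add: field_simps)
    qed
    then show ?thesis using nsq_nonneg[of h] nsq_nonneg[of k] by (simp add: c_def)
  next
    case False
    then have k: "nsq k > 0" using nsq_nonneg[of k] by (simp only: order_less_le) simp
    have "0 \<le> nsq h - c\<^sup>2 / nsq k"
      using quad[of "- c / nsq k"] k by (simp add: field_simps power2_eq_square)
    then show ?thesis using k by (simp add: c_def field_simps)
  qed
qed

lemma nsq_add_le:
  fixes h :: "real \<times> real \<Rightarrow> 'b::euclidean_space"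
  assumes "h \<in> L2" "k \<in> L2"
  shows "nsq (\<lambda>z. h z + k z) \<le> 2 * nsq h + 2 * nsq k"
  using nsq_expand[OF assms, of 1] nsq_expand[OF assms, of "-1"] nsq_nonneg[of "\<lambda>z. h z + (-1) *\<^sub>R k z"]
  by simp

text \<open>
  Strong convergence implies weak convergence; this is how weak gradients and energies pass to the
  limit along approximating sequences.
\<close>
lemma L2_tendsto_inner:
  fixes h :: "nat \<Rightarrow> real \<times> real \<Rightarrow> 'b::euclidean_space"
  assumes h: "\<And>n. h n \<in> L2" "g \<in> L2" and w: "w \<in> L2" and lim: "(\<lambda>n. nsq (\<lambda>z. h n z - g z)) \<longlonglongrightarrow> 0"
  shows "(\<lambda>n. LINT z|DM. h n z \<bullet> w z) \<longlonglongrightarrow> (LINT z|DM. g z \<bullet> w z)"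
proof -
  have "((LINT z|DM. h n z \<bullet> w z) - (LINT z|DM. g z \<bullet> w z))\<^sup>2 \<le> nsq (\<lambda>z. h n z - g z) * nsq w" for n
    using L2_Cauchy_Schwarz[OF L2_diff[OF h(1) h(2)] w, of n] L2_inner_integrable[OF h(1) w] L2_inner_integrable[OF h(2) w]
    by (simp add: inner_diff_left)
  moreover have "(\<lambda>n. nsq (\<lambda>z. h n z - g z) * nsq w) \<longlonglongrightarrow> 0"
    using tendsto_mult_right[OF lim, of "nsq w"] by simp
  ultimately have "(\<lambda>n. ((LINT z|DM. h n z \<bullet> w z) - (LINT z|DM. g z \<bullet> w z))\<^sup>2) \<longlonglongrightarrow> 0"
    by (rule_tac tendsto_sandwich[OF _ _ tendsto_const]) auto
  then have "(\<lambda>n. sqrt (((LINT z|DM. h n z \<bullet> w z) - (LINT z|DM. g z \<bullet> w z))\<^sup>2)) \<longlonglongrightarrow> sqrt 0"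
    by (rule tendsto_real_sqrt)
  then show ?thesis
    by (simp add: LIM_zero_iff tendsto_rabs_zero_iff)
qed

text \<open>
  The Riesz-Fischer theorem. Along a subsequence whose increments have norms at most \<open>2\<^sup>-\<^sup>k\<close>, the
  increments are summable in \<open>L\<^sup>1\<close> because \<open>D\<close> has measure one; hence the subsequence converges
  almost everywhere, and Fatou's lemma turns the Cauchy condition into convergence to that limit.
\<close>
lemma L2_complete:
  fixes h :: "nat \<Rightarrow> real \<times> real \<Rightarrow> 'b::euclidean_space"
  assumes h: "\<And>n. h n \<in> L2"
    and Cauchy: "\<And>e. e > 0 \<Longrightarrow> \<exists>N. \<forall>m\<ge>N. \<forall>n\<ge>N. nsq (\<lambda>z. h m z - h n z) < e"
  shows "\<exists>g\<in>L2. (\<lambda>n. nsq (\<lambda>z. h n z - g z)) \<longlonglongrightarrow> 0"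
proof -
  note [measurable] = h[THEN L2_measurable]
  have hd: "(\<lambda>z. h m z - h n z) \<in> L2" for m n by (intro L2_diff h)
  have step: "\<exists>N. \<forall>m\<ge>N. \<forall>n\<ge>N. nsq (\<lambda>z. h m z - h n z) < (1/4) ^ k" for k :: nat
    by (rule Cauchy) simp
  \<comment> \<open>The bound \<open>1/4\<^sup>k\<close> on squared norms is \<open>1/2\<^sup>k\<close> on norms.\<close>
  have "\<exists>r. \<forall>k. (\<forall>m\<ge>r k. \<forall>n\<ge>r k. nsq (\<lambda>z. h m z - h n z) < (1/4)^k) \<and> r k < r (Suc k)"
  proof (rule dependent_nat_choice)
    show "\<exists>x. \<forall>m\<ge>x. \<forall>n\<ge>x. nsq (\<lambda>z. h m z - h n z) < (1 / 4) ^ 0" by (rule step)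
    fix x k
    obtain N where "\<forall>m\<ge>N. \<forall>n\<ge>N. nsq (\<lambda>z. h m z - h n z) < (1 / 4) ^ Suc k" using step by blast
    then show "\<exists>y. (\<forall>m\<ge>y. \<forall>n\<ge>y. nsq (\<lambda>z. h m z - h n z) < (1 / 4) ^ Suc k) \<and> x < y"
      by (intro exI[of _ "max N (Suc x)"]) (simp del: power_Suc)
  qed
  then obtain r where r: "\<And>k m n. m \<ge> r k \<Longrightarrow> n \<ge> r k \<Longrightarrow> nsq (\<lambda>z. h m z - h n z) < (1/4)^k"
    and rS: "\<And>k. r k < r (Suc k)" by blast
  have "strict_mono r" using rS by (simp add: strict_mono_Suc_iff)
  define d where "d k z = h (r (Suc k)) z - h (r k) z" for k z
  have dL2: "d k \<in> L2" for k unfolding d_def by (rule hd)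
  note [measurable] = dL2[THEN L2_measurable]
  have nd: "(\<lambda>z. norm (d k z)) \<in> L2" for k
    using L2_sq_integrable[OF dL2, of k] by (simp add: L2_def)
  have nd_int: "integrable DM (\<lambda>z. norm (d k z))" for k
    using L2_mult_integrable[OF nd L2_const, of k 1] by simp
  have d1: "(LINT z|DM. norm (d k z)) \<le> (1/2)^k" for k
  proof -
    have "(LINT z|DM. norm (d k z))\<^sup>2 \<le> nsq (\<lambda>z. norm (d k z)) * nsq (\<lambda>z. 1::real)"
      using L2_Cauchy_Schwarz[OF nd L2_const, of k 1] by simp
    also have "\<dots> = nsq (d k)" by (simp add: measure_D)
    also have "\<dots> \<le> (1/4)^k" unfolding d_def using rS[of k] by (intro r[THEN less_imp_le]) auto
    also have "\<dots> = ((1/2)^k)\<^sup>2" by (simp add: power2_eq_square flip: power_mult_distrib)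
    finally show ?thesis by (rule power2_le_imp_le) simp
  qed
  have "(\<integral>\<^sup>+ z. (\<Sum>k. ennreal (norm (d k z))) \<partial>DM) = (\<Sum>k. \<integral>\<^sup>+ z. ennreal (norm (d k z)) \<partial>DM)"
    by (rule nn_integral_suminf) simp
  also have "\<dots> \<le> (\<Sum>k. ennreal ((1/2)^k))"
    using d1 nd_int by (intro suminf_le) (auto simp: nn_integral_eq_integral intro: ennreal_leI)
  also have "\<dots> = ennreal (\<Sum>k. (1/2)^k)"
    by (intro suminf_ennreal2) (auto simp: summable_geometric)
  finally have "(\<integral>\<^sup>+ z. (\<Sum>k. ennreal (norm (d k z))) \<partial>DM) \<noteq> \<infinity>"
    by (auto simp: top_unique)
  then have "AE z in DM. (\<Sum>k. ennreal (norm (d k z))) \<noteq> \<infinity>"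
    by (rule nn_integral_noteq_infinite[rotated]) simp
  then have conv: "AE z in DM. convergent (\<lambda>k. h (r k) z)"
  proof eventually_elim
    fix z assume "(\<Sum>k. ennreal (norm (d k z))) \<noteq> \<infinity>"
    then have "summable (\<lambda>k. norm (d k z))" by (intro summable_suminf_not_top) auto
    then have "summable (\<lambda>k. d k z)" by (rule summable_norm_cancel)
    then have "convergent (\<lambda>n. \<Sum>k<n. d k z)" by (simp add: summable_iff_convergent)
    moreover have "(\<Sum>k<n. d k z) = h (r n) z - h (r 0) z" for n
      by (simp add: d_def sum_lessThan_telescope[of "\<lambda>k. h (r k) z"])
    ultimately have "convergent (\<lambda>n. h (r n) z - h (r 0) z)" by simp
    then show "convergent (\<lambda>k. h (r k) z)" by (simp add: convergent_diff_const_right_iff)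
  qed
  define g where "g z = lim (\<lambda>k. h (r k) z)" for z
  have g [measurable]: "g \<in> borel_measurable DM"
    unfolding g_def by (rule borel_measurable_lim_metric) simp
  have fatou: "(\<integral>\<^sup>+ z. ennreal ((norm (h n z - g z))\<^sup>2) \<partial>DM) \<le> ennreal e"
    if e: "\<And>m. m \<ge> N \<Longrightarrow> nsq (\<lambda>z. h n z - h m z) \<le> e" for n N e
  proof -
    have "(\<integral>\<^sup>+ z. ennreal ((norm (h n z - g z))\<^sup>2) \<partial>DM) =
        (\<integral>\<^sup>+ z. liminf (\<lambda>k. ennreal ((norm (h n z - h (r k) z))\<^sup>2)) \<partial>DM)"
    proof (rule nn_integral_cong_AE, use conv in eventually_elim)
      fix z assume "convergent (\<lambda>k. h (r k) z)"
      then have "(\<lambda>k. h (r k) z) \<longlonglongrightarrow> g z" by (simp add: g_def convergent_LIMSEQ_iff)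
      then have "(\<lambda>k. ennreal ((norm (h n z - h (r k) z))\<^sup>2)) \<longlonglongrightarrow> ennreal ((norm (h n z - g z))\<^sup>2)"
        by (intro tendsto_intros)
      then show "ennreal ((norm (h n z - g z))\<^sup>2) = liminf (\<lambda>k. ennreal ((norm (h n z - h (r k) z))\<^sup>2))"
        by (rule lim_imp_Liminf[OF trivial_limit_sequentially, symmetric])
    qed
    also have "\<dots> \<le> liminf (\<lambda>k. \<integral>\<^sup>+ z. ennreal ((norm (h n z - h (r k) z))\<^sup>2) \<partial>DM)"
      by (rule nn_integral_liminf) simp
    also have "\<dots> = liminf (\<lambda>k. ennreal (nsq (\<lambda>z. h n z - h (r k) z)))"
      using L2_sq_integrable[OF hd] by (simp add: nn_integral_eq_integral)
    also have "\<dots> \<le> ennreal e"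
    proof (rule Liminf_le)
      have "eventually (\<lambda>k. r k \<ge> N) sequentially"
        using \<open>strict_mono r\<close> filterlim_subseq by (auto simp: filterlim_at_top)
      then show "\<forall>\<^sub>F k in sequentially. ennreal (nsq (\<lambda>z. h n z - h (r k) z)) \<le> ennreal e"
        by eventually_elim (intro ennreal_leI e)
    qed simp
    finally show ?thesis .
  qed
  have hg: "(\<lambda>z. h n z - g z) \<in> L2 \<and> nsq (\<lambda>z. h n z - g z) \<le> e"
    if e: "\<And>m. m \<ge> N \<Longrightarrow> nsq (\<lambda>z. h n z - h m z) \<le> e" for n N e
  proof -
    have "0 \<le> e" using order_trans[OF nsq_nonneg e[of N]] by simp
    note f = fatou[OF e]
    have int: "integrable DM (\<lambda>z. (norm (h n z - g z))\<^sup>2)"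
      using f by (intro integrableI_bounded) (auto simp: less_top[symmetric] top_unique)
    then have "ennreal (nsq (\<lambda>z. h n z - g z)) \<le> ennreal e"
      using f by (simp add: nn_integral_eq_integral)
    then show ?thesis using int \<open>0 \<le> e\<close> by (simp add: L2_def)
  qed
  obtain N where N: "\<forall>m\<ge>N. \<forall>n\<ge>N. nsq (\<lambda>z. h m z - h n z) < 1" using Cauchy[of 1] by auto
  then have "(\<lambda>z. h N z - g z) \<in> L2" using hg[of N N 1] by (auto simp: less_imp_le)
  from L2_diff[OF h[of N] this] have "g \<in> L2" by simp
  moreover have "(\<lambda>n. nsq (\<lambda>z. h n z - g z)) \<longlonglongrightarrow> 0"
  proof (rule LIMSEQ_I)
    fix e :: real assume "0 < e"
    then obtain N where N: "\<forall>m\<ge>N. \<forall>n\<ge>N. nsq (\<lambda>z. h m z - h n z) < e / 2" using Cauchy[of "e/2"] by auto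
    show "\<exists>N. \<forall>n\<ge>N. norm (nsq (\<lambda>z. h n z - g z) - 0) < e"
    proof (intro exI allI impI)
      fix n assume "N \<le> n"
      then have "nsq (\<lambda>z. h n z - g z) \<le> e / 2" using hg[of N n "e/2"] N by (auto simp: less_imp_le)
      then show "norm (nsq (\<lambda>z. h n z - g z) - 0) < e" using \<open>0 < e\<close> nsq_nonneg[of "\<lambda>z. h n z - g z"] by simp
    qed
  qed
  ultimately show ?thesis by blast
qed

section \<open>Smooth functions with compact support\<close>

text \<open>
  \<open>smooth1 k f\<close> says that \<open>f\<close> is \<open>k\<close> times continuously differentiable on the line. The derivative
  is existentially quantified, which makes the closure properties direct inductions on \<open>k\<close>.
\<close>
fun smooth1 :: "nat \<Rightarrow> (real \<Rightarrow> real) \<Rightarrow> bool" where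
  "smooth1 0 f \<longleftrightarrow> continuous_on UNIV f"
| "smooth1 (Suc k) f \<longleftrightarrow> (\<exists>f'. (\<forall>x. (f has_real_derivative f' x) (at x)) \<and> smooth1 k f')"

lemma smooth1_SucD: "smooth1 (Suc k) f \<Longrightarrow> smooth1 k f"
proof (induction k arbitrary: f)
  case 0
  then obtain f' where "\<And>x. (f has_real_derivative f' x) (at x)" by auto
  then show ?case using DERIV_continuous_on[of UNIV f f'] by simp
next
  case (Suc k)
  then show ?case by (metis smooth1.simps(2))
qed

lemma smooth1_const: "smooth1 k (\<lambda>_. c)"
proof (induction k arbitrary: c)
  case (Suc k)
  have "\<forall>x. ((\<lambda>_. c) has_real_derivative (\<lambda>_. 0) x) (at x)" by simp
  then show ?case unfolding smooth1.simps using Suc[of 0] by (intro exI[of _ "\<lambda>_. 0"]) simp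
qed simp

lemma smooth1_add: "smooth1 k f \<Longrightarrow> smooth1 k g \<Longrightarrow> smooth1 k (\<lambda>x. f x + g x)"
proof (induction k arbitrary: f g)
  case 0
  then show ?case by (auto intro: continuous_on_add)
next
  case (Suc k)
  then obtain f' g' where "\<forall>x. (f has_real_derivative f' x) (at x)" "smooth1 k f'"
    "\<forall>x. (g has_real_derivative g' x) (at x)" "smooth1 k g'" by auto
  then show ?case unfolding smooth1.simps using Suc.IH by (intro exI[of _ "\<lambda>x. f' x + g' x"] conjI allI DERIV_add) auto
qed

lemma smooth1_mult: "smooth1 k f \<Longrightarrow> smooth1 k g \<Longrightarrow> smooth1 k (\<lambda>x. f x * g x)"
proof (induction k arbitrary: f g)
  case 0
  then show ?case by (auto intro: continuous_on_mult)
next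
  case (Suc k)
  then obtain f' g' where *: "\<forall>x. (f has_real_derivative f' x) (at x)" "smooth1 k f'"
    "\<forall>x. (g has_real_derivative g' x) (at x)" "smooth1 k g'" by auto
  moreover have "smooth1 k f" "smooth1 k g" using Suc.prems by (blast intro: smooth1_SucD)+
  ultimately show ?case unfolding smooth1.simps using Suc.IH
    by (intro exI[of _ "\<lambda>x. f' x * g x + g' x * f x"] conjI allI DERIV_mult smooth1_add) auto
qed

lemma smooth1_affine: "smooth1 k f \<Longrightarrow> smooth1 k (\<lambda>x. f (a * x + b))"
proof (induction k arbitrary: f)
  case 0
  have "continuous_on UNIV (\<lambda>x. a * x + b)" by (intro continuous_intros)
  then show ?case using 0 continuous_on_compose2[of UNIV f UNIV "\<lambda>x. a * x + b"] by simp
next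
  case (Suc k)
  then obtain f' where f': "\<forall>x. (f has_real_derivative f' x) (at x)" "smooth1 k f'"
    unfolding smooth1.simps by blast
  have aff: "((\<lambda>x. a * x + b) has_real_derivative a) (at x)" for x
    using DERIV_add[OF DERIV_cmult_Id[of a x UNIV] DERIV_const[of b "at x"]] by simp
  have "((\<lambda>x. f (a * x + b)) has_real_derivative f' (a * x + b) * a) (at x)" for x
    by (rule DERIV_chain2[OF f'(1)[rule_format] aff])
  moreover have "smooth1 k (\<lambda>x. f' (a * x + b) * a)"
    by (rule smooth1_mult[OF Suc.IH[OF f'(2)] smooth1_const])
  ultimately show ?case unfolding smooth1.simps
    by (intro exI[of _ "\<lambda>x. f' (a * x + b) * a"] conjI allI)
qed

text \<open>
  Cauchy's function \<open>e\<^sup>-\<^sup>1\<^sup>/\<^sup>t\<close> extended by zero is the member \<open>n = 0\<close>. The powers of \<open>1/t\<close> are included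
  because they are what differentiation produces: the linear span of the family is closed under
  derivatives, so all its members are smooth.
\<close>
definition exp_recip :: "nat \<Rightarrow> real \<Rightarrow> real" where
  "exp_recip n t = (if t > 0 then (1/t) ^ n * exp (- (1/t)) else 0)"

text \<open>
  At the origin from the right, \<open>x\<^sup>n / e\<^sup>x \<longrightarrow> 0\<close> at infinity is used with \<open>x = 1/t\<close>.
\<close>
lemma exp_recip_tendsto_0: "(exp_recip n \<longlongrightarrow> 0) (at 0)"
proof (rule filterlim_split_at)
  have "eventually (\<lambda>t. t < 0) (at_left (0::real))" by (simp add: eventually_at_filter)
  then have "eventually (\<lambda>t. 0 = exp_recip n t) (at_left 0)"
    by eventually_elim (simp add: exp_recip_def)
  then show "(exp_recip n \<longlongrightarrow> 0) (at_left 0)"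
    by (rule Lim_transform_eventually[OF tendsto_const])
  have "((\<lambda>t. (inverse t) ^ n / exp (inverse t)) \<longlongrightarrow> 0) (at_right (0::real))"
    by (rule filterlim_compose[OF tendsto_power_div_exp_0 filterlim_inverse_at_top_right])
  moreover have "eventually (\<lambda>t. t > 0) (at_right (0::real))" by (simp add: eventually_at_filter)
  then have "eventually (\<lambda>t. (inverse t) ^ n / exp (inverse t) = exp_recip n t) (at_right 0)"
    by eventually_elim (simp add: exp_recip_def exp_minus divide_inverse)
  ultimately show "(exp_recip n \<longlongrightarrow> 0) (at_right 0)"
    by (rule Lim_transform_eventually)
qed

text \<open>
  At \<open>t = 0\<close> the difference quotient of member \<open>n\<close> is exactly member \<open>n + 1\<close>, which tends to zero.
\<close>
lemma exp_recip_deriv: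
  "(exp_recip n has_real_derivative (- real n) * exp_recip (n + 1) t + exp_recip (n + 2) t) (at t)"
proof (cases "t = 0")
  case True
  have "((\<lambda>h. (exp_recip n (0 + h) - exp_recip n 0) / h) \<longlongrightarrow> 0) (at 0)"
  proof (rule Lim_transform_eventually[OF exp_recip_tendsto_0[of "n + 1"]])
    show "\<forall>\<^sub>F h in at 0. exp_recip (n + 1) h = (exp_recip n (0 + h) - exp_recip n 0) / h"
      by (intro always_eventually allI) (simp add: exp_recip_def)
  qed
  then show ?thesis by (simp add: DERIV_def True exp_recip_def)
next
  case False
  show ?thesis
  proof (cases "t > 0")
    case True
    have i: "((\<lambda>t. 1/t) has_real_derivative - ((1/t)\<^sup>2)) (at t)"
      using True by (auto intro!: derivative_eq_intros simp: power2_eq_square)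
    have p: "((\<lambda>t. (1/t) ^ n) has_real_derivative (- real n) * (1/t) ^ (n + 1)) (at t)"
      by (rule DERIV_cong[OF DERIV_power[OF i, of n]])
        (cases n; simp add: power2_eq_square algebra_simps add_divide_distrib diff_divide_distrib)
    have e: "((\<lambda>t. exp (- (1/t))) has_real_derivative exp (- (1/t)) * (1/t)\<^sup>2) (at t)"
      using DERIV_fun_exp[OF DERIV_minus[OF i]] by simp
    have "((\<lambda>t. (1/t) ^ n * exp (- (1/t))) has_real_derivative
        (- real n) * exp_recip (n + 1) t + exp_recip (n + 2) t) (at t)"
      using DERIV_mult[OF p e] True by (simp add: exp_recip_def power2_eq_square mult_ac)
    then show ?thesis
      by (rule has_field_derivative_transform_within_open[of _ _ _ "{0<..}"]) (use True in \<open>auto simp: exp_recip_def\<close>)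
  next
    case neg: False
    have "((\<lambda>_. 0) has_real_derivative (- real n) * exp_recip (n + 1) t + exp_recip (n + 2) t) (at t)"
      using neg by (simp add: exp_recip_def)
    then show ?thesis
      by (rule has_field_derivative_transform_within_open[of _ _ _ "{..<0}"])
        (use neg False in \<open>auto simp: exp_recip_def\<close>)
  qed
qed

lemma smooth1_exp_recip: "smooth1 k (exp_recip n)"
proof (induction k arbitrary: n)
  case 0
  have "continuous_on UNIV (exp_recip n)"
    by (rule DERIV_continuous_on, rule has_field_derivative_at_within, rule exp_recip_deriv)
  then show ?case by simp
next
  case (Suc k)
  have "smooth1 k (\<lambda>t. (- real n) * exp_recip (n + 1) t + exp_recip (n + 2) t)"
    by (intro smooth1_add smooth1_mult smooth1_const Suc)
  then show ?case unfolding smooth1.simps using exp_recip_deriv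
    by (intro exI[of _ "\<lambda>t. (- real n) * exp_recip (n + 1) t + exp_recip (n + 2) t"]) simp
qed

lemma Ck_add: "Ck k \<phi> \<Longrightarrow> Ck k \<psi> \<Longrightarrow> Ck k (\<lambda>z. \<phi> z + \<psi> z)"
proof (induction k arbitrary: \<phi> \<psi>)
  case 0
  then show ?case by (simp add: continuous_on_add)
next
  case (Suc k)
  note prems = Suc.prems[unfolded Ck.simps]
  have der: "((\<lambda>z. \<phi> z + \<psi> z) has_derivative (\<lambda>e. frechet_derivative \<phi> (at z) e + frechet_derivative \<psi> (at z) e)) (at z)" for z
    using prems by (intro has_derivative_add frechet_derivative_works[THEN iffD1]) blast+
  have fd: "frechet_derivative (\<lambda>z. \<phi> z + \<psi> z) (at z) = (\<lambda>e. frechet_derivative \<phi> (at z) e + frechet_derivative \<psi> (at z) e)" for z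
    by (rule frechet_derivative_at[OF der, symmetric])
  show ?case unfolding Ck.simps fd
  proof (intro conjI allI ballI)
    show "(\<lambda>z. \<phi> z + \<psi> z) differentiable at z" for z by (rule differentiableI[OF der])
    fix e :: "real \<times> real" assume "e \<in> Basis"
    then show "Ck k (\<lambda>z. frechet_derivative \<phi> (at z) e + frechet_derivative \<psi> (at z) e)"
      using prems by (intro Suc.IH) blast+
  qed
qed

lemma Ck_cmult: "Ck k \<phi> \<Longrightarrow> Ck k (\<lambda>z. c * \<phi> z)"
proof (induction k arbitrary: \<phi>)
  case 0
  then show ?case by (simp add: continuous_on_mult_left)
next
  case (Suc k)
  note prems = Suc.prems[unfolded Ck.simps]
  have der: "((\<lambda>z. c * \<phi> z) has_derivative (\<lambda>e. c * frechet_derivative \<phi> (at z) e)) (at z)" for z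
    using prems by (intro has_derivative_mult_right frechet_derivative_works[THEN iffD1]) blast
  have fd: "frechet_derivative (\<lambda>z. c * \<phi> z) (at z) = (\<lambda>e. c * frechet_derivative \<phi> (at z) e)" for z
    by (rule frechet_derivative_at[OF der, symmetric])
  show ?case unfolding Ck.simps fd
  proof (intro conjI allI ballI)
    show "(\<lambda>z. c * \<phi> z) differentiable at z" for z by (rule differentiableI[OF der])
    fix e :: "real \<times> real" assume "e \<in> Basis"
    then show "Ck k (\<lambda>z. c * frechet_derivative \<phi> (at z) e)"
      using prems by (intro Suc.IH) blast
  qed
qed

lemma Basis_plane: "Basis = {(1, 0), (0, 1) :: real \<times> real}"
  by (auto simp: Basis_prod_def)

text \<open>
  Both partial derivatives of a product of a function of \<open>x\<close> and a function of \<open>y\<close> are again such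
  products, so the induction stays within this class.
\<close>
lemma Ck_tensor:
  "smooth1 k g \<Longrightarrow> smooth1 k h \<Longrightarrow> Ck k (\<lambda>z. g (fst z) * h (snd z))"
proof (induction k arbitrary: g h)
  case 0
  have "continuous_on UNIV (\<lambda>z::real \<times> real. g (fst z))" "continuous_on UNIV (\<lambda>z::real \<times> real. h (snd z))"
    using 0 by (auto intro!: continuous_on_compose2[of UNIV g] continuous_on_compose2[of UNIV h] continuous_intros)
  then show ?case by (auto intro: continuous_on_mult)
next
  case (Suc k)
  then obtain g' h' where g': "\<And>x. (g has_real_derivative g' x) (at x)" "smooth1 k g'"
    and h': "\<And>x. (h has_real_derivative h' x) (at x)" "smooth1 k h'" by auto
  have gh: "smooth1 k g" "smooth1 k h" using Suc.prems smooth1_SucD by blast+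
  have dg: "((\<lambda>z::real \<times> real. g (fst z)) has_derivative (\<lambda>e. g' (fst z) * fst e)) (at z)" for z
    by (rule has_derivative_compose[of fst fst z UNIV g, OF _ g'(1)[unfolded has_field_derivative_def]])
      (auto intro!: derivative_eq_intros)
  have dh: "((\<lambda>z::real \<times> real. h (snd z)) has_derivative (\<lambda>e. h' (snd z) * snd e)) (at z)" for z
    by (rule has_derivative_compose[of snd snd z UNIV h, OF _ h'(1)[unfolded has_field_derivative_def]])
      (auto intro!: derivative_eq_intros)
  have der: "((\<lambda>z. g (fst z) * h (snd z)) has_derivative
      (\<lambda>e. g (fst z) * (h' (snd z) * snd e) + g' (fst z) * fst e * h (snd z))) (at z)" for z
    by (rule has_derivative_mult[OF dg dh])
  have fd: "frechet_derivative (\<lambda>z. g (fst z) * h (snd z)) (at z) =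
      (\<lambda>e. g (fst z) * (h' (snd z) * snd e) + g' (fst z) * fst e * h (snd z))" for z
    by (rule frechet_derivative_at[OF der, symmetric])
  show ?case
    unfolding Ck.simps fd
  proof (intro conjI allI ballI)
    show "(\<lambda>z. g (fst z) * h (snd z)) differentiable at z" for z by (rule differentiableI[OF der])
    fix e :: "real \<times> real" assume "e \<in> Basis"
    then have "e = (1, 0) \<or> e = (0, 1)" by (simp add: Basis_plane)
    then show "Ck k (\<lambda>z. g (fst z) * (h' (snd z) * snd e) + g' (fst z) * fst e * h (snd z))"
      using Suc.IH[OF g'(2) gh(2)] Suc.IH[OF gh(1) h'(2)] by auto
  qed
qed

lemma compact_closed_subset: "compact T \<Longrightarrow> closed S \<Longrightarrow> S \<subseteq> T \<Longrightarrow> compact S"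
  using compact_Int_closed[of T S] by (simp add: Int_absorb1)

lemma test_function_add:
  assumes "test_function \<phi>" "test_function \<psi>"
  shows "test_function (\<lambda>z. \<phi> z + \<psi> z)"
proof -
  let ?S = "\<lambda>\<phi>. closure {z. \<phi> z \<noteq> 0}"
  have sub: "?S (\<lambda>z. \<phi> z + \<psi> z) \<subseteq> ?S \<phi> \<union> ?S \<psi>"
    unfolding closure_Un[symmetric] by (intro closure_mono) auto
  moreover have "compact (?S \<phi> \<union> ?S \<psi>)" using assms by (auto simp: test_function_def)
  ultimately have "compact (?S (\<lambda>z. \<phi> z + \<psi> z))"
    by (rule compact_closed_subset[OF _ closed_closure, rotated])
  then show ?thesis using assms sub by (auto simp: test_function_def intro: Ck_add)
qed

lemma test_function_cmult:
  assumes "test_function \<phi>"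
  shows "test_function (\<lambda>z. c * \<phi> z)"
proof -
  let ?S = "\<lambda>\<phi>. closure {z. \<phi> z \<noteq> 0}"
  have sub: "?S (\<lambda>z. c * \<phi> z) \<subseteq> ?S \<phi>"
    by (intro closure_mono) auto
  moreover have "compact (?S \<phi>)" using assms by (auto simp: test_function_def)
  ultimately have "compact (?S (\<lambda>z. c * \<phi> z))"
    by (rule compact_closed_subset[OF _ closed_closure, rotated])
  then show ?thesis using assms sub by (auto simp: test_function_def intro: Ck_cmult)
qed

lemma test_function_diff:
  assumes "test_function \<phi>" "test_function \<psi>"
  shows "test_function (\<lambda>z. \<phi> z - \<psi> z)"
  using test_function_add[OF assms(1) test_function_cmult[OF assms(2), of "-1"]] by simp

text \<open>
  Smooth functions on the line supported in \<open>[a + 1/m, b - 1/m]\<close> that tend to the indicator of the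
  open interval as \<open>m\<close> grows. The shift by \<open>-1\<close> keeps the support away from the end points, so
  that boxes touching the boundary of \<open>D\<close> are also reached by test functions.
\<close>
definition bump1 :: "nat \<Rightarrow> real \<Rightarrow> real \<Rightarrow> real \<Rightarrow> real" where
  "bump1 m a b t = exp_recip 0 (real m * (t - a) - 1) * exp_recip 0 (real m * (b - t) - 1)"

lemma smooth1_bump1: "smooth1 k (bump1 m a b)"
proof -
  have "smooth1 k (\<lambda>t. exp_recip 0 (real m * t + (- real m * a - 1)) * exp_recip 0 (- real m * t + (real m * b - 1)))"
    by (intro smooth1_mult smooth1_affine smooth1_exp_recip)
  moreover have eq: "real m * (t - a) - 1 = real m * t + (- real m * a - 1)"
    "real m * (b - t) - 1 = - real m * t + (real m * b - 1)" for t
    by (simp_all add: algebra_simps)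
  ultimately show ?thesis unfolding bump1_def eq by simp
qed

lemma bump1_support:
  assumes "m > 0" "bump1 m a b t \<noteq> 0"
  shows "a + 1 / real m \<le> t" "t \<le> b - 1 / real m"
proof -
  have "real m * (t - a) - 1 > 0" "real m * (b - t) - 1 > 0"
  proof -
    have "exp_recip 0 s = 0" if "\<not> s > 0" for s using that by (simp add: exp_recip_def)
    then show "real m * (t - a) - 1 > 0" "real m * (b - t) - 1 > 0"
      using assms(2) unfolding bump1_def mult_eq_0_iff by blast+
  qed
  then show "a + 1 / real m \<le> t" "t \<le> b - 1 / real m" using assms(1) by (simp_all add: field_simps)
qed

lemma bump1_bounds: "0 \<le> bump1 m a b t" "bump1 m a b t \<le> 1"
proof -
  have "0 \<le> exp_recip 0 s" "exp_recip 0 s \<le> 1" for s by (auto simp: exp_recip_def)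
  then show "0 \<le> bump1 m a b t" "bump1 m a b t \<le> 1" unfolding bump1_def by (auto intro: mult_le_one)
qed

lemma exp_recip_scaled_tendsto:
  "(\<lambda>m. exp_recip 0 (real m * s - 1)) \<longlonglongrightarrow> (if s > 0 then 1 else 0)"
proof (cases "s > 0")
  case True
  have lim: "filterlim (\<lambda>m. real m * s - 1) at_top sequentially"
  proof -
    have "filterlim (\<lambda>m. - 1 + real m * s) at_top sequentially"
      by (intro filterlim_tendsto_add_at_top[OF tendsto_const] filterlim_at_top_mult_tendsto_pos[OF tendsto_const True]
          filterlim_real_sequentially)
    then show ?thesis by simp
  qed
  then have "((\<lambda>m. exp (- (1 / (real m * s - 1)))) \<longlongrightarrow> exp (- 0)) sequentially"
    by (intro tendsto_intros tendsto_divide_0[OF tendsto_const] filterlim_mono[OF lim at_top_le_at_infinity]) auto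
  moreover have "eventually (\<lambda>m. exp (- (1 / (real m * s - 1))) = exp_recip 0 (real m * s - 1)) sequentially"
    using lim[unfolded filterlim_at_top_dense, rule_format, of 0] by eventually_elim (simp add: exp_recip_def)
  ultimately show ?thesis using True by (auto intro: Lim_transform_eventually)
next
  case False
  then have "real m * s - 1 \<le> 0" for m by (smt (verit) mult_nonneg_nonpos of_nat_0_le_iff)
  then have "exp_recip 0 (real m * s - 1) = 0" for m by (auto simp: exp_recip_def not_less)
  then show ?thesis using False by simp
qed

lemma bump1_tendsto: "(\<lambda>m. bump1 m a b t) \<longlonglongrightarrow> indicator {a<..<b} t"
proof -
  have "(\<lambda>m. bump1 m a b t) \<longlonglongrightarrow> (if t - a > 0 then 1 else 0) * (if b - t > 0 then 1 else 0)"
    unfolding bump1_def by (intro tendsto_mult exp_recip_scaled_tendsto)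
  moreover have "(if t - a > 0 then 1 else 0) * (if b - t > 0 then 1 else 0) = (indicator {a<..<b} t :: real)"
    by (simp add: indicator_def)
  ultimately show ?thesis by (simp only:)
qed

lemma test_function_bump:
  assumes "m > 0" "{a<..<b} \<times> {c<..<d} \<subseteq> D" "a < b" "c < d"
  shows "test_function (\<lambda>z. bump1 m a b (fst z) * bump1 m c d (snd z))"
proof -
  let ?K = "{a + 1 / real m .. b - 1 / real m} \<times> {c + 1 / real m .. d - 1 / real m}"
  have "closure {z. bump1 m a b (fst z) * bump1 m c d (snd z) \<noteq> 0} \<subseteq> ?K"
    using bump1_support[OF assms(1)] by (intro closure_minimal closed_Times) fastforce+
  moreover have "compact ?K" by (intro compact_Times compact_Icc)
  moreover have "?K \<subseteq> {a<..<b} \<times> {c<..<d}" using assms(1) by auto (smt (verit) divide_pos_pos of_nat_0_less_iff)+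
  ultimately show ?thesis using assms(2) unfolding test_function_def
    by (intro conjI allI Ck_tensor smooth1_bump1) (blast intro: compact_closed_subset[OF _ closed_closure])+
qed

section \<open>Weak gradients\<close>

lemma continuous_L2:
  fixes g :: "real \<times> real \<Rightarrow> 'b::euclidean_space"
  assumes "continuous_on UNIV g"
  shows "g \<in> L2"
proof -
  have "compact (g ` cbox (0, 0) (1, 1))"
    by (rule compact_continuous_image[OF continuous_on_subset[OF assms] compact_cbox]) simp
  then have "bounded (g ` cbox (0, 0) (1, 1))" by (rule compact_imp_bounded)
  then obtain B where B: "\<And>z. z \<in> cbox (0, 0) (1, 1) \<Longrightarrow> norm (g z) \<le> B"
    unfolding bounded_iff by blast
  show ?thesis
  proof (rule L2_dominated)
    show "g \<in> borel_measurable DM"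
      by (rule measurable_lebesgue_on_D[OF borel_measurable_continuous_onI[OF assms]])
    show "integrable DM (\<lambda>_. B\<^sup>2)" by simp
    have "(norm (g z))\<^sup>2 \<le> B\<^sup>2" if "z \<in> space DM" for z
    proof -
      have "z \<in> D" using that by simp
      then have "z \<in> cbox (0, 0) (1, 1)" unfolding D_box by (rule subsetD[OF box_subset_cbox])
      from B[OF this] show ?thesis by (intro power_mono) auto
    qed
    then show "AE z in DM. (norm (g z))\<^sup>2 \<le> B\<^sup>2" by (rule AE_I2)
  qed
qed

lemma continuous_integrable_DM:
  fixes g :: "real \<times> real \<Rightarrow> real"
  shows "continuous_on UNIV g \<Longrightarrow> integrable DM g"
  using L2_mult_integrable[OF continuous_L2 L2_const, of g 1] by simp

lemma integral_DM_continuous: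
  fixes g :: "real \<times> real \<Rightarrow> real"
  assumes "continuous_on UNIV g"
  shows "(LINT z|DM. g z) = integral (cbox (0, 0) (1, 1)) g"
  using lebesgue_integral_eq_integral[OF continuous_integrable_DM[OF assms] D_sets(1)]
  by (simp add: D_box integral_open_interval)

text \<open>
  By Fubini the integral is taken first along the lines parallel to \<open>e\<close>; there the fundamental
  theorem of calculus leaves only boundary values, which vanish. Applied to a product this is
  integration by parts.
\<close>
lemma integral_directional_derivative_zero:
  fixes \<psi> :: "real \<times> real \<Rightarrow> real"
  assumes der: "\<And>z. (\<psi> has_derivative \<psi>' z) (at z)" and e: "e \<in> Basis"
    and cont: "continuous_on UNIV (\<lambda>z. \<psi>' z e)" and zero: "\<And>z. z \<notin> D \<Longrightarrow> \<psi> z = 0"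
  shows "(LINT z|DM. \<psi>' z e) = 0"
proof -
  have lin: "\<psi>' z (h *\<^sub>R v) = h * \<psi>' z v" for z h v
    using has_derivative_linear[OF der] by (simp add: linear_scale)
  \<comment> \<open>The fundamental theorem of calculus along a line \<open>\<gamma>\<close> with direction \<open>v\<close>.\<close>
  have ftc: "integral {0..1} (\<lambda>s. \<psi>' (\<gamma> s) v) = \<psi> (\<gamma> 1) - \<psi> (\<gamma> 0)"
    if \<gamma>: "\<And>s. (\<gamma> has_derivative (\<lambda>h. h *\<^sub>R v)) (at s within {0..1})" for \<gamma> :: "real \<Rightarrow> real \<times> real" and v
  proof (rule integral_unique[OF fundamental_theorem_of_calculus])
    fix s :: real
    have "((\<lambda>s. \<psi> (\<gamma> s)) has_derivative (\<lambda>h. \<psi>' (\<gamma> s) (h *\<^sub>R v))) (at s within {0..1})"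
      by (rule has_derivative_compose[OF \<gamma> der])
    then show "((\<lambda>s. \<psi> (\<gamma> s)) has_vector_derivative \<psi>' (\<gamma> s) v) (at s within {0..1})"
      by (simp add: has_vector_derivative_def lin)
  qed simp
  have "e = (1, 0) \<or> e = (0, 1)" using e by (simp add: Basis_plane)
  then have "integral (cbox (0, 0) (1, 1)) (\<lambda>z. \<psi>' z e) = 0"
  proof
    assume e: "e = (1, 0)"
    have row: "integral (cbox 0 1) (\<lambda>x. \<psi>' (x, y) e) = 0" for y
    proof -
      have "((\<lambda>s. (s, y)) has_derivative (\<lambda>h. h *\<^sub>R e)) (at s within {0..1})" for s
        using has_derivative_Pair[OF has_derivative_ident has_derivative_const[of y]] by (simp add: e)
      from ftc[OF this] show ?thesis by (simp add: zero D_def)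
    qed
    have "integral (cbox (0, 0) (1, 1)) (\<lambda>z. \<psi>' z e) = integral (cbox 0 1) (\<lambda>x. integral (cbox 0 1) (\<lambda>y. \<psi>' (x, y) e))"
      by (rule integral_prod_continuous[OF continuous_on_subset[OF cont]]) simp
    also have "\<dots> = integral (cbox 0 1) (\<lambda>y. integral (cbox 0 1) (\<lambda>x. \<psi>' (x, y) e))"
      by (rule integral_swap_continuous) (simp add: split_beta' continuous_on_subset[OF cont])
    finally show ?thesis unfolding row by simp
  next
    assume e: "e = (0, 1)"
    have col: "integral (cbox 0 1) (\<lambda>y. \<psi>' (x, y) e) = 0" for x
    proof -
      have "((\<lambda>s. (x, s)) has_derivative (\<lambda>h. h *\<^sub>R e)) (at s within {0..1})" for s
        using has_derivative_Pair[OF has_derivative_const[of x] has_derivative_ident] by (simp add: e)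
      from ftc[OF this] show ?thesis by (simp add: zero D_def)
    qed
    have "integral (cbox (0, 0) (1, 1)) (\<lambda>z. \<psi>' z e) = integral (cbox 0 1) (\<lambda>x. integral (cbox 0 1) (\<lambda>y. \<psi>' (x, y) e))"
      by (rule integral_prod_continuous[OF continuous_on_subset[OF cont]]) simp
    then show ?thesis unfolding col by simp
  qed
  then show ?thesis by (simp only: integral_DM_continuous[OF cont])
qed

text \<open>
  The classical gradient. For a test function the weak gradient selected by \<open>grad\<close> agrees with it
  only up to null sets, so the two must be kept apart.
\<close>
definition dgrad :: "(real \<times> real \<Rightarrow> real) \<Rightarrow> real \<times> real \<Rightarrow> real \<times> real" where
  "dgrad \<phi> z = (frechet_derivative \<phi> (at z) (1, 0), frechet_derivative \<phi> (at z) (0, 1))"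

lemma dgrad_inner_Basis: "e \<in> Basis \<Longrightarrow> dgrad \<phi> z \<bullet> e = frechet_derivative \<phi> (at z) e"
  by (auto simp: Basis_plane dgrad_def)

lemma test_function_has_derivative:
  assumes "test_function \<phi>"
  shows "(\<phi> has_derivative frechet_derivative \<phi> (at z)) (at z)"
proof -
  have "Ck (Suc 0) \<phi>" using assms unfolding test_function_def by blast
  then show ?thesis unfolding Ck.simps frechet_derivative_works[symmetric] by blast
qed

lemma test_function_continuous_derivative:
  assumes "test_function \<phi>" "e \<in> Basis"
  shows "continuous_on UNIV (\<lambda>z. frechet_derivative \<phi> (at z) e)"
proof -
  have "Ck (Suc 0) \<phi>" using assms unfolding test_function_def by blast
  then show ?thesis using assms(2) unfolding Ck.simps by blast
qed

lemma test_function_continuous: "test_function \<phi> \<Longrightarrow> continuous_on UNIV \<phi>"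
  unfolding test_function_def using Ck.simps(1) by blast

lemma test_function_zero:
  assumes "test_function \<phi>" "z \<notin> D"
  shows "\<phi> z = 0"
proof -
  have "z \<notin> {z. \<phi> z \<noteq> 0}"
    using assms closure_subset[of "{z. \<phi> z \<noteq> 0}"] unfolding test_function_def by blast
  then show ?thesis by simp
qed

lemma test_function_L2: "test_function \<phi> \<Longrightarrow> \<phi> \<in> L2"
  by (rule continuous_L2[OF test_function_continuous])

lemma dgrad_continuous: "test_function \<phi> \<Longrightarrow> continuous_on UNIV (dgrad \<phi>)"
  unfolding dgrad_def by (intro continuous_on_Pair test_function_continuous_derivative) (auto simp: Basis_plane)

lemma dgrad_L2: "test_function \<phi> \<Longrightarrow> dgrad \<phi> \<in> L2"
  by (rule continuous_L2[OF dgrad_continuous])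

lemma weak_gradient_test_function:
  assumes \<phi>: "test_function \<phi>"
  shows "weak_gradient \<phi> (dgrad \<phi>)"
  unfolding weak_gradient_def
proof (intro allI impI ballI)
  fix \<psi> and e :: "real \<times> real" assume \<psi>: "test_function \<psi>" and e: "e \<in> Basis"
  have c1: "continuous_on UNIV (\<lambda>z. \<phi> z * frechet_derivative \<psi> (at z) e)"
    by (intro continuous_on_mult test_function_continuous \<phi> test_function_continuous_derivative \<psi> e)
  have c2: "continuous_on UNIV (\<lambda>z. frechet_derivative \<phi> (at z) e * \<psi> z)"
    by (intro continuous_on_mult test_function_continuous \<phi> test_function_continuous_derivative \<psi> e)
  have "(LINT z|DM. \<phi> z * frechet_derivative \<psi> (at z) e + frechet_derivative \<phi> (at z) e * \<psi> z) = 0"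
  proof (rule integral_directional_derivative_zero[OF _ e])
    show "((\<lambda>z. \<phi> z * \<psi> z) has_derivative
        (\<lambda>e. \<phi> z * frechet_derivative \<psi> (at z) e + frechet_derivative \<phi> (at z) e * \<psi> z)) (at z)" for z
      by (rule has_derivative_mult[OF test_function_has_derivative[OF \<phi>] test_function_has_derivative[OF \<psi>]])
    show "continuous_on UNIV (\<lambda>z. \<phi> z * frechet_derivative \<psi> (at z) e + frechet_derivative \<phi> (at z) e * \<psi> z)"
      by (rule continuous_on_add[OF c1 c2])
    show "\<phi> z * \<psi> z = 0" if "z \<notin> D" for z using test_function_zero[OF \<phi> that] by simp
  qed
  then show "(LINT z|DM. \<phi> z * frechet_derivative \<psi> (at z) e) = - (LINT z|DM. (dgrad \<phi> z \<bullet> e) * \<psi> z)"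
    using continuous_integrable_DM[OF c1] continuous_integrable_DM[OF c2]
    by (simp add: dgrad_inner_Basis[OF e])
qed

text \<open>
  The Poincare inequality, from \<open>\<integral> \<partial>\<^sub>x (x \<phi>\<^sup>2) = 0\<close>, that is \<open>\<integral> \<phi>\<^sup>2 = - \<integral> 2 x \<phi> \<partial>\<^sub>x\<phi>\<close>, and
  \<open>- 2 x \<phi> \<partial>\<^sub>x\<phi> \<le> \<phi>\<^sup>2/2 + 2 (\<partial>\<^sub>x\<phi>)\<^sup>2\<close> for \<open>0 \<le> x \<le> 1\<close>.
\<close>
lemma poincare_test_function:
  assumes \<phi>: "test_function \<phi>"
  shows "nsq \<phi> \<le> 4 * nsq (dgrad \<phi>)"
proof -
  let ?d = "\<lambda>z. frechet_derivative \<phi> (at z) (1, 0)"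
  let ?\<psi>' = "\<lambda>z e. fst z * (\<phi> z * frechet_derivative \<phi> (at z) e + frechet_derivative \<phi> (at z) e * \<phi> z) + fst e * (\<phi> z * \<phi> z)"
  have e: "(1, 0) \<in> (Basis :: (real \<times> real) set)" by (simp add: Basis_plane)
  note c\<phi> = test_function_continuous[OF \<phi>] and cd = test_function_continuous_derivative[OF \<phi> e]
  have c\<psi>: "continuous_on UNIV (\<lambda>z. ?\<psi>' z (1, 0))"
    by (intro continuous_intros c\<phi> cd)
  have zero: "(LINT z|DM. ?\<psi>' z (1, 0)) = 0"
  proof (rule integral_directional_derivative_zero[where \<psi>="\<lambda>z. fst z * (\<phi> z * \<phi> z)" and \<psi>'="?\<psi>'", OF _ e c\<psi>])
    show "((\<lambda>z. fst z * (\<phi> z * \<phi> z)) has_derivative ?\<psi>' z) (at z)" for z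
      by (intro has_derivative_mult has_derivative_fst has_derivative_ident test_function_has_derivative[OF \<phi>])
    show "fst z * (\<phi> z * \<phi> z) = 0" if "z \<notin> D" for z using test_function_zero[OF \<phi> that] by simp
  qed
  have bound: "(norm (\<phi> z))\<^sup>2 \<le> ?\<psi>' z (1, 0) + (1/2 * (norm (\<phi> z))\<^sup>2 + 2 * (norm (dgrad \<phi> z))\<^sup>2)"
    if "z \<in> space DM" for z
  proof -
    have x: "(fst z)\<^sup>2 \<le> 1" using that by (auto simp: D_def power_le_one)
    \<comment> \<open>\<open>?\<psi>'\<close> already contains \<open>2 x \<phi> \<partial>\<^sub>x\<phi> + \<phi>\<^sup>2\<close>, so it remains to complete a square.\<close>
    have "0 \<le> 1/2 * (\<phi> z + 2 * fst z * ?d z)\<^sup>2" by simp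
    also have "\<dots> = 1/2 * (\<phi> z)\<^sup>2 + 2 * (fst z * \<phi> z * ?d z) + 2 * ((fst z)\<^sup>2 * (?d z)\<^sup>2)"
      by (simp add: power2_eq_square algebra_simps)
    also have "(fst z)\<^sup>2 * (?d z)\<^sup>2 \<le> 1 * (?d z)\<^sup>2" using x by (intro mult_right_mono) auto
    also have "1 * (?d z)\<^sup>2 \<le> (norm (dgrad \<phi> z))\<^sup>2"
      by (simp add: dgrad_def norm_Pair)
    finally show ?thesis by (simp add: power2_eq_square algebra_simps)
  qed
  have int: "integrable DM (\<lambda>z. ?\<psi>' z (1, 0))" by (rule continuous_integrable_DM[OF c\<psi>])
  have int': "integrable DM (\<lambda>z. 1/2 * (norm (\<phi> z))\<^sup>2 + 2 * (norm (dgrad \<phi> z))\<^sup>2)"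
    using L2_sq_integrable[OF test_function_L2[OF \<phi>]] L2_sq_integrable[OF dgrad_L2[OF \<phi>]] by simp
  have "nsq \<phi> \<le> (LINT z|DM. ?\<psi>' z (1, 0) + (1/2 * (norm (\<phi> z))\<^sup>2 + 2 * (norm (dgrad \<phi> z))\<^sup>2))"
    by (rule integral_mono[OF L2_sq_integrable[OF test_function_L2[OF \<phi>]] Bochner_Integration.integrable_add[OF int int'] bound])
  also have "\<dots> = (LINT z|DM. 1/2 * (norm (\<phi> z))\<^sup>2 + 2 * (norm (dgrad \<phi> z))\<^sup>2)"
    by (simp only: Bochner_Integration.integral_add[OF int int'] zero add_0)
  also have "\<dots> = 1/2 * nsq \<phi> + 2 * nsq (dgrad \<phi>)"
    using L2_sq_integrable[OF test_function_L2[OF \<phi>]] L2_sq_integrable[OF dgrad_L2[OF \<phi>]] by simp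
  finally show ?thesis by simp
qed


text \<open>
  Products of one-dimensional bumps tend boundedly to the indicator of the box.
\<close>
lemma integral_box_zero:
  assumes h: "h \<in> L2" and test: "\<And>\<phi>. test_function \<phi> \<Longrightarrow> (LINT z|DM. h z * \<phi> z) = 0"
    and sub: "{a<..<b} \<times> {c<..<d} \<subseteq> D" and ab: "a < b" "c < d"
  shows "(LINT z|DM. indicator ({a<..<b} \<times> {c<..<d}) z * h z) = (0::real)"
proof -
  note [measurable] = L2_measurable[OF h]
  \<comment> \<open>\<open>Suc m\<close> because the bumps have the required support only for a positive index.\<close>
  let ?\<phi> = "\<lambda>m z. bump1 (Suc m) a b (fst z) * bump1 (Suc m) c d (snd z)"
  have \<phi>: "test_function (?\<phi> m)" for m by (rule test_function_bump[OF _ sub ab]) simp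
  have h_int: "integrable DM h" using L2_mult_integrable[OF h L2_const, of 1] by simp
  have "(\<lambda>m. LINT z|DM. h z * ?\<phi> m z) \<longlonglongrightarrow> (LINT z|DM. h z * indicator ({a<..<b} \<times> {c<..<d}) z)"
  proof (rule integral_dominated_convergence[where w="\<lambda>z. \<bar>h z\<bar>"])
    have "{a<..<b} \<times> {c<..<d} \<in> sets borel" by (intro borel_open open_Times) auto
    then have "(indicator ({a<..<b} \<times> {c<..<d}) :: _ \<Rightarrow> real) \<in> borel_measurable DM"
      by (intro measurable_lebesgue_on_D borel_measurable_indicator)
    then show "(\<lambda>z. h z * indicator ({a<..<b} \<times> {c<..<d}) z) \<in> borel_measurable DM" by measurable
    have "?\<phi> m \<in> borel_measurable DM" for m by (rule L2_measurable[OF test_function_L2[OF \<phi>]])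
    then show "(\<lambda>z. h z * ?\<phi> m z) \<in> borel_measurable DM" for m by measurable
    show "integrable DM (\<lambda>z. \<bar>h z\<bar>)" by (rule integrable_abs[OF h_int])
    show "AE z in DM. (\<lambda>m. h z * ?\<phi> m z) \<longlonglongrightarrow> h z * indicator ({a<..<b} \<times> {c<..<d}) z"
    proof (rule AE_I2)
      fix z :: "real \<times> real"
      have "indicator ({a<..<b} \<times> {c<..<d}) z = (indicator {a<..<b} (fst z) * indicator {c<..<d} (snd z) :: real)"
        by (cases z) (simp add: indicator_times)
      moreover have "(\<lambda>m. h z * ?\<phi> m z) \<longlonglongrightarrow> h z * (indicator {a<..<b} (fst z) * indicator {c<..<d} (snd z))"
        by (rule tendsto_mult[OF tendsto_const tendsto_mult[OF LIMSEQ_Suc[OF bump1_tendsto] LIMSEQ_Suc[OF bump1_tendsto]]])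
      ultimately show "(\<lambda>m. h z * ?\<phi> m z) \<longlonglongrightarrow> h z * indicator ({a<..<b} \<times> {c<..<d}) z"
        by (simp only:)
    qed
    show "AE z in DM. norm (h z * ?\<phi> m z) \<le> \<bar>h z\<bar>" for m
    proof (rule AE_I2)
      fix z :: "real \<times> real"
      have "\<bar>?\<phi> m z\<bar> \<le> 1" using bump1_bounds by (simp add: abs_mult mult_le_one)
      from mult_left_mono[OF this, of "\<bar>h z\<bar>"] show "norm (h z * ?\<phi> m z) \<le> \<bar>h z\<bar>" by (simp add: abs_mult)
    qed
  qed
  moreover have "(LINT z|DM. h z * ?\<phi> m z) = 0" for m by (rule test[OF \<phi>])
  ultimately have "(\<lambda>m. 0) \<longlonglongrightarrow> (LINT z|DM. h z * indicator ({a<..<b} \<times> {c<..<d}) z)"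
    by (simp only:)
  then have "(LINT z|DM. h z * indicator ({a<..<b} \<times> {c<..<d}) z) = 0"
    by (rule LIMSEQ_unique[OF _ tendsto_const])
  then show ?thesis by (simp add: mult.commute)
qed

text \<open>
  The sets on which the integral of \<open>h\<close> vanishes contain the open boxes, an intersection-stable
  generator of the Borel sets, and form a Dynkin system; so they contain all Borel sets and, up to
  null sets, all Lebesgue measurable sets.
\<close>
lemma fundamental_lemma_calculus_of_variations:
  fixes h :: "real \<times> real \<Rightarrow> real"
  assumes h: "h \<in> L2" and test: "\<And>\<phi>. test_function \<phi> \<Longrightarrow> (LINT z|DM. h z * \<phi> z) = 0"
  shows "AE z in DM. h z = 0"
proof -
  have h_int: "integrable DM h" using L2_mult_integrable[OF h L2_const, of 1] by simp
  define P where "P A \<longleftrightarrow> (LINT z|DM. indicator A z * h z) = 0" for A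
  have P_D: "P A \<longleftrightarrow> P (A \<inter> D)" for A
  proof -
    have "(LINT z|DM. indicator A z * h z) = (LINT z|DM. indicator (A \<inter> D) z * h z)"
      by (rule Bochner_Integration.integral_cong) (simp_all add: indicator_def)
    then show ?thesis by (simp only: P_def)
  qed
  have P_box: "P (box a b)" for a b :: "real \<times> real"
  proof -
    obtain a1 a2 b1 b2 where ab: "a = (a1, a2)" "b = (b1, b2)" by (cases a, cases b) blast
    let ?R = "{max a1 0<..<min b1 1} \<times> {max a2 0<..<min b2 1}"
    have eq: "box a b \<inter> D = ?R"
      unfolding D_def ab box_def Basis_plane by (auto simp: less_max_iff_disj)
    have "P ?R"
    proof (cases "max a1 0 < min b1 1 \<and> max a2 0 < min b2 1")
      case True
      then show ?thesis unfolding P_def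
        by (intro integral_box_zero[OF h test]) (auto simp: D_def)
    next
      case False
      then have "?R = {}" by (simp only: Sigma_empty_iff greaterThanLessThan_empty_iff not_less) auto
      moreover have "P {}" by (simp add: P_def)
      ultimately show ?thesis by (simp only:)
    qed
    then show ?thesis unfolding P_D[of "box a b"] eq .
  qed
  have P_borel: "P A" if "A \<in> sets borel" for A
  proof -
    have "A \<in> sigma_sets UNIV (range (\<lambda>(a, b). box a b))"
      using that unfolding borel_eq_box by simp
    with _ _ show ?thesis
    proof (rule sigma_sets_induct_disjoint[where P=P])
      show "Int_stable (range (\<lambda>(a, b). box a b :: (real \<times> real) set))"
        by (auto simp: Int_stable_def box_Int_box)
      show "range (\<lambda>(a, b). box a b :: (real \<times> real) set) \<subseteq> Pow UNIV" by simp
    next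
      show "P A" if "A \<in> range (\<lambda>(a, b). box a b)" for A using that P_box by auto
    next
      show "P {}" by (simp add: P_def)
    next
      fix A assume A: "A \<in> sigma_sets UNIV (range (\<lambda>(a, b). box a b))" and PA: "P A"
      then have "A \<in> sets borel" unfolding borel_eq_box by simp
      then have ind: "(indicator A :: _ \<Rightarrow> real) \<in> borel_measurable DM"
        by (intro measurable_lebesgue_on_D borel_measurable_indicator)
      have int: "integrable DM (\<lambda>z. indicator A z * h z)"
      proof (rule Bochner_Integration.integrable_bound[OF h_int])
        show "(\<lambda>z. indicator A z * h z) \<in> borel_measurable DM"
          by (rule borel_measurable_times[OF ind L2_measurable[OF h]])
      qed (simp add: indicator_def)
      have "P D" using P_box[of "(0, 0)" "(1, 1)"] by (simp only: D_box)
      moreover have "(LINT z|DM. indicator D z * h z) = (LINT z|DM. h z)"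
        by (rule Bochner_Integration.integral_cong) simp_all
      ultimately have "(LINT z|DM. h z) = 0" by (simp only: P_def)
      moreover have "(LINT z|DM. indicator (UNIV - A) z * h z) = (LINT z|DM. h z - indicator A z * h z)"
        by (intro Bochner_Integration.integral_cong refl) (simp add: indicator_def)
      ultimately show "P (UNIV - A)" using PA h_int int by (simp add: P_def)
    next
      fix A :: "nat \<Rightarrow> (real \<times> real) set"
      assume disj: "disjoint_family A" and A: "range A \<subseteq> sigma_sets UNIV (range (\<lambda>(a, b). box a b))"
        and PA: "\<And>i. P (A i)"
      have borel: "A i \<in> sets borel" for i using A unfolding borel_eq_box by auto
      have PAD: "P (A i \<inter> D)" for i using PA P_D by blast
      have meas: "A i \<inter> D \<in> sets DM" for i
        using borel[of i] by (auto simp: sets_restrict_space)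
      have "(LINT z:(\<Union>i. A i \<inter> D)|DM. h z) = (\<Sum>i. (LINT z:(A i \<inter> D)|DM. h z))"
      proof (rule lebesgue_integral_countable_add[OF meas])
        show "i \<noteq> j \<Longrightarrow> A i \<inter> D \<inter> (A j \<inter> D) = {}" for i j
          using disj unfolding disjoint_family_on_def by blast
        show "set_integrable DM (\<Union>i. A i \<inter> D) h"
          unfolding set_integrable_def by (rule integrable_mult_indicator[OF sets.countable_nat_UN h_int]) (use meas in blast)
      qed
      also have "\<dots> = 0" using PAD by (simp add: set_lebesgue_integral_def P_def)
      finally have "P ((\<Union>i. A i) \<inter> D)" unfolding set_lebesgue_integral_def P_def by simp
      then show "P (\<Union>i. A i)" using P_D by blast
    qed
  qed
  have "set_lebesgue_integral DM A h = 0" if "A \<in> sets DM" for A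
  proof -
    have "A \<in> sets lebesgue" using that by (auto simp: sets_restrict_space)
    then obtain C T where C: "fsigma C" and T: "T \<in> null_sets lebesgue" and CT: "C \<union> T = A" "disjnt C T"
      by (rule lebesgue_set_almost_fsigma)
    have "C \<in> sets borel" using C by cases (auto intro: borel_closed)
    then have "P C" by (rule P_borel)
    have "AE z in DM. z \<notin> T"
    proof -
      have "AE z in lebesgue. z \<notin> T" by (rule AE_not_in[OF T])
      then have "AE z in lebesgue. z \<in> D \<longrightarrow> z \<notin> T" by eventually_elim simp
      then show ?thesis by (simp add: AE_restrict_space_iff)
    qed
    then have ae: "AE z in DM. indicator A z * h z = indicator C z * h z"
    proof eventually_elim
      case (elim z)
      then have "z \<in> A \<longleftrightarrow> z \<in> C" using CT by blast
      then show ?case by (simp add: indicator_def)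
    qed
    have "(LINT z|DM. indicator A z * h z) = (LINT z|DM. indicator C z * h z)"
    proof (rule integral_cong_AE[OF _ _ ae])
      have "(indicator C :: _ \<Rightarrow> real) \<in> borel_measurable DM"
        using \<open>C \<in> sets borel\<close> by (intro measurable_lebesgue_on_D borel_measurable_indicator)
      then show "(\<lambda>z. indicator C z * h z) \<in> borel_measurable DM"
        by (rule borel_measurable_times[OF _ L2_measurable[OF h]])
      have "(indicator A :: _ \<Rightarrow> real) \<in> borel_measurable DM"
        using that by (rule borel_measurable_indicator)
      then show "(\<lambda>z. indicator A z * h z) \<in> borel_measurable DM"
        by (rule borel_measurable_times[OF _ L2_measurable[OF h]])
    qed
    with \<open>P C\<close> show ?thesis by (simp add: P_def set_lebesgue_integral_def)
  qed
  then show ?thesis by (rule DM.density_zero[OF h_int])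
qed

lemma L2_component:
  fixes g :: "real \<times> real \<Rightarrow> real \<times> real"
  assumes g: "g \<in> L2" and e: "e \<in> Basis"
  shows "(\<lambda>z. g z \<bullet> e) \<in> L2"
proof (rule L2_dominated)
  show "(\<lambda>z. g z \<bullet> e) \<in> borel_measurable DM" using L2_measurable[OF g] by measurable
  show "integrable DM (\<lambda>z. (norm (g z))\<^sup>2)" by (rule L2_sq_integrable[OF g])
  have "(norm (x \<bullet> e))\<^sup>2 \<le> (norm x)\<^sup>2" for x :: "real \<times> real"
    using Basis_le_norm[OF e, of x] by (intro power_mono) auto
  then show "AE z in DM. (norm (g z \<bullet> e))\<^sup>2 \<le> (norm (g z))\<^sup>2" by simp
qed

text \<open>
  Without uniqueness the choice operator in \<open>grad\<close> could select unrelated gradients for \<open>p\<close>, \<open>q\<close> and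
  \<open>p + q\<close>; with it, \<open>grad\<close> is linear almost everywhere.
\<close>
lemma weak_gradient_unique:
  assumes g: "g \<in> L2" "weak_gradient p g" and g': "g' \<in> L2" "weak_gradient p g'"
  shows "AE z in DM. g z = g' z"
proof -
  have "AE z in DM. (g z - g' z) \<bullet> e = 0" if e: "e \<in> Basis" for e
  proof (rule fundamental_lemma_calculus_of_variations)
    note ge = L2_component[OF _ e]
    show "(\<lambda>z. (g z - g' z) \<bullet> e) \<in> L2" by (rule ge[OF L2_diff[OF g(1) g'(1)]])
    fix \<phi> assume \<phi>: "test_function \<phi>"
    have "(LINT z|DM. (g z \<bullet> e) * \<phi> z) = (LINT z|DM. (g' z \<bullet> e) * \<phi> z)"
      using g(2)[unfolded weak_gradient_def, rule_format, OF \<phi> e]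
        g'(2)[unfolded weak_gradient_def, rule_format, OF \<phi> e] by simp
    then show "(LINT z|DM. ((g z - g' z) \<bullet> e) * \<phi> z) = 0"
      using L2_mult_integrable[OF ge[OF g(1)] test_function_L2[OF \<phi>]] L2_mult_integrable[OF ge[OF g'(1)] test_function_L2[OF \<phi>]]
      by (simp add: inner_diff_left left_diff_distrib)
  qed
  then have "AE z in DM. \<forall>e\<in>Basis. (g z - g' z) \<bullet> e = 0"
    by (intro AE_finite_allI) auto
  then show ?thesis
    by eventually_elim (metis euclidean_eq_iff inner_zero_left right_minus_eq)
qed

section \<open>The Sobolev space with zero boundary values\<close>

lemma grad_H1:
  assumes "p \<in> H1"
  shows "grad p \<in> L2" "weak_gradient p (grad p)"
proof -
  obtain g where "g \<in> L2 \<and> weak_gradient p g" using assms unfolding H1_def by blast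
  then have "grad p \<in> L2 \<and> weak_gradient p (grad p)" unfolding grad_def by (rule someI[where P="\<lambda>g. g \<in> L2 \<and> weak_gradient p g"])
  then show "grad p \<in> L2" "weak_gradient p (grad p)" by auto
qed

lemma H1I: "p \<in> L2 \<Longrightarrow> g \<in> L2 \<Longrightarrow> weak_gradient p g \<Longrightarrow> p \<in> H1"
  unfolding H1_def by blast

lemma H1_L2: "p \<in> H1 \<Longrightarrow> p \<in> L2"
  unfolding H1_def by blast

lemma grad_AE_eq:
  assumes "p \<in> L2" "g \<in> L2" "weak_gradient p g"
  shows "AE z in DM. grad p z = g z"
proof -
  have "p \<in> H1" by (rule H1I[OF assms])
  then show ?thesis using weak_gradient_unique grad_H1 assms by blast
qed

lemma test_function_derivative_L2: "test_function \<phi> \<Longrightarrow> e \<in> Basis \<Longrightarrow> (\<lambda>z. frechet_derivative \<phi> (at z) e) \<in> L2"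
  by (rule continuous_L2[OF test_function_continuous_derivative])

lemma weak_gradient_add_cmult:
  assumes p: "p \<in> L2" "g \<in> L2" "weak_gradient p g" and q: "q \<in> L2" "h \<in> L2" "weak_gradient q h"
  shows "weak_gradient (\<lambda>z. p z + c * q z) (\<lambda>z. g z + c *\<^sub>R h z)"
  unfolding weak_gradient_def
proof (intro allI impI ballI)
  fix \<phi> and e :: "real \<times> real" assume \<phi>: "test_function \<phi>" and e: "e \<in> Basis"
  let ?d = "\<lambda>z. frechet_derivative \<phi> (at z) e"
  note d = test_function_derivative_L2[OF \<phi> e] and \<phi>2 = test_function_L2[OF \<phi>]
  note i1 = L2_mult_integrable[OF p(1) d] and i2 = L2_mult_integrable[OF q(1) d]
  note j1 = L2_mult_integrable[OF L2_component[OF p(2) e] \<phi>2]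
  note j2 = L2_mult_integrable[OF L2_component[OF q(2) e] \<phi>2]
  have "(LINT z|DM. (p z + c * q z) * ?d z) = (LINT z|DM. p z * ?d z + c * (q z * ?d z))"
    by (rule arg_cong[where f="integral\<^sup>L DM"]) (simp add: algebra_simps)
  also have "\<dots> = (LINT z|DM. p z * ?d z) + c * (LINT z|DM. q z * ?d z)"
    using i1 i2 by simp
  also have "\<dots> = - ((LINT z|DM. (g z \<bullet> e) * \<phi> z) + c * (LINT z|DM. (h z \<bullet> e) * \<phi> z))"
    using p(3)[unfolded weak_gradient_def, rule_format, OF \<phi> e] q(3)[unfolded weak_gradient_def, rule_format, OF \<phi> e]
    by simp
  also have "\<dots> = - (LINT z|DM. (g z \<bullet> e) * \<phi> z + c * ((h z \<bullet> e) * \<phi> z))"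
    using j1 j2 by simp
  also have "\<dots> = - (LINT z|DM. ((g z + c *\<^sub>R h z) \<bullet> e) * \<phi> z)"
    by (simp add: inner_add_left algebra_simps)
  finally show "(LINT z|DM. (p z + c * q z) * ?d z) = - (LINT z|DM. ((g z + c *\<^sub>R h z) \<bullet> e) * \<phi> z)" .
qed

lemma L2_add_mult: "p \<in> L2 \<Longrightarrow> q \<in> L2 \<Longrightarrow> (\<lambda>z. p z + c * q z) \<in> L2" for p q :: "real \<times> real \<Rightarrow> real"
  by (rule L2_add[OF _ L2_mult])

lemma L2_add_scaleR: "g \<in> L2 \<Longrightarrow> h \<in> L2 \<Longrightarrow> (\<lambda>z. g z + c *\<^sub>R h z) \<in> L2"
  for g h :: "real \<times> real \<Rightarrow> 'b::euclidean_space"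
  by (rule L2_add[OF _ L2_scaleR])

lemma H1_add_cmult:
  assumes p: "p \<in> H1" and q: "q \<in> H1"
  shows "(\<lambda>z. p z + c * q z) \<in> H1"
    and "AE z in DM. grad (\<lambda>z. p z + c * q z) z = grad p z + c *\<^sub>R grad q z"
proof -
  note w = weak_gradient_add_cmult[OF H1_L2[OF p] grad_H1[OF p] H1_L2[OF q] grad_H1[OF q], of c]
  note l = L2_add_mult[OF H1_L2[OF p] H1_L2[OF q], of c] L2_add_scaleR[OF grad_H1(1)[OF p] grad_H1(1)[OF q], of c]
  show "(\<lambda>z. p z + c * q z) \<in> H1" by (rule H1I[OF l w])
  show "AE z in DM. grad (\<lambda>z. p z + c * q z) z = grad p z + c *\<^sub>R grad q z"
    by (rule grad_AE_eq[OF l w])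
qed

lemma test_function_H1: "test_function \<phi> \<Longrightarrow> \<phi> \<in> H1"
  by (rule H1I[OF test_function_L2 dgrad_L2 weak_gradient_test_function])

lemma grad_test_function: "test_function \<phi> \<Longrightarrow> AE z in DM. grad \<phi> z = dgrad \<phi> z"
  by (rule grad_AE_eq[OF test_function_L2 dgrad_L2 weak_gradient_test_function])

lemma nsq_cong_AE:
  fixes h :: "real \<times> real \<Rightarrow> 'b::euclidean_space"
  assumes "h \<in> L2" "k \<in> L2" "AE z in DM. h z = k z"
  shows "nsq h = nsq k"
proof (rule integral_cong_AE)
  show "AE z in DM. (norm (h z))\<^sup>2 = (norm (k z))\<^sup>2" using assms(3) by eventually_elim simp
qed (use assms(1,2)[THEN L2_measurable] in \<open>measurable\<close>)

text \<open>
  Membership in \<open>V\<close> expressed without the norm of \<open>H\<^sup>1\<close>, hence without weak gradients of differences.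
\<close>
lemma V_iff:
  "p \<in> V \<longleftrightarrow> p \<in> H1 \<and> (\<exists>\<phi>. (\<forall>k. test_function (\<phi> k)) \<and>
     (\<lambda>k. nsq (\<lambda>z. \<phi> k z - p z)) \<longlonglongrightarrow> 0 \<and> (\<lambda>k. nsq (\<lambda>z. dgrad (\<phi> k) z - grad p z)) \<longlonglongrightarrow> 0)"
proof -
  have "(\<lambda>k. H1_norm (\<lambda>z. \<phi> k z - p z)) \<longlonglongrightarrow> 0 \<longleftrightarrow>
     (\<lambda>k. nsq (\<lambda>z. \<phi> k z - p z)) \<longlonglongrightarrow> 0 \<and> (\<lambda>k. nsq (\<lambda>z. dgrad (\<phi> k) z - grad p z)) \<longlonglongrightarrow> 0"
    if p: "p \<in> H1" and \<phi>: "\<forall>k. test_function (\<phi> k)" for \<phi> :: "nat \<Rightarrow> real \<times> real \<Rightarrow> real"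
  proof -
    let ?a = "\<lambda>k. nsq (\<lambda>z. \<phi> k z - p z)" and ?b = "\<lambda>k. nsq (\<lambda>z. dgrad (\<phi> k) z - grad p z)"
    have eq: "H1_norm (\<lambda>z. \<phi> k z - p z) = sqrt (?a k + ?b k)" for k
    proof -
      have \<phi>k: "test_function (\<phi> k)" using \<phi> by blast
      have H: "(\<lambda>z. \<phi> k z + (-1) * p z) \<in> H1" "AE z in DM. grad (\<lambda>z. \<phi> k z + (-1) * p z) z = grad (\<phi> k) z + (-1) *\<^sub>R grad p z"
        by (rule H1_add_cmult[OF test_function_H1[OF \<phi>k] p])+
      have "AE z in DM. grad (\<lambda>z. \<phi> k z - p z) z = dgrad (\<phi> k) z - grad p z"
        using H(2) grad_test_function[OF \<phi>k] by eventually_elim simp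
      moreover have "(\<lambda>z. \<phi> k z - p z) \<in> H1" using H(1) by simp
      ultimately have "nsq (grad (\<lambda>z. \<phi> k z - p z)) = ?b k"
        by (intro nsq_cong_AE L2_diff dgrad_L2 \<phi>k grad_H1(1) p)
      then show ?thesis by (simp add: H1_norm_def)
    qed
    have nn: "0 \<le> ?a k" "0 \<le> ?b k" for k by (rule nsq_nonneg)+
    show ?thesis
    proof
      assume "(\<lambda>k. H1_norm (\<lambda>z. \<phi> k z - p z)) \<longlonglongrightarrow> 0"
      then have "(\<lambda>k. (sqrt (?a k + ?b k))\<^sup>2) \<longlonglongrightarrow> 0\<^sup>2" unfolding eq by (rule tendsto_power)
      then have lim: "(\<lambda>k. ?a k + ?b k) \<longlonglongrightarrow> 0"
        by (simp only: real_sqrt_pow2[OF add_nonneg_nonneg[OF nn]] power_zero_numeral)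
      have "?a \<longlonglongrightarrow> 0"
        by (rule tendsto_sandwich[OF _ _ tendsto_const lim]) (use nn in \<open>auto intro!: always_eventually\<close>)
      moreover have "?b \<longlonglongrightarrow> 0"
        by (rule tendsto_sandwich[OF _ _ tendsto_const lim]) (use nn in \<open>auto intro!: always_eventually\<close>)
      ultimately show "?a \<longlonglongrightarrow> 0 \<and> ?b \<longlonglongrightarrow> 0" ..
    next
      assume "?a \<longlonglongrightarrow> 0 \<and> ?b \<longlonglongrightarrow> 0"
      then have "(\<lambda>k. ?a k + ?b k) \<longlonglongrightarrow> 0 + 0" by (intro tendsto_add) auto
      then have "(\<lambda>k. sqrt (?a k + ?b k)) \<longlonglongrightarrow> sqrt (0 + 0)" by (rule tendsto_real_sqrt)
      then show "(\<lambda>k. H1_norm (\<lambda>z. \<phi> k z - p z)) \<longlonglongrightarrow> 0" unfolding eq by simp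
    qed
  qed
  then show ?thesis unfolding V_def by blast
qed

lemma V_H1: "p \<in> V \<Longrightarrow> p \<in> H1"
  unfolding V_def by blast

lemma grad_V_L2: "p \<in> V \<Longrightarrow> grad p \<in> L2"
  by (rule grad_H1(1)[OF V_H1])

lemma nsq_tendsto_0_add_scaleR:
  fixes h :: "nat \<Rightarrow> real \<times> real \<Rightarrow> 'b::euclidean_space"
  assumes "\<And>k. h k \<in> L2" "\<And>k. g k \<in> L2" and lim: "(\<lambda>k. nsq (h k)) \<longlonglongrightarrow> 0" "(\<lambda>k. nsq (g k)) \<longlonglongrightarrow> 0"
  shows "(\<lambda>k. nsq (\<lambda>z. h k z + c *\<^sub>R g k z)) \<longlonglongrightarrow> 0"
proof (rule tendsto_sandwich[OF always_eventually always_eventually tendsto_const])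
  have "(\<lambda>k. 2 * nsq (h k) + 2 * (c\<^sup>2 * nsq (g k))) \<longlonglongrightarrow> 2 * 0 + 2 * (c\<^sup>2 * 0)"
    by (intro tendsto_add tendsto_mult tendsto_const lim)
  then show "(\<lambda>k. 2 * nsq (h k) + 2 * (c\<^sup>2 * nsq (g k))) \<longlonglongrightarrow> 0" by simp
  show "\<forall>k. 0 \<le> nsq (\<lambda>z. h k z + c *\<^sub>R g k z)" by (intro allI nsq_nonneg)
  show "\<forall>k. nsq (\<lambda>z. h k z + c *\<^sub>R g k z) \<le> 2 * nsq (h k) + 2 * (c\<^sup>2 * nsq (g k))"
    using nsq_add_le[OF assms(1) L2_scaleR[OF assms(2)]] unfolding nsq_scaleR by blast
qed

lemma dgrad_add_cmult:
  assumes "test_function \<phi>" "test_function \<psi>"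
  shows "dgrad (\<lambda>z. \<phi> z + c * \<psi> z) z = dgrad \<phi> z + c *\<^sub>R dgrad \<psi> z"
proof -
  have "((\<lambda>z. \<phi> z + c * \<psi> z) has_derivative
      (\<lambda>e. frechet_derivative \<phi> (at z) e + c * frechet_derivative \<psi> (at z) e)) (at z)"
    by (intro has_derivative_add has_derivative_mult_right test_function_has_derivative assms)
  from frechet_derivative_at[OF this, symmetric] show ?thesis
    by (simp add: dgrad_def)
qed

text \<open>
  Linearity of \<open>V\<close>, in the one form that covers sums, differences, multiples and the perturbations
  \<open>p + t q\<close> of the calculus of variations.
\<close>
lemma V_add_cmult:
  assumes p: "p \<in> V" and q: "q \<in> V"
  shows "(\<lambda>z. p z + c * q z) \<in> V"
proof -
  obtain \<phi> where \<phi>: "\<And>k. test_function (\<phi> k)" "(\<lambda>k. nsq (\<lambda>z. \<phi> k z - p z)) \<longlonglongrightarrow> 0"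
      "(\<lambda>k. nsq (\<lambda>z. dgrad (\<phi> k) z - grad p z)) \<longlonglongrightarrow> 0"
    using p unfolding V_iff by blast
  obtain \<psi> where \<psi>: "\<And>k. test_function (\<psi> k)" "(\<lambda>k. nsq (\<lambda>z. \<psi> k z - q z)) \<longlonglongrightarrow> 0"
      "(\<lambda>k. nsq (\<lambda>z. dgrad (\<psi> k) z - grad q z)) \<longlonglongrightarrow> 0"
    using q unfolding V_iff by blast
  note pH = V_H1[OF p] and qH = V_H1[OF q]
  let ?\<xi> = "\<lambda>k z. \<phi> k z + c * \<psi> k z"
  have "test_function (?\<xi> k)" for k by (rule test_function_add[OF \<phi>(1) test_function_cmult[OF \<psi>(1)]])
  moreover have "(\<lambda>k. nsq (\<lambda>z. ?\<xi> k z - (p z + c * q z))) \<longlonglongrightarrow> 0"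
  proof -
    have "(\<lambda>k. nsq (\<lambda>z. (\<phi> k z - p z) + c *\<^sub>R (\<psi> k z - q z))) \<longlonglongrightarrow> 0"
      by (intro nsq_tendsto_0_add_scaleR L2_diff test_function_L2 \<phi> \<psi> H1_L2 pH qH)
    then show ?thesis by (simp add: algebra_simps)
  qed
  moreover have "(\<lambda>k. nsq (\<lambda>z. dgrad (?\<xi> k) z - grad (\<lambda>z. p z + c * q z) z)) \<longlonglongrightarrow> 0"
  proof -
    have L: "(\<lambda>z. (dgrad (\<phi> k) z - grad p z) + c *\<^sub>R (dgrad (\<psi> k) z - grad q z)) \<in> L2" for k
      by (intro L2_add_scaleR L2_diff dgrad_L2 \<phi> \<psi> grad_H1 pH qH)
    have "(\<lambda>k. nsq (\<lambda>z. (dgrad (\<phi> k) z - grad p z) + c *\<^sub>R (dgrad (\<psi> k) z - grad q z))) \<longlonglongrightarrow> 0"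
      by (intro nsq_tendsto_0_add_scaleR L2_diff dgrad_L2 \<phi> \<psi> grad_H1 pH qH)
    moreover have "nsq (\<lambda>z. (dgrad (\<phi> k) z - grad p z) + c *\<^sub>R (dgrad (\<psi> k) z - grad q z)) =
        nsq (\<lambda>z. dgrad (?\<xi> k) z - grad (\<lambda>z. p z + c * q z) z)" for k
    proof (rule nsq_cong_AE[OF L])
      show "(\<lambda>z. dgrad (?\<xi> k) z - grad (\<lambda>z. p z + c * q z) z) \<in> L2"
        by (intro L2_diff dgrad_L2 test_function_add test_function_cmult \<phi> \<psi> grad_H1 H1_add_cmult pH qH)
      show "AE z in DM. (dgrad (\<phi> k) z - grad p z) + c *\<^sub>R (dgrad (\<psi> k) z - grad q z) =
          dgrad (?\<xi> k) z - grad (\<lambda>z. p z + c * q z) z"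
        using H1_add_cmult(2)[OF pH qH, of c]
        by eventually_elim (simp add: dgrad_add_cmult[OF \<phi>(1) \<psi>(1)] algebra_simps)
    qed
    ultimately show ?thesis by simp
  qed
  ultimately show ?thesis unfolding V_iff using H1_add_cmult(1)[OF pH qH]
    by (intro conjI exI[of _ ?\<xi>] allI)
qed

lemma test_function_V: "test_function \<phi> \<Longrightarrow> \<phi> \<in> V"
proof -
  assume \<phi>: "test_function \<phi>"
  have "nsq (\<lambda>z. dgrad \<phi> z - grad \<phi> z) = nsq (\<lambda>z. 0 :: real \<times> real)"
  proof (rule nsq_cong_AE)
    show "AE z in DM. dgrad \<phi> z - grad \<phi> z = 0" using grad_test_function[OF \<phi>] by eventually_elim simp
  qed (intro L2_diff dgrad_L2 \<phi> grad_H1 test_function_H1 L2_const)+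
  then show ?thesis unfolding V_iff using \<phi> test_function_H1[OF \<phi>] by (intro conjI exI[of _ "\<lambda>_. \<phi>"]) auto
qed

lemma test_function_zero_fun: "test_function (\<lambda>_. 0)"
  using Ck_tensor[OF smooth1_const[of _ 0] smooth1_const[of _ 0]] by (simp add: test_function_def)

text \<open>
  The Poincare inequality makes a sequence of test functions with Cauchy gradients itself Cauchy in
  \<open>L\<^sup>2\<close>, and the defining identity of the weak gradient is stable under the two \<open>L\<^sup>2\<close> limits.
\<close>
lemma V_complete:
  assumes \<phi>: "\<And>k. test_function (\<phi> k)"
    and Cauchy: "\<And>e. e > 0 \<Longrightarrow> \<exists>N. \<forall>m\<ge>N. \<forall>n\<ge>N. nsq (\<lambda>z. dgrad (\<phi> m) z - dgrad (\<phi> n) z) < e"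
  shows "\<exists>p\<in>V. (\<lambda>k. nsq (\<lambda>z. dgrad (\<phi> k) z - grad p z)) \<longlonglongrightarrow> 0"
proof -
  obtain g where g: "g \<in> L2" "(\<lambda>k. nsq (\<lambda>z. dgrad (\<phi> k) z - g z)) \<longlonglongrightarrow> 0"
    using L2_complete[OF dgrad_L2[OF \<phi>] Cauchy] by blast
  have poincare: "nsq (\<lambda>z. \<phi> m z - \<phi> n z) \<le> 4 * nsq (\<lambda>z. dgrad (\<phi> m) z - dgrad (\<phi> n) z)" for m n
    using poincare_test_function[OF test_function_diff[OF \<phi> \<phi>], of m n] dgrad_add_cmult[OF \<phi> \<phi>, of m "-1" n]
    by simp
  have "\<exists>p\<in>L2. (\<lambda>k. nsq (\<lambda>z. \<phi> k z - p z)) \<longlonglongrightarrow> 0"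
  proof (rule L2_complete[OF test_function_L2[OF \<phi>]])
    fix e :: real assume "e > 0"
    then obtain N where "\<forall>m\<ge>N. \<forall>n\<ge>N. nsq (\<lambda>z. dgrad (\<phi> m) z - dgrad (\<phi> n) z) < e / 4"
      using Cauchy[of "e / 4"] by auto
    then have "nsq (\<lambda>z. \<phi> m z - \<phi> n z) < e" if "m \<ge> N" "n \<ge> N" for m n
      using poincare[of m n] that by fastforce
    then show "\<exists>N. \<forall>m\<ge>N. \<forall>n\<ge>N. nsq (\<lambda>z. \<phi> m z - \<phi> n z) < e" by blast
  qed
  then obtain p where p: "p \<in> L2" "(\<lambda>k. nsq (\<lambda>z. \<phi> k z - p z)) \<longlonglongrightarrow> 0" by blast
  have w: "weak_gradient p g"
    unfolding weak_gradient_def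
  proof (intro allI impI ballI)
    fix \<psi> and e :: "real \<times> real" assume \<psi>: "test_function \<psi>" and e: "e \<in> Basis"
    note d = test_function_derivative_L2[OF \<psi> e]
    have \<psi>e: "(\<lambda>z. \<psi> z *\<^sub>R e) \<in> L2"
      by (rule continuous_L2) (intro continuous_intros test_function_continuous[OF \<psi>])
    have "(\<lambda>k. LINT z|DM. \<phi> k z \<bullet> frechet_derivative \<psi> (at z) e) \<longlonglongrightarrow> (LINT z|DM. p z \<bullet> frechet_derivative \<psi> (at z) e)"
      by (rule L2_tendsto_inner[OF test_function_L2[OF \<phi>] p(1) d p(2)])
    moreover have "(\<lambda>k. - (LINT z|DM. dgrad (\<phi> k) z \<bullet> (\<psi> z *\<^sub>R e))) \<longlonglongrightarrow> - (LINT z|DM. g z \<bullet> (\<psi> z *\<^sub>R e))"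
      by (rule tendsto_minus[OF L2_tendsto_inner[OF dgrad_L2[OF \<phi>] g(1) \<psi>e g(2)]])
    moreover have "(LINT z|DM. \<phi> k z \<bullet> frechet_derivative \<psi> (at z) e) = - (LINT z|DM. dgrad (\<phi> k) z \<bullet> (\<psi> z *\<^sub>R e))" for k
      using weak_gradient_test_function[OF \<phi>, unfolded weak_gradient_def, rule_format, OF \<psi> e, of k]
      by (simp add: mult.commute)
    ultimately have "(LINT z|DM. p z \<bullet> frechet_derivative \<psi> (at z) e) = - (LINT z|DM. g z \<bullet> (\<psi> z *\<^sub>R e))"
      by (simp only:) (rule LIMSEQ_unique)
    then show "(LINT z|DM. p z * frechet_derivative \<psi> (at z) e) = - (LINT z|DM. (g z \<bullet> e) * \<psi> z)"
      by (simp add: mult.commute)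
  qed
  have pH: "p \<in> H1" by (rule H1I[OF p(1) g(1) w])
  have "nsq (\<lambda>z. dgrad (\<phi> k) z - grad p z) = nsq (\<lambda>z. dgrad (\<phi> k) z - g z)" for k
  proof (rule nsq_cong_AE)
    show "AE z in DM. dgrad (\<phi> k) z - grad p z = dgrad (\<phi> k) z - g z"
      using grad_AE_eq[OF p(1) g(1) w] by eventually_elim simp
  qed (intro L2_diff dgrad_L2 \<phi> grad_H1 pH g)+
  then have lim: "(\<lambda>k. nsq (\<lambda>z. dgrad (\<phi> k) z - grad p z)) \<longlonglongrightarrow> 0" using g(2) by simp
  then have "p \<in> V" unfolding V_iff using pH \<phi> p(2) by (intro conjI exI[of _ \<phi>] allI)
  with lim show ?thesis by blast
qed

section \<open>The elliptic problem and its observations\<close>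

lemma V_dual_add_cmult:
  assumes f: "f \<in> V_dual" and pq: "p \<in> V" "q \<in> V"
  shows "f (\<lambda>z. p z + c * q z) = f p + c * f q"
proof -
  have "(\<lambda>z. c * q z) \<in> V" using V_add_cmult[OF test_function_V[OF test_function_zero_fun] pq(2), of c] by simp
  then show ?thesis using f pq unfolding V_dual_def by simp
qed

lemma V_dual_bounded:
  assumes "f \<in> V_dual"
  obtains K where "K \<ge> 0" "\<And>p. p \<in> V \<Longrightarrow> \<bar>f p\<bar> \<le> K * sqrt (nsq (grad p))"
proof -
  obtain K where K: "\<And>p. p \<in> V \<Longrightarrow> \<bar>f p\<bar> \<le> K * V_norm p" using assms unfolding V_dual_def by blast
  have "\<bar>f p\<bar> \<le> \<bar>K\<bar> * sqrt (nsq (grad p))" if "p \<in> V" for p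
  proof -
    have "K * V_norm p \<le> \<bar>K\<bar> * V_norm p"
      by (intro mult_right_mono) (simp_all add: V_norm_def)
    then show ?thesis using K[OF that] by (simp add: V_norm_def)
  qed
  then show thesis by (rule that[OF abs_ge_zero])
qed

lemma V_dual_add:
  assumes "f \<in> V_dual" "l \<in> V_dual"
  shows "(\<lambda>p. f p + l p) \<in> V_dual"
proof -
  obtain K K' where K: "\<And>p. p \<in> V \<Longrightarrow> \<bar>f p\<bar> \<le> K * V_norm p" "\<And>p. p \<in> V \<Longrightarrow> \<bar>l p\<bar> \<le> K' * V_norm p"
    using assms unfolding V_dual_def by blast
  have "\<bar>f p + l p\<bar> \<le> (K + K') * V_norm p" if "p \<in> V" for p
    using K[OF that] by (simp add: distrib_right)
  then show ?thesis using assms unfolding V_dual_def by (auto simp: distrib_left)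
qed

text \<open>
  The zero functional enters the formula that recovers \<open>l p\<close> from dual energies.
\<close>
lemma V_dual_0: "(\<lambda>_. 0) \<in> V_dual"
  unfolding V_dual_def by (auto intro!: exI[of _ 0])

text \<open>
  The bilinear form of the elliptic operator. Its arguments are gradients rather than functions, so
  that classical and weak gradients can be inserted alike.
\<close>
definition energy :: "(real \<times> real \<Rightarrow> real) \<Rightarrow> (real \<times> real \<Rightarrow> real \<times> real) \<Rightarrow> (real \<times> real \<Rightarrow> real \<times> real) \<Rightarrow> real" where
  "energy \<kappa> g h = (LINT z|DM. \<kappa> z * (g z \<bullet> h z))"

lemma X_mult_L2:
  fixes h :: "real \<times> real \<Rightarrow> 'b::euclidean_space"
  assumes "\<kappa> \<in> X" "h \<in> L2"
  shows "(\<lambda>z. \<kappa> z *\<^sub>R h z) \<in> L2"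
proof -
  obtain K where "\<kappa> \<in> borel_measurable DM" "AE z in DM. \<bar>\<kappa> z\<bar> \<le> K" using assms(1) unfolding X_def by blast
  from L2_mult_bounded[OF this assms(2)] show ?thesis .
qed

lemma energy_alt: "energy \<kappa> g h = (LINT z|DM. g z \<bullet> (\<kappa> z *\<^sub>R h z))"
  by (simp add: energy_def)

lemma energy_integrable: "\<kappa> \<in> X \<Longrightarrow> g \<in> L2 \<Longrightarrow> h \<in> L2 \<Longrightarrow> integrable DM (\<lambda>z. \<kappa> z * (g z \<bullet> h z))"
  for g h :: "real \<times> real \<Rightarrow> real \<times> real"
  using L2_inner_integrable[OF _ X_mult_L2, of g \<kappa> h] by simp

lemma energy_add_scaleR:
  assumes "\<kappa> \<in> X" "g \<in> L2" "h \<in> L2" "k \<in> L2"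
  shows "energy \<kappa> (\<lambda>z. g z + t *\<^sub>R h z) k = energy \<kappa> g k + t * energy \<kappa> h k"
proof -
  have "energy \<kappa> (\<lambda>z. g z + t *\<^sub>R h z) k = (LINT z|DM. \<kappa> z * (g z \<bullet> k z) + t * (\<kappa> z * (h z \<bullet> k z)))"
    unfolding energy_def by (rule arg_cong[where f="integral\<^sup>L DM"]) (simp add: inner_add_left algebra_simps)
  then show ?thesis using energy_integrable[OF assms(1)] assms by (simp add: energy_def)
qed

lemma energy_commute: "energy \<kappa> g h = energy \<kappa> h g"
  by (simp add: energy_def inner_commute)

lemma energy_expand:
  assumes "\<kappa> \<in> X" "g \<in> L2" "h \<in> L2"
  shows "energy \<kappa> (\<lambda>z. g z + t *\<^sub>R h z) (\<lambda>z. g z + t *\<^sub>R h z) = energy \<kappa> g g + 2 * t * energy \<kappa> g h + t\<^sup>2 * energy \<kappa> h h"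
proof -
  let ?s = "\<lambda>z. g z + t *\<^sub>R h z"
  have s: "?s \<in> L2" by (rule L2_add_scaleR[OF assms(2,3)])
  have "energy \<kappa> ?s ?s = energy \<kappa> ?s g + t * energy \<kappa> ?s h"
    using energy_add_scaleR[OF assms s] by (simp add: energy_commute)
  also have "energy \<kappa> ?s g = energy \<kappa> g g + t * energy \<kappa> h g" by (rule energy_add_scaleR[OF assms assms(2)])
  also have "energy \<kappa> ?s h = energy \<kappa> g h + t * energy \<kappa> h h" by (rule energy_add_scaleR[OF assms assms(3)])
  finally show ?thesis by (simp add: energy_commute[of \<kappa> h g] power2_eq_square algebra_simps)
qed

lemma energy_cong_AE:
  assumes "\<kappa> \<in> X" "g \<in> L2" "h \<in> L2" "g' \<in> L2" "h' \<in> L2" "AE z in DM. g z = g' z" "AE z in DM. h z = h' z"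
  shows "energy \<kappa> g h = energy \<kappa> g' h'"
  unfolding energy_def
proof (rule integral_cong_AE)
  show "AE z in DM. \<kappa> z * (g z \<bullet> h z) = \<kappa> z * (g' z \<bullet> h' z)"
    using assms(6,7) by eventually_elim simp
qed (use energy_integrable[OF assms(1)] assms in \<open>auto intro: borel_measurable_integrable\<close>)

lemma energy_tendsto:
  assumes "\<kappa> \<in> X" "\<And>k. g k \<in> L2" "g' \<in> L2" "h \<in> L2" "(\<lambda>k. nsq (\<lambda>z. g k z - g' z)) \<longlonglongrightarrow> 0"
  shows "(\<lambda>k. energy \<kappa> (g k) h) \<longlonglongrightarrow> energy \<kappa> g' h"
  unfolding energy_alt by (rule L2_tendsto_inner[OF assms(2,3) X_mult_L2[OF assms(1,4)] assms(5)])

lemma energy_coercive: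
  assumes "\<kappa> \<in> X"
  obtains \<epsilon> where "\<epsilon> > 0" "\<And>g. g \<in> L2 \<Longrightarrow> \<epsilon> * nsq g \<le> energy \<kappa> g g"
proof -
  obtain \<epsilon> where \<epsilon>: "\<epsilon> > 0" "AE z in DM. \<epsilon> \<le> \<kappa> z" using assms unfolding X_def by blast
  have "\<epsilon> * nsq g \<le> energy \<kappa> g g" if "g \<in> L2" for g
  proof -
    have "(LINT z|DM. \<epsilon> * (norm (g z))\<^sup>2) \<le> (LINT z|DM. \<kappa> z * (g z \<bullet> g z))"
    proof (rule integral_mono_AE[OF _ energy_integrable[OF assms that that]])
      show "integrable DM (\<lambda>z. \<epsilon> * (norm (g z))\<^sup>2)" using L2_sq_integrable[OF that] by simp
      show "AE z in DM. \<epsilon> * (norm (g z))\<^sup>2 \<le> \<kappa> z * (g z \<bullet> g z)"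
        using \<epsilon>(2) by eventually_elim (simp add: power2_norm_eq_inner mult_right_mono)
    qed
    then show ?thesis by (simp add: energy_def)
  qed
  with \<epsilon>(1) show thesis by (rule that)
qed

lemma energy_nonneg:
  assumes "\<kappa> \<in> X" "g \<in> L2"
  shows "0 \<le> energy \<kappa> g g"
proof -
  obtain \<epsilon> where "\<epsilon> > 0" "\<epsilon> * nsq g \<le> energy \<kappa> g g" using energy_coercive[OF assms(1)] assms(2) by metis
  then show ?thesis using nsq_nonneg[of g] by (meson less_imp_le mult_nonneg_nonneg order_trans)
qed

text \<open>
  Young's inequality, with the weight chosen so that the quadratic term is absorbed by coercivity.
\<close>
lemma young_bound:
  fixes K \<epsilon> s :: real
  assumes "\<epsilon> > 0"
  shows "K * s \<le> \<epsilon> / 2 * s\<^sup>2 + K\<^sup>2 / (2 * \<epsilon>)"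
proof -
  have "0 \<le> (\<epsilon> * s - K)\<^sup>2 / (2 * \<epsilon>)" using assms by simp
  also have "\<dots> = \<epsilon> / 2 * s\<^sup>2 + K\<^sup>2 / (2 * \<epsilon>) - K * s"
    using assms by (simp add: field_simps power2_eq_square)
  finally show ?thesis by simp
qed

lemma dual_energy_bounded:
  assumes "\<kappa> \<in> X" "f \<in> V_dual"
  obtains C where "\<And>q. q \<in> V \<Longrightarrow> f q - 1/2 * energy \<kappa> (grad q) (grad q) \<le> C"
proof -
  obtain \<epsilon> where \<epsilon>: "\<epsilon> > 0" "\<And>g. g \<in> L2 \<Longrightarrow> \<epsilon> * nsq g \<le> energy \<kappa> g g"
    using energy_coercive[OF assms(1)] by metis
  obtain K where K: "\<And>p. p \<in> V \<Longrightarrow> \<bar>f p\<bar> \<le> K * sqrt (nsq (grad p))" using V_dual_bounded[OF assms(2)] by metis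
  have "f q - 1/2 * energy \<kappa> (grad q) (grad q) \<le> K\<^sup>2 / (2 * \<epsilon>)" if "q \<in> V" for q
  proof -
    have "f q \<le> K * sqrt (nsq (grad q))" using K[OF that] by simp
    also have "\<dots> \<le> \<epsilon> / 2 * (sqrt (nsq (grad q)))\<^sup>2 + K\<^sup>2 / (2 * \<epsilon>)" by (rule young_bound[OF \<epsilon>(1)])
    also have "(sqrt (nsq (grad q)))\<^sup>2 = nsq (grad q)" by (rule real_sqrt_pow2[OF nsq_nonneg])
    finally show ?thesis using \<epsilon>(2)[OF grad_V_L2[OF that]] by simp
  qed
  then show thesis by (rule that)
qed

lemma nonneg_quadratic_linear_term_zero:
  fixes b c :: real
  assumes "\<And>t. 0 \<le> t * c + t\<^sup>2 * b" "0 \<le> b"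
  shows "c = 0"
proof -
  define d where "d = b + 1"
  have d: "d > 0" "b = d - 1" using assms(2) by (simp_all add: d_def)
  \<comment> \<open>The value \<open>t = - c / (b + 1)\<close> makes the polynomial negative unless \<open>c = 0\<close>.\<close>
  have "0 \<le> (- c / d) * c + (- c / d)\<^sup>2 * b" by (rule assms(1))
  also have "\<dots> = - (c\<^sup>2 / d\<^sup>2)" unfolding d(2) using d(1) by (simp add: field_simps power2_eq_square)
  finally have "c\<^sup>2 / d\<^sup>2 \<le> 0" by simp
  then show ?thesis using d(1) by (simp add: divide_le_0_iff)
qed

lemma dgrad_test_combination:
  assumes "test_function \<phi>" "test_function \<psi>"
  shows "dgrad (\<lambda>z. \<phi> z + c * \<psi> z) = (\<lambda>z. dgrad \<phi> z + c *\<^sub>R dgrad \<psi> z)"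
  by (rule ext) (rule dgrad_add_cmult[OF assms])

text \<open>
  The Dirichlet principle. The functional \<open>J \<phi> = 1/2 \<integral> \<kappa> \<bar>\<nabla>\<phi>\<bar>\<^sup>2 - f \<phi>\<close> is bounded below on test functions.
  The parallelogram identity shows that the gradients of a minimising sequence are Cauchy, so the
  sequence has a limit \<open>p\<close> in \<open>V\<close>; the first variation of \<open>J\<close> vanishes at \<open>p\<close>, which is the weak
  equation against test functions, and by density against all of \<open>V\<close>.
\<close>
theorem weak_solution_exists:
  assumes f: "f \<in> V_dual" and \<kappa>: "\<kappa> \<in> X"
  shows "\<exists>p. weak_solution f \<kappa> p"
proof -
  define J where "J \<phi> = 1/2 * energy \<kappa> (dgrad \<phi>) (dgrad \<phi>) - f \<phi>" for \<phi>
  let ?T = "Collect test_function"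
  have comb: "test_function (\<lambda>z. \<phi> z + c * \<psi> z)" if "test_function \<phi>" "test_function \<psi>" for \<phi> \<psi> c
    by (rule test_function_add[OF that(1) test_function_cmult[OF that(2)]])
  have J_expand: "J (\<lambda>z. \<phi> z + t * \<psi> z) = J \<phi> + t * (energy \<kappa> (dgrad \<phi>) (dgrad \<psi>) - f \<psi>)
      + t\<^sup>2 / 2 * energy \<kappa> (dgrad \<psi>) (dgrad \<psi>)" if "test_function \<phi>" "test_function \<psi>" for \<phi> \<psi> t
    unfolding J_def dgrad_test_combination[OF that] energy_expand[OF \<kappa> dgrad_L2[OF that(1)] dgrad_L2[OF that(2)]]
      V_dual_add_cmult[OF f test_function_V[OF that(1)] test_function_V[OF that(2)]]
    by (simp add: field_simps)
  obtain C where C: "\<And>q. q \<in> V \<Longrightarrow> f q - 1/2 * energy \<kappa> (grad q) (grad q) \<le> C"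
    using dual_energy_bounded[OF \<kappa> f] by metis
  have J_bound: "- C \<le> J \<phi>" if \<phi>: "test_function \<phi>" for \<phi>
  proof -
    have "energy \<kappa> (grad \<phi>) (grad \<phi>) = energy \<kappa> (dgrad \<phi>) (dgrad \<phi>)"
      by (rule energy_cong_AE[OF \<kappa>]) (intro grad_V_L2 test_function_V \<phi> dgrad_L2 grad_test_function)+
    then show ?thesis using C[OF test_function_V[OF \<phi>]] by (simp add: J_def)
  qed
  define m where "m = (INF \<phi>\<in>?T. J \<phi>)"
  have bdd: "bdd_below (J ` ?T)" using J_bound by (intro bdd_belowI2[of _ "- C"]) auto
  have m_le: "m \<le> J \<phi>" if "test_function \<phi>" for \<phi>
    unfolding m_def by (rule cINF_lower[OF bdd]) (use that in simp)
  have "\<exists>\<phi>. test_function \<phi> \<and> J \<phi> < m + 1 / real (Suc k)" for k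
  proof -
    have "(INF \<phi>\<in>?T. J \<phi>) < m + 1 / real (Suc k)" by (simp add: m_def)
    then show ?thesis using test_function_zero_fun by (subst (asm) cINF_less_iff[OF _ bdd]) auto
  qed
  then obtain \<phi> where \<phi>: "\<And>k. test_function (\<phi> k)" and J\<phi>: "\<And>k. J (\<phi> k) < m + 1 / real (Suc k)" by metis
  obtain \<epsilon> where \<epsilon>: "\<epsilon> > 0" "\<And>g. g \<in> L2 \<Longrightarrow> \<epsilon> * nsq g \<le> energy \<kappa> g g"
    using energy_coercive[OF \<kappa>] by metis
  have close: "nsq (\<lambda>z. dgrad (\<phi> i) z - dgrad (\<phi> j) z) \<le> 4 / \<epsilon> * (1 / real (Suc i) + 1 / real (Suc j))" for i j
  proof -
    \<comment> \<open>Parallelogram identity: compare \<open>J\<close> at the two functions with \<open>J\<close> at their midpoint.\<close>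
    let ?h = "\<lambda>z. \<phi> i z + (-1) * \<phi> j z"
    have h: "test_function ?h" by (rule comb[OF \<phi> \<phi>])
    have full: "J (\<phi> i) = J (\<phi> j) + (energy \<kappa> (dgrad (\<phi> j)) (dgrad ?h) - f ?h) + 1/2 * energy \<kappa> (dgrad ?h) (dgrad ?h)"
      using J_expand[OF \<phi> h, of j 1] by simp
    have half: "J (\<lambda>z. \<phi> j z + 1/2 * ?h z) = J (\<phi> j) + 1/2 * (energy \<kappa> (dgrad (\<phi> j)) (dgrad ?h) - f ?h)
        + 1/8 * energy \<kappa> (dgrad ?h) (dgrad ?h)"
      using J_expand[OF \<phi> h, of j "1/2"] by (simp add: power2_eq_square)
    have "1/4 * energy \<kappa> (dgrad ?h) (dgrad ?h) = J (\<phi> i) + J (\<phi> j) - 2 * J (\<lambda>z. \<phi> j z + 1/2 * ?h z)"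
      unfolding full half by (simp add: field_simps)
    also have "\<dots> \<le> 1 / real (Suc i) + 1 / real (Suc j)"
      using J\<phi>[of i] J\<phi>[of j] m_le[OF comb[OF \<phi> h], of j "1/2"] by linarith
    finally have "energy \<kappa> (dgrad ?h) (dgrad ?h) \<le> 4 * (1 / real (Suc i) + 1 / real (Suc j))" by simp
    with \<epsilon>(2)[OF dgrad_L2[OF h]] have "\<epsilon> * nsq (dgrad ?h) \<le> 4 * (1 / real (Suc i) + 1 / real (Suc j))"
      by (rule order_trans)
    then have "nsq (dgrad ?h) \<le> 4 / \<epsilon> * (1 / real (Suc i) + 1 / real (Suc j))"
      using \<epsilon>(1) by (simp add: pos_le_divide_eq mult.commute)
    then show ?thesis unfolding dgrad_test_combination[OF \<phi> \<phi>] by simp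
  qed
  have "\<exists>p\<in>V. (\<lambda>k. nsq (\<lambda>z. dgrad (\<phi> k) z - grad p z)) \<longlonglongrightarrow> 0"
  proof (rule V_complete[OF \<phi>])
    fix e :: real assume "e > 0"
    then have "0 < e * \<epsilon> / 8" using \<epsilon>(1) by simp
    then obtain N where N: "1 / real (Suc N) < e * \<epsilon> / 8" using nat_approx_posE by metis
    have "nsq (\<lambda>z. dgrad (\<phi> i) z - dgrad (\<phi> j) z) < e" if "i \<ge> N" "j \<ge> N" for i j
    proof -
      have "1 / real (Suc i) \<le> 1 / real (Suc N)" "1 / real (Suc j) \<le> 1 / real (Suc N)"
        using that by (simp_all add: frac_le)
      then have "4 / \<epsilon> * (1 / real (Suc i) + 1 / real (Suc j)) < 4 / \<epsilon> * (e * \<epsilon> / 4)"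
        using \<epsilon>(1) N by (intro mult_strict_left_mono) auto
      also have "\<dots> = e" using \<epsilon>(1) by simp
      finally show ?thesis using close[of i j] by linarith
    qed
    then show "\<exists>N. \<forall>m\<ge>N. \<forall>n\<ge>N. nsq (\<lambda>z. dgrad (\<phi> m) z - dgrad (\<phi> n) z) < e" by blast
  qed
  then obtain p where p: "p \<in> V" and lim: "(\<lambda>k. nsq (\<lambda>z. dgrad (\<phi> k) z - grad p z)) \<longlonglongrightarrow> 0" by blast
  have test: "energy \<kappa> (grad p) (dgrad \<psi>) = f \<psi>" if \<psi>: "test_function \<psi>" for \<psi>
  proof -
    have "0 \<le> t * (energy \<kappa> (grad p) (dgrad \<psi>) - f \<psi>) + t\<^sup>2 * (1/2 * energy \<kappa> (dgrad \<psi>) (dgrad \<psi>))" for t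
    proof (rule LIMSEQ_le)
      have "(\<lambda>k. - (1 / real (Suc k))) \<longlonglongrightarrow> - 0"
        by (intro tendsto_minus LIMSEQ_Suc lim_1_over_n)
      then show "(\<lambda>k. - (1 / real (Suc k))) \<longlonglongrightarrow> 0" by simp
      show "(\<lambda>k. t * (energy \<kappa> (dgrad (\<phi> k)) (dgrad \<psi>) - f \<psi>) + t\<^sup>2 * (1/2 * energy \<kappa> (dgrad \<psi>) (dgrad \<psi>)))
          \<longlonglongrightarrow> t * (energy \<kappa> (grad p) (dgrad \<psi>) - f \<psi>) + t\<^sup>2 * (1/2 * energy \<kappa> (dgrad \<psi>) (dgrad \<psi>))"
        by (intro tendsto_add tendsto_mult tendsto_diff tendsto_const
            energy_tendsto[OF \<kappa> dgrad_L2[OF \<phi>] grad_V_L2[OF p] dgrad_L2[OF \<psi>] lim])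
      have "- (1 / real (Suc k)) \<le> t * (energy \<kappa> (dgrad (\<phi> k)) (dgrad \<psi>) - f \<psi>) + t\<^sup>2 * (1/2 * energy \<kappa> (dgrad \<psi>) (dgrad \<psi>))" for k
        using m_le[OF comb[OF \<phi> \<psi>], of k t] J\<phi>[of k] unfolding J_expand[OF \<phi> \<psi>] by simp
      then show "\<exists>N. \<forall>k\<ge>N. - (1 / real (Suc k)) \<le> t * (energy \<kappa> (dgrad (\<phi> k)) (dgrad \<psi>) - f \<psi>) + t\<^sup>2 * (1/2 * energy \<kappa> (dgrad \<psi>) (dgrad \<psi>))"
        by blast
    qed
    then have "energy \<kappa> (grad p) (dgrad \<psi>) - f \<psi> = 0"
      by (rule nonneg_quadratic_linear_term_zero) (use energy_nonneg[OF \<kappa> dgrad_L2[OF \<psi>]] in simp)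
    then show ?thesis by simp
  qed
  have "energy \<kappa> (grad p) (grad q) = f q" if q: "q \<in> V" for q
  proof -
    obtain \<psi> where \<psi>: "\<And>k. test_function (\<psi> k)" and lim\<psi>: "(\<lambda>k. nsq (\<lambda>z. dgrad (\<psi> k) z - grad q z)) \<longlonglongrightarrow> 0"
      using q unfolding V_iff by blast
    have "(\<lambda>k. energy \<kappa> (grad p) (dgrad (\<psi> k))) \<longlonglongrightarrow> energy \<kappa> (grad p) (grad q)"
      using energy_tendsto[OF \<kappa> dgrad_L2[OF \<psi>] grad_V_L2[OF q] grad_V_L2[OF p] lim\<psi>] by (simp add: energy_commute)
    moreover have "(\<lambda>k. f (\<psi> k)) \<longlonglongrightarrow> f q"
    proof -
      obtain K where K: "\<And>p. p \<in> V \<Longrightarrow> \<bar>f p\<bar> \<le> K * sqrt (nsq (grad p))" using V_dual_bounded[OF f] by metis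
      have bound: "\<bar>f (\<psi> k) - f q\<bar> \<le> K * sqrt (nsq (\<lambda>z. dgrad (\<psi> k) z - grad q z))" for k
      proof -
        let ?r = "\<lambda>z. \<psi> k z + (-1) * q z"
        note \<psi>V = test_function_V[OF \<psi>, of k]
        have r: "?r \<in> V" by (rule V_add_cmult[OF \<psi>V q])
        have "nsq (grad ?r) = nsq (\<lambda>z. dgrad (\<psi> k) z - grad q z)"
        proof (rule nsq_cong_AE[OF grad_V_L2[OF r]])
          show "AE z in DM. grad ?r z = dgrad (\<psi> k) z - grad q z"
            using H1_add_cmult(2)[OF V_H1[OF \<psi>V] V_H1[OF q], of "-1"] grad_test_function[OF \<psi>[of k]]
            by eventually_elim simp
        qed (intro L2_diff dgrad_L2 \<psi> grad_V_L2 q)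
        moreover have "f ?r = f (\<psi> k) - f q" using V_dual_add_cmult[OF f \<psi>V q, of "-1"] by simp
        ultimately show ?thesis using K[OF r] by simp
      qed
      have "(\<lambda>k. sqrt (nsq (\<lambda>z. dgrad (\<psi> k) z - grad q z))) \<longlonglongrightarrow> 0"
        using tendsto_real_sqrt[OF lim\<psi>] by simp
      then have "(\<lambda>k. K * sqrt (nsq (\<lambda>z. dgrad (\<psi> k) z - grad q z))) \<longlonglongrightarrow> 0"
        by (rule tendsto_mult_right_zero)
      then have "(\<lambda>k. f (\<psi> k) - f q) \<longlonglongrightarrow> 0"
        by (rule Lim_null_comparison[OF always_eventually, rotated]) (use bound in simp)
      then show ?thesis by (rule LIM_zero_cancel)
    qed
    ultimately show ?thesis unfolding test[OF \<psi>] by (rule LIMSEQ_unique)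
  qed
  then show ?thesis unfolding weak_solution_def using \<kappa> p by (auto simp: energy_def)
qed

text \<open>
  One half of the squared dual norm of \<open>l\<close> for the energy of \<open>\<kappa>\<close>. As a supremum over \<open>V\<close> of
  expressions that depend on \<open>\<kappa>\<close> through a single integral, its dependence on \<open>\<kappa>\<close> is easy to control.
\<close>
definition dual_energy :: "(real \<times> real \<Rightarrow> real) \<Rightarrow> ((real \<times> real \<Rightarrow> real) \<Rightarrow> real) \<Rightarrow> real" where
  "dual_energy \<kappa> l = (SUP q\<in>V. l q - 1/2 * energy \<kappa> (grad q) (grad q))"

text \<open>
  Completing the square: in the supremum on the left, substitute \<open>q = p + r\<close>; since the energy of
  \<open>p\<close> against \<open>r\<close> is \<open>f r\<close>, the terms linear in \<open>f\<close> cancel and the supremum for \<open>l\<close> alone remains.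
\<close>
lemma dual_energy_shift:
  assumes f: "f \<in> V_dual" and l: "l \<in> V_dual" and p: "weak_solution f \<kappa> p"
  shows "dual_energy \<kappa> (\<lambda>q. f q + l q) = 1/2 * f p + l p + dual_energy \<kappa> l"
proof -
  have \<kappa>: "\<kappa> \<in> X" and pV: "p \<in> V" and eq: "\<And>q. q \<in> V \<Longrightarrow> energy \<kappa> (grad p) (grad q) = f q"
    using p by (auto simp: weak_solution_def energy_def)
  let ?H = "\<lambda>r. l r - 1/2 * energy \<kappa> (grad r) (grad r)"
  let ?F = "\<lambda>q. f q + l q - 1/2 * energy \<kappa> (grad q) (grad q)"
  define c where "c = 1/2 * f p + l p"
  have shift: "?F (\<lambda>z. p z + 1 * r z) = c + ?H r" if r: "r \<in> V" for r
  proof -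
    have "energy \<kappa> (grad (\<lambda>z. p z + 1 * r z)) (grad (\<lambda>z. p z + 1 * r z)) =
        energy \<kappa> (\<lambda>z. grad p z + 1 *\<^sub>R grad r z) (\<lambda>z. grad p z + 1 *\<^sub>R grad r z)"
      by (rule energy_cong_AE[OF \<kappa>])
        (intro grad_V_L2 V_add_cmult pV r L2_add_scaleR H1_add_cmult V_H1)+
    then show ?thesis
      unfolding V_dual_add_cmult[OF f pV r] V_dual_add_cmult[OF l pV r]
      by (simp add: energy_expand[OF \<kappa> grad_V_L2[OF pV] grad_V_L2[OF r], of 1, simplified] eq[OF pV] eq[OF r] c_def field_simps)
  qed
  obtain C where C: "\<And>q. q \<in> V \<Longrightarrow> ?H q \<le> C" using dual_energy_bounded[OF \<kappa> l] by metis
  obtain C' where C': "\<And>q. q \<in> V \<Longrightarrow> ?F q \<le> C'" using dual_energy_bounded[OF \<kappa> V_dual_add[OF f l]] by metis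
  have ne: "V \<noteq> {}" using pV by blast
  have bH: "bdd_above (?H ` V)" using C by (rule bdd_aboveI2)
  have bF: "bdd_above (?F ` V)" using C' by (rule bdd_aboveI2)
  have "(SUP q\<in>V. ?F q) \<le> c + (SUP r\<in>V. ?H r)"
  proof (rule cSUP_least[OF ne])
    fix q assume q: "q \<in> V"
    let ?r = "\<lambda>z. q z + (-1) * p z"
    have r: "?r \<in> V" by (rule V_add_cmult[OF q pV])
    have "?F q = c + ?H ?r" using shift[OF r] by simp
    then show "?F q \<le> c + (SUP r\<in>V. ?H r)" using cSUP_upper[OF r bH] by simp
  qed
  moreover have "(SUP r\<in>V. ?H r) \<le> (SUP q\<in>V. ?F q) - c"
  proof (rule cSUP_least[OF ne])
    fix r assume r: "r \<in> V"
    have "?F (\<lambda>z. p z + 1 * r z) \<le> (SUP q\<in>V. ?F q)" by (rule cSUP_upper[OF V_add_cmult[OF pV r] bF])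
    then show "?H r \<le> (SUP q\<in>V. ?F q) - c" unfolding shift[OF r] by simp
  qed
  ultimately show ?thesis by (simp add: dual_energy_def c_def)
qed

text \<open>
  Polarisation expresses an observation of the solution by dual energies. In this form it can be
  seen to depend measurably on \<open>\<kappa>\<close>, without any stability estimate for the solution operator.
\<close>
theorem functional_of_solution:
  assumes f: "f \<in> V_dual" and l: "l \<in> V_dual" and p: "weak_solution f \<kappa> p"
  shows "l p = dual_energy \<kappa> (\<lambda>q. f q + l q) - dual_energy \<kappa> l - dual_energy \<kappa> f + dual_energy \<kappa> (\<lambda>_. 0)"
  using dual_energy_shift[OF f l p] dual_energy_shift[OF f V_dual_0 p] by simp

lemma weak_solution_G: "f \<in> V_dual \<Longrightarrow> \<kappa> \<in> X \<Longrightarrow> weak_solution f \<kappa> (G f \<kappa>)"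
  unfolding G_def by (rule someI_ex[OF weak_solution_exists])

section \<open>The layered permeability and the forward map\<close>

lemma coord_no_range:
  "range (coord_no :: 'n::{finite,linorder} \<Rightarrow> nat) = {1..CARD('n)}"
proof (rule card_subset_eq)
  have mono: "coord_no i < coord_no j" if "i < j" for i j :: 'n
  proof -
    have "{k. k \<le> i} \<subseteq> {k. k \<le> j}" "j \<in> {k. k \<le> j}" "j \<notin> {k. k \<le> i}" using that by auto
    then have "{k. k \<le> i} \<subset> {k. k \<le> j}" by blast
    then show ?thesis unfolding coord_no_def by (rule psubset_card_mono[rotated]) simp
  qed
  then have "inj (coord_no :: 'n \<Rightarrow> nat)"
    by (intro linorder_injI) (metis less_irrefl)
  then show "card (range (coord_no :: 'n \<Rightarrow> nat)) = card {1..CARD('n)}" by (simp add: card_image)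
  show "range (coord_no :: 'n \<Rightarrow> nat) \<subseteq> {1..CARD('n)}"
  proof
    fix k assume "k \<in> range (coord_no :: 'n \<Rightarrow> nat)"
    then obtain i :: 'n where k: "k = card {j. j \<le> i}" by (auto simp: coord_no_def)
    have "card {i} \<le> card {j. j \<le> i}" by (rule card_mono) auto
    moreover have "card {j. j \<le> i} \<le> CARD('n)" by (rule card_mono) auto
    ultimately show "k \<in> {1..CARD('n)}" by (simp add: k)
  qed
qed simp

lemma AE_DM_not_in_hyperplane:
  assumes "v \<noteq> 0"
  shows "AE z in DM. v \<bullet> z \<noteq> d"
proof -
  have "{z. v \<bullet> z = d} \<in> null_sets lebesgue"
    using negligible_hyperplane[of v d] assms by (simp add: negligible_iff_null_sets)
  from AE_not_in[OF this] have "AE z in lebesgue. z \<in> D \<longrightarrow> v \<bullet> z \<noteq> d" by eventually_elim simp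
  then show ?thesis by (simp add: AE_restrict_space_iff)
qed

text \<open>
  On either side of the fault every interface is part of a line, and lines are null sets.
\<close>
lemma AE_off_interfaces:
  fixes a b :: "real ^ 'm::{finite,linorder}"
  shows "AE z in DM. \<forall>i. depth a b c i (fst z) \<noteq> ereal (1 - snd z)"
  unfolding AE_all_countable
proof
  fix i
  define A where "A = (\<Sum>k | coord_no k \<le> i. a $ k)"
  define B where "B = (\<Sum>k | coord_no k \<le> i. b $ k)"
  have cum: "cum_thickness a b i x = B + (A - B) * x" for x
    unfolding cum_thickness_def A_def B_def
    by (simp add: algebra_simps sum.distrib sum_subtractf sum_distrib_left)
  have v: "(A - B, 1) \<noteq> (0 :: real \<times> real)" by (simp add: zero_prod_def)
  show "AE z in DM. depth a b c i (fst z) \<noteq> ereal (1 - snd z)"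
    using AE_DM_not_in_hyperplane[OF v, of "1 - B - c"] AE_DM_not_in_hyperplane[OF v, of "1 - B"]
  proof eventually_elim
    case (elim z)
    then show ?case by (auto simp: depth_def cum inner_prod_def)
  qed
qed

text \<open>
  The layer is the first one whose lower interface lies strictly below \<open>z\<close>. There is one because the
  last interface has infinite depth.
\<close>
lemma exists_layer:
  fixes a b :: "real ^ 'm::{finite,linorder}"
  assumes card: "CARD('n::{finite,linorder}) = CARD('m) + 1"
    and z: "z \<in> D" "fst z \<noteq> 1/2" and off: "\<forall>i. depth a b c i (fst z) \<noteq> ereal (1 - snd z)"
  shows "\<exists>i::'n. z \<in> layer a b c (coord_no i)"
proof -
  let ?P = "\<lambda>j. 0 < j \<and> ereal (1 - snd z) < depth a b c j (fst z)"
  define j where "j = (LEAST j. ?P j)"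
  have P: "?P (CARD('m) + 1)" by (simp add: depth_def)
  then have j: "?P j" unfolding j_def by (rule LeastI)
  have "j \<le> CARD('m) + 1" unfolding j_def using P by (rule Least_le)
  then have "j \<in> range (coord_no :: 'n \<Rightarrow> nat)" using j unfolding coord_no_range card by auto
  then obtain i :: 'n where i: "j = coord_no i" by blast
  have "depth a b c (j - 1) (fst z) < ereal (1 - snd z)"
  proof (cases "j = 1")
    case True
    then show ?thesis by (simp add: depth_def)
  next
    case False
    have "j - 1 < (LEAST j. ?P j)" using j unfolding j_def[symmetric] by simp
    then have "\<not> ?P (j - 1)" by (rule not_less_Least)
    moreover have "0 < j - 1" using False j by simp
    ultimately have "depth a b c (j - 1) (fst z) \<le> ereal (1 - snd z)" by (simp only: not_less simp_thms)
    then show ?thesis using off unfolding order_less_le by blast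
  qed
  then have "z \<in> layer a b c j" using z j by (cases z) (simp add: layer_def)
  then show ?thesis using i by blast
qed

lemma continuous_on_Abs_Dbar: "continuous_on (closure D) Abs_Dbar"
  unfolding continuous_on_iff
proof (intro ballI allI impI)
  fix s and e :: real assume "s \<in> closure D" "0 < e"
  then show "\<exists>d>0. \<forall>s'\<in>closure D. dist s' s < d \<longrightarrow> dist (Abs_Dbar s') (Abs_Dbar s) < e"
    by (intro exI[of _ e]) (simp add: dist_Dbar_def Abs_Dbar_inverse)
qed

lemma F_eq: "F (a, b, c, \<alpha>) z = (\<Sum>i\<in>UNIV. exp (apply_bcontfun \<alpha> (Abs_Dbar z) $ i) * indicator (layer a b c (coord_no i)) z)"
  by (simp add: F_def)

lemma log_permeability_bound: "\<bar>apply_bcontfun \<alpha> s $ i\<bar> \<le> norm \<alpha>"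
  using component_le_norm_cart[of "apply_bcontfun \<alpha> s" i] norm_bounded[of \<alpha> s] by linarith

lemma F_nonneg: "0 \<le> F u z"
  by (cases u) (auto simp: F_eq intro!: sum_nonneg)

lemma F_upper_bound: "F (a, b, c, \<alpha> :: Dbar \<Rightarrow>\<^sub>C (real ^ 'n::{finite,linorder})) z \<le> CARD('n) * exp (norm \<alpha>)"
proof -
  have "F (a, b, c, \<alpha>) z \<le> (\<Sum>i\<in>(UNIV :: 'n set). exp (norm \<alpha>))"
    unfolding F_eq
  proof (rule sum_mono)
    fix i :: 'n
    have "apply_bcontfun \<alpha> (Abs_Dbar z) $ i \<le> norm \<alpha>" using log_permeability_bound[of \<alpha> "Abs_Dbar z" i] by linarith
    then have "exp (apply_bcontfun \<alpha> (Abs_Dbar z) $ i) * indicator (layer a b c (coord_no i)) z \<le> exp (norm \<alpha>) * 1"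
      by (intro mult_mono) (auto simp: indicator_def)
    then show "exp (apply_bcontfun \<alpha> (Abs_Dbar z) $ i) * indicator (layer a b c (coord_no i)) z \<le> exp (norm \<alpha>)"
      by simp
  qed
  then show ?thesis by simp
qed

lemma layer_borel: "layer a b c i \<in> sets borel"
proof -
  have [measurable]: "depth a b c i \<in> borel_measurable borel" for i
    unfolding depth_def[abs_def] cum_thickness_def by measurable
  have eq: "layer a b c i = {z \<in> space borel. z \<in> D \<and> fst z \<noteq> 1/2 \<and>
      depth a b c (i - 1) (fst z) < ereal (1 - snd z) \<and> ereal (1 - snd z) < depth a b c i (fst z)}"
    by (auto simp: layer_def)
  have [measurable]: "(fst :: real \<times> real \<Rightarrow> real) \<in> borel_measurable borel" "(snd :: real \<times> real \<Rightarrow> real) \<in> borel_measurable borel"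
    by (auto intro!: borel_measurable_continuous_onI continuous_intros)
  show ?thesis unfolding eq by measurable
qed

lemma F_measurable: "F u \<in> borel_measurable DM"
proof -
  obtain a b c \<alpha> where u: "u = (a, b, c, \<alpha>)" by (cases u) blast
  have "(\<lambda>z. exp (apply_bcontfun \<alpha> (Abs_Dbar z) $ i) * indicator (layer a b c (coord_no i)) z) \<in> borel_measurable DM" for i
  proof (rule borel_measurable_times)
    have cont: "continuous_on UNIV (apply_bcontfun \<alpha>)" by simp
    have "continuous_on D (\<lambda>z. apply_bcontfun \<alpha> (Abs_Dbar z))"
      by (rule continuous_on_compose2[OF cont continuous_on_subset[OF continuous_on_Abs_Dbar closure_subset]]) simp
    then have "continuous_on D (\<lambda>z. exp (apply_bcontfun \<alpha> (Abs_Dbar z) $ i))"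
      by (intro continuous_on_exp continuous_on_component)
    then show "(\<lambda>z. exp (apply_bcontfun \<alpha> (Abs_Dbar z) $ i)) \<in> borel_measurable DM"
      by (rule continuous_imp_measurable_on_sets_lebesgue) simp
    show "(\<lambda>z. indicator (layer a b c (coord_no i)) z :: real) \<in> borel_measurable DM"
      by (rule measurable_lebesgue_on_D) (intro borel_measurable_indicator layer_borel)
  qed
  then have "(\<lambda>z. F u z) \<in> borel_measurable DM" unfolding u F_eq by (intro borel_measurable_sum)
  then show ?thesis by simp
qed

text \<open>
  Off the interfaces and the fault at least one layer contains the point, which bounds the
  permeability from below by \<open>e\<close> to the power \<open>- norm \<alpha>\<close>.
\<close>
lemma F_in_X:
  fixes u :: "('m::{finite,linorder}, 'n::{finite,linorder}) params"
  assumes card: "CARD('n) = CARD('m) + 1"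
  shows "F u \<in> X"
proof -
  obtain a b c \<alpha> where u: "u = (a, b, c, \<alpha>)" by (cases u) blast
  have upper: "AE z in DM. \<bar>F u z\<bar> \<le> CARD('n) * exp (norm \<alpha>)"
    using F_nonneg[of u] F_upper_bound[of a b c \<alpha>] unfolding u by (intro AE_I2) simp
  have "AE z in DM. fst z \<noteq> 1/2"
    using AE_DM_not_in_hyperplane[of "(1, 0)" "1/2"] by (simp add: zero_prod_def inner_prod_def)
  then have lower: "AE z in DM. exp (- norm \<alpha>) \<le> F u z"
    using AE_off_interfaces[of a b c] AE_space
  proof eventually_elim
    case (elim z)
    then obtain i :: 'n where i: "z \<in> layer a b c (coord_no i)"
      using exists_layer[OF card, of z a b c] by auto
    have "exp (- norm \<alpha>) \<le> exp (apply_bcontfun \<alpha> (Abs_Dbar z) $ i)"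
      using log_permeability_bound[of \<alpha> "Abs_Dbar z" i] by simp
    also have "\<dots> = exp (apply_bcontfun \<alpha> (Abs_Dbar z) $ i) * indicator (layer a b c (coord_no i)) z"
      using i by simp
    also have "\<dots> \<le> F u z"
      unfolding u F_eq by (rule member_le_sum) auto
    finally show ?case .
  qed
  have "(0::real) < exp (- norm \<alpha>)" by simp
  with F_measurable[of u] upper lower show ?thesis unfolding X_def by blast
qed

lemma depth_tendsto:
  fixes a :: "nat \<Rightarrow> real ^ 'm::{finite,linorder}"
  assumes "a \<longlonglongrightarrow> a'" "b \<longlonglongrightarrow> b'" "c \<longlonglongrightarrow> c'"
  shows "(\<lambda>k. depth (a k) (b k) (c k) i x) \<longlonglongrightarrow> depth a' b' c' i x"
proof -
  have "(\<lambda>k. cum_thickness (a k) (b k) i x + (if x < 1/2 then c k else 0)) \<longlonglongrightarrow>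
      cum_thickness a' b' i x + (if x < 1/2 then c' else 0)"
    unfolding cum_thickness_def using assms by (auto intro!: tendsto_intros)
  then show ?thesis by (auto simp: depth_def)
qed

text \<open>
  The strict inequalities that decide membership in a layer are stable under small changes of the
  geometry, at every point off the limiting interfaces.
\<close>
lemma eventually_in_layer_iff:
  fixes a :: "nat \<Rightarrow> real ^ 'm::{finite,linorder}"
  assumes lim: "a \<longlonglongrightarrow> a'" "b \<longlonglongrightarrow> b'" "c \<longlonglongrightarrow> c'"
    and off: "\<forall>i. depth a' b' c' i (fst z) \<noteq> ereal (1 - snd z)"
  shows "eventually (\<lambda>k. z \<in> layer (a k) (b k) (c k) i \<longleftrightarrow> z \<in> layer a' b' c' i) sequentially"
proof -
  let ?d = "\<lambda>k j. depth (a k) (b k) (c k) j (fst z)" and ?t = "ereal (1 - snd z)"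
  have side: "eventually (\<lambda>k. (?d k j < ?t \<longleftrightarrow> depth a' b' c' j (fst z) < ?t) \<and>
      (?t < ?d k j \<longleftrightarrow> ?t < depth a' b' c' j (fst z))) sequentially" for j
  proof (cases "depth a' b' c' j (fst z) < ?t")
    case True
    from order_tendstoD(2)[OF depth_tendsto[OF lim] this] show ?thesis
      by eventually_elim (use True in auto)
  next
    case False
    then have gt: "?t < depth a' b' c' j (fst z)" using off by (metis linorder_cases)
    from order_tendstoD(1)[OF depth_tendsto[OF lim] this] show ?thesis
      by eventually_elim (use gt in auto)
  qed
  show ?thesis using side[of "i - 1"] side[of i]
    by eventually_elim (cases z, simp add: layer_def)
qed

lemma F_tendsto:
  fixes u :: "nat \<Rightarrow> ('m::{finite,linorder}, 'n::{finite,linorder}) params"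
  assumes lim: "u \<longlonglongrightarrow> (a, b, c, \<alpha>)" and off: "\<forall>i. depth a b c i (fst z) \<noteq> ereal (1 - snd z)"
  shows "(\<lambda>k. F (u k) z) \<longlonglongrightarrow> F (a, b, c, \<alpha>) z"
proof -
  define ak bk ck \<alpha>k where defs: "ak k = fst (u k)" "bk k = fst (snd (u k))" "ck k = fst (snd (snd (u k)))" "\<alpha>k k = snd (snd (snd (u k)))" for k
  have u: "u k = (ak k, bk k, ck k, \<alpha>k k)" for k by (simp add: defs)
  have l: "ak \<longlonglongrightarrow> a" "bk \<longlonglongrightarrow> b" "ck \<longlonglongrightarrow> c" "\<alpha>k \<longlonglongrightarrow> \<alpha>"
    using tendsto_fst[OF lim] tendsto_fst[OF tendsto_snd[OF lim]] tendsto_fst[OF tendsto_snd[OF tendsto_snd[OF lim]]]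
      tendsto_snd[OF tendsto_snd[OF tendsto_snd[OF lim]]] by (simp_all add: defs[abs_def])
  have "(\<lambda>k. apply_bcontfun (\<alpha>k k) s) \<longlonglongrightarrow> apply_bcontfun \<alpha> s" for s
  proof (rule metric_tendsto_imp_tendsto[OF l(4)])
    show "\<forall>\<^sub>F k in sequentially. dist (apply_bcontfun (\<alpha>k k) s) (apply_bcontfun \<alpha> s) \<le> dist (\<alpha>k k) \<alpha>"
      by (intro always_eventually allI dist_bounded)
  qed
  then have e: "(\<lambda>k. exp (apply_bcontfun (\<alpha>k k) s $ i)) \<longlonglongrightarrow> exp (apply_bcontfun \<alpha> s $ i)" for s i
    by (intro tendsto_exp tendsto_vec_nth)
  have ind: "(\<lambda>k. indicator (layer (ak k) (bk k) (ck k) j) z :: real) \<longlonglongrightarrow> indicator (layer a b c j) z" for j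
  proof (rule tendsto_eventually)
    show "\<forall>\<^sub>F k in sequentially. indicator (layer (ak k) (bk k) (ck k) j) z = (indicator (layer a b c j) z :: real)"
      using eventually_in_layer_iff[OF l(1-3) off, of j] by eventually_elim (simp add: indicator_def)
  qed
  show ?thesis unfolding u F_eq by (intro tendsto_sum tendsto_mult e ind)
qed

text \<open>
  The permeability converges pointwise off a null set and stays bounded, so dominated convergence
  applies. In the uniform norm the permeability would not be continuous in the geometry; testing
  against an integrable function is what makes the dependence continuous.
\<close>
lemma continuous_weighted_integral_F:
  fixes w :: "real \<times> real \<Rightarrow> real"
  assumes w: "integrable DM w"
  shows "continuous_on UNIV (\<lambda>u :: ('m::{finite,linorder}, 'n::{finite,linorder}) params. LINT z|DM. F u z * w z)"
proof (rule continuous_on_sequentiallyI)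
  fix u :: "nat \<Rightarrow> ('m, 'n) params" and u' assume lim: "u \<longlonglongrightarrow> u'"
  obtain a b c \<alpha> where u': "u' = (a, b, c, \<alpha>)" by (cases u') blast
  have "(\<lambda>k. snd (snd (snd (u k)))) \<longlonglongrightarrow> \<alpha>"
    using tendsto_snd[OF tendsto_snd[OF tendsto_snd[OF lim]]] by (simp add: u')
  then have "Bseq (\<lambda>k. snd (snd (snd (u k))))" by (intro convergent_imp_Bseq convergentI)
  then obtain R where R: "\<And>k. norm (snd (snd (snd (u k)))) \<le> R" unfolding Bseq_def by blast
  have bound: "F (u k) z \<le> CARD('n) * exp R" for k z
  proof -
    have "F (u k) z \<le> CARD('n) * exp (norm (snd (snd (snd (u k)))))"
      using F_upper_bound[of "fst (u k)" "fst (snd (u k))" "fst (snd (snd (u k)))" "snd (snd (snd (u k)))" z] by simp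
    also have "\<dots> \<le> CARD('n) * exp R" using R by (intro mult_left_mono) auto
    finally show ?thesis .
  qed
  show "(\<lambda>k. LINT z|DM. F (u k) z * w z) \<longlonglongrightarrow> (LINT z|DM. F u' z * w z)"
  proof (rule integral_dominated_convergence[where w="\<lambda>z. CARD('n) * exp R * \<bar>w z\<bar>"])
    show "(\<lambda>z. F u' z * w z) \<in> borel_measurable DM" "(\<lambda>z. F (u k) z * w z) \<in> borel_measurable DM" for k
      by (intro borel_measurable_times F_measurable borel_measurable_integrable[OF w])+
    show "integrable DM (\<lambda>z. CARD('n) * exp R * \<bar>w z\<bar>)" using w by simp
    show "AE z in DM. (\<lambda>k. F (u k) z * w z) \<longlonglongrightarrow> F u' z * w z"
      using AE_off_interfaces[of a b c]
    proof eventually_elim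
      case (elim z)
      then show ?case using F_tendsto[OF lim[unfolded u'] elim] unfolding u' by (intro tendsto_mult tendsto_const)
    qed
    show "AE z in DM. norm (F (u k) z * w z) \<le> CARD('n) * exp R * \<bar>w z\<bar>" for k
      using bound F_nonneg[of "u k"] by (intro AE_I2) (simp add: abs_mult mult_right_mono)
  qed
qed

text \<open>
  A supremum of continuous functions is lower semicontinuous, hence Borel, even though \<open>V\<close> is
  uncountable.
\<close>
lemma dual_energy_borel:
  assumes card: "CARD('n::{finite,linorder}) = CARD('m::{finite,linorder}) + 1" and l: "l \<in> V_dual"
  shows "(\<lambda>u :: ('m, 'n) params. dual_energy (F u) l) \<in> borel_measurable borel"
proof (rule borel_measurableI_greater)
  fix t :: real
  let ?H = "\<lambda>q u. l q - 1/2 * energy (F u) (grad q) (grad q)"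
  have ne: "V \<noteq> {}" using test_function_V[OF test_function_zero_fun] by blast
  have bdd: "bdd_above ((\<lambda>q. ?H q u) ` V)" for u :: "('m, 'n) params"
  proof -
    obtain K where "\<And>q. q \<in> V \<Longrightarrow> ?H q u \<le> K" using dual_energy_bounded[OF F_in_X[OF card] l] by metis
    then show ?thesis by (rule bdd_aboveI2)
  qed
  have "t < dual_energy (F u) l \<longleftrightarrow> (\<exists>q\<in>V. t < ?H q u)" for u :: "('m, 'n) params"
    unfolding dual_energy_def by (rule less_cSUP_iff[OF ne bdd])
  then have "{u \<in> space borel. t < dual_energy (F u) l} = (\<Union>q\<in>V. {u :: ('m, 'n) params. t < ?H q u})"
    by (intro set_eqI) simp
  moreover have "open (\<Union>q\<in>V. {u :: ('m, 'n) params. t < ?H q u})"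
  proof (intro open_UN ballI open_Collect_less continuous_on_const continuous_on_diff continuous_on_mult)
    fix q assume "q \<in> V"
    then show "continuous_on UNIV (\<lambda>u :: ('m, 'n) params. energy (F u) (grad q) (grad q))"
      unfolding energy_def by (intro continuous_weighted_integral_F L2_inner_integrable grad_V_L2)
  qed
  ultimately show "{u \<in> space borel. t < dual_energy (F u) l} \<in> sets (borel :: ('m, 'n) params measure)"
    by simp
qed

theorem forward_map_borel:
  fixes l :: "'J::finite \<Rightarrow> (real \<times> real \<Rightarrow> real) \<Rightarrow> real"
  assumes card: "CARD('n::{finite,linorder}) = CARD('m::{finite,linorder}) + 1"
    and f: "f \<in> V_dual" and l: "\<And>j. l j \<in> V_dual"
  shows "(forward_map f l :: ('m, 'n) params \<Rightarrow> real ^ 'J) \<in> borel_measurable borel"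
proof -
  have comp: "(\<lambda>u :: ('m, 'n) params. l j (G f (F u))) \<in> borel_measurable borel" for j
    unfolding functional_of_solution[OF f l weak_solution_G[OF f F_in_X[OF card]]]
    by (intro borel_measurable_add borel_measurable_diff dual_energy_borel[OF card] V_dual_add f l V_dual_0)
  show ?thesis
  proof (rule borel_measurable_euclidean_space[THEN iffD2], intro ballI)
    fix e :: "real ^ 'J" assume "e \<in> Basis"
    then obtain j where e: "e = axis j 1" by (auto simp: Basis_vec_def)
    have eq: "forward_map f l u \<bullet> e = l j (G f (F u))" for u :: "('m, 'n) params"
      by (simp add: e inner_axis forward_map_def L_def)
    show "(\<lambda>u :: ('m, 'n) params. forward_map f l u \<bullet> e) \<in> borel_measurable borel"
      unfolding eq by (rule comp)
  qed
qed

section \<open>Square roots of positive definite matrices\<close>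

text \<open>
  Induction on the dimension: a maximiser \<open>v\<close> of the quadratic form on the unit sphere of \<open>S\<close> is an
  eigenvector, and its orthogonal complement in \<open>S\<close> is again invariant.
\<close>
lemma spectral_theorem_invariant_subspace:
  fixes f :: "'a::euclidean_space \<Rightarrow> 'a"
  assumes lin: "linear f" and sym: "\<And>x y. f x \<bullet> y = x \<bullet> f y"
  shows "subspace S \<Longrightarrow> f ` S \<subseteq> S \<Longrightarrow>
    \<exists>B. finite B \<and> B \<subseteq> S \<and> pairwise orthogonal B \<and> (\<forall>b\<in>B. norm b = 1 \<and> (\<exists>c. f b = c *\<^sub>R b)) \<and> S \<subseteq> span B"
proof (induction "dim S" arbitrary: S rule: less_induct)
  case (less S)
  interpret f: linear f by (rule lin)
  show ?case
  proof (cases "S \<subseteq> {0}")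
    case True
    then show ?thesis by (intro exI[of _ "{}"]) auto
  next
    case False
    then obtain x where x: "x \<in> S" "x \<noteq> 0" by blast
    let ?K = "sphere 0 1 \<inter> S"
    have "compact ?K"
      by (intro compact_Int_closed compact_sphere closed_subspace less)
    moreover have "x /\<^sub>R norm x \<in> ?K" using x less.prems(1) by (auto simp: subspace_scale)
    moreover have "continuous_on ?K (\<lambda>x. x \<bullet> f x)"
      by (intro continuous_intros linear_continuous_on_compose[OF _ lin])
    ultimately obtain v where v: "v \<in> ?K" and vmax: "\<And>w. w \<in> ?K \<Longrightarrow> w \<bullet> f w \<le> v \<bullet> f v"
      using continuous_attains_sup[of ?K "\<lambda>x. x \<bullet> f x"] by blast
    have vS: "v \<in> S" and nv: "norm v = 1" using v by auto
    define c where "c = v \<bullet> f v"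
    have vv: "v \<bullet> v = 1" using nv by (simp add: norm_eq_1)
    have bound: "w \<bullet> f w \<le> c * (w \<bullet> w)" if "w \<in> S" for w
    proof (cases "w = 0")
      case True then show ?thesis by (simp add: f.zero)
    next
      case False
      have "w /\<^sub>R norm w \<in> ?K" using that False less.prems(1) by (auto simp: subspace_scale)
      from vmax[OF this] have "(w \<bullet> f w) / (norm w * norm w) \<le> c"
        by (simp add: f.scaleR c_def divide_simps)
      then show ?thesis using False
        by (simp add: divide_simps power2_norm_eq_inner[symmetric] power2_eq_square mult.commute)
    qed
    have ortho: "(f v - c *\<^sub>R v) \<bullet> w = 0" if w: "w \<in> S" for w
    proof (rule ccontr)
      define e where "e = (f v - c *\<^sub>R v) \<bullet> w"
      assume "(f v - c *\<^sub>R v) \<bullet> w \<noteq> 0"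
      then have e: "e \<noteq> 0" by (simp add: e_def)
      \<comment> \<open>Perturbing the maximiser in the direction \<open>w\<close> gives a linear term in \<open>t\<close> dominated by a quadratic one.\<close>
      define q where "q = c * (w \<bullet> w) - w \<bullet> f w"
      have q: "q \<ge> 0" using bound[OF w] by (simp add: q_def)
      have quad: "2 * t * e \<le> t\<^sup>2 * q" for t
      proof -
        have "v + t *\<^sub>R w \<in> S" using w vS less.prems(1) by (simp add: subspace_add subspace_scale)
        from bound[OF this] show ?thesis
          by (simp add: f.add f.scaleR inner_add_left inner_add_right vv c_def[symmetric] e_def q_def
              inner_diff_left sym inner_commute[of w v] power2_eq_square algebra_simps
              inner_commute[of w "f v"])
      qed
      have "2 * (e / (q + 1)) * e \<le> (e / (q + 1))\<^sup>2 * q" by (rule quad)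
      then have "2 * e\<^sup>2 * (q + 1) \<le> e\<^sup>2 * q" using q
        by (simp add: divide_simps power2_eq_square split: if_splits)
      then have "e\<^sup>2 * (q + 2) \<le> 0" by (simp add: algebra_simps)
      then show False using e q by (simp add: mult_le_0_iff)
    qed
    have fvS: "f v \<in> S" using less.prems(2) vS by auto
    have "f v - c *\<^sub>R v \<in> S" using fvS vS less.prems(1) by (simp add: subspace_diff subspace_scale)
    from ortho[OF this] have fv: "f v = c *\<^sub>R v" by simp
    define T where "T = {x \<in> S. v \<bullet> x = 0}"
    have T: "subspace T" unfolding T_def using less.prems(1)
      by (auto simp: subspace_def inner_add_right)
    have TS: "T \<subseteq> S" by (auto simp: T_def)
    have "f ` T \<subseteq> T" using less.prems(2) by (auto simp: T_def sym[symmetric] fv)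
    moreover have "dim T < dim S"
    proof (rule dim_psubset)
      have "v \<notin> T" by (simp add: T_def vv)
      then show "span T \<subset> span S"
        using T less.prems(1) TS vS by (simp add: span_eq_iff[THEN iffD2]) blast
    qed
    ultimately obtain B where B: "finite B" "B \<subseteq> T" "pairwise orthogonal B"
        "\<forall>b\<in>B. norm b = 1 \<and> (\<exists>c. f b = c *\<^sub>R b)" "T \<subseteq> span B"
      using less.hyps[OF _ T] by blast
    have "S \<subseteq> span (insert v B)"
    proof
      fix x assume xS: "x \<in> S"
      have "x - (v \<bullet> x) *\<^sub>R v \<in> T"
        using xS vS less.prems(1) by (simp add: T_def subspace_diff subspace_scale inner_diff_right vv)
      then have "x - (v \<bullet> x) *\<^sub>R v \<in> span B" using B(5) by blast
      then show "x \<in> span (insert v B)" unfolding span_insert by blast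
    qed
    moreover have "pairwise orthogonal (insert v B)"
      using B(2,3) by (auto simp: pairwise_insert orthogonal_def T_def inner_commute)
    ultimately show ?thesis using B TS vS nv fv by (intro exI[of _ "insert v B"]) auto
  qed
qed

lemma symmetric_matrix_inner:
  fixes A :: "real ^ 'n ^ 'n"
  assumes "transpose A = A"
  shows "(A *v x) \<bullet> y = x \<bullet> (A *v y)"
  using assms by (metis dot_lmul_matrix transpose_matrix_vector)

text \<open>
  In an orthonormal basis of eigenvectors, take the square roots of the eigenvalues.
\<close>
lemma sym_pos_def_sqrt_exists:
  fixes A :: "real ^ 'n ^ 'n"
  assumes A: "sym_pos_def A"
  shows "\<exists>B. sym_pos_def B \<and> B ** B = A"
proof -
  have symA: "(A *v x) \<bullet> y = x \<bullet> (A *v y)" for x y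
    using A by (intro symmetric_matrix_inner) (simp add: sym_pos_def_def)
  obtain E where E: "finite E" "pairwise orthogonal E" "\<forall>b\<in>E. norm b = 1 \<and> (\<exists>c. A *v b = c *\<^sub>R b)"
      "UNIV \<subseteq> span E"
    using spectral_theorem_invariant_subspace[of "(*v) A" UNIV] symA by auto
  from E(3) obtain c where c: "\<And>b. b \<in> E \<Longrightarrow> A *v b = c b *\<^sub>R b" by metis
  have inn: "b \<bullet> b' = (if b = b' then 1 else 0)" if "b \<in> E" "b' \<in> E" for b b'
    using E(2,3) that by (auto simp: pairwise_def orthogonal_def norm_eq_1)
  have cpos: "c b > 0" if "b \<in> E" for b
  proof -
    have "b \<noteq> 0" using E(3) that by auto
    then have "0 < b \<bullet> (A *v b)" using A by (auto simp: sym_pos_def_def)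
    then show ?thesis using c[OF that] inn[OF that that] by simp
  qed
  have expand: "x = (\<Sum>b\<in>E. (b \<bullet> x) *\<^sub>R b)" for x
  proof -
    have "x \<in> span E" using E(4) by blast
    then obtain r where r: "x = (\<Sum>b\<in>E. r b *\<^sub>R b)" using span_finite[OF E(1)] by auto
    have "b \<bullet> x = r b" if "b \<in> E" for b
    proof -
      have "b \<bullet> x = (\<Sum>b'\<in>E. if b = b' then r b' else 0)"
        unfolding r inner_sum_right by (intro sum.cong) (auto simp: inn that)
      then show ?thesis using that E(1) by simp
    qed
    then show ?thesis using r by simp
  qed
  define g where "g x = (\<Sum>b\<in>E. (sqrt (c b) * (b \<bullet> x)) *\<^sub>R b)" for x
  have ling: "linear g"
    unfolding g_def by (rule linearI)
      (simp_all add: inner_add_right algebra_simps sum.distrib scaleR_sum_right)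
  have gb: "b \<bullet> g x = sqrt (c b) * (b \<bullet> x)" if "b \<in> E" for b x
  proof -
    have "b \<bullet> g x = (\<Sum>b'\<in>E. if b = b' then sqrt (c b') * (b' \<bullet> x) else 0)"
      unfolding g_def inner_sum_right by (intro sum.cong) (auto simp: inn that)
    then show ?thesis using that E(1) by simp
  qed
  have gg: "g (g x) = A *v x" for x
  proof -
    have "g (g x) = (\<Sum>b\<in>E. (c b * (b \<bullet> x)) *\<^sub>R b)"
      unfolding g_def[of "g x"] using cpos
      by (intro sum.cong refl) (auto simp: gb less_imp_le mult.assoc[symmetric])
    also have "\<dots> = A *v (\<Sum>b\<in>E. (b \<bullet> x) *\<^sub>R b)"
      by (simp add: matrix_vector_mult_scaleR vec.linear_sum linear_sum matrix_vector_mul_linear c mult.commute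
            cong: sum.cong)
    finally show ?thesis by (simp only: expand[of x, symmetric])
  qed
  have gsym: "g x \<bullet> y = x \<bullet> g y" for x y
    unfolding g_def inner_sum_left inner_sum_right
    by (intro sum.cong refl) (simp add: inner_commute)
  define B where "B = matrix g"
  have Bv: "B *v x = g x" for x
    unfolding B_def using ling by (simp add: matrix_works)
  have "transpose B = B"
  proof -
    have "g (axis i 1) $ j = g (axis j 1) $ i" for i j
      using gsym[of "axis i 1" "axis j 1"] by (simp add: inner_axis inner_axis')
    then show ?thesis by (simp add: B_def transpose_def matrix_def vec_eq_iff)
  qed
  moreover have "0 < v \<bullet> (B *v v)" if "v \<noteq> 0" for v
  proof -
    have "v \<bullet> g v = (\<Sum>b\<in>E. sqrt (c b) * (b \<bullet> v)\<^sup>2)"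
      unfolding g_def inner_sum_right by (simp add: power2_eq_square inner_commute mult.assoc)
    moreover obtain b where b: "b \<in> E" "b \<bullet> v \<noteq> 0"
    proof (rule ccontr)
      assume "\<not> thesis"
      then have "\<forall>b\<in>E. b \<bullet> v = 0" using that by blast
      then have "(\<Sum>b\<in>E. (b \<bullet> v) *\<^sub>R b) = 0" by simp
      then show False using \<open>v \<noteq> 0\<close> by (simp only: expand[of v, symmetric])
    qed
    moreover have "0 < (\<Sum>b\<in>E. sqrt (c b) * (b \<bullet> v)\<^sup>2)"
      using b cpos E(1) by (intro sum_pos2[of _ b]) (auto simp: less_imp_le)
    ultimately have "0 < v \<bullet> g v" by simp
    then show ?thesis by (simp add: Bv)
  qed
  ultimately have "sym_pos_def B" by (simp add: sym_pos_def_def)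
  moreover have "B ** B = A"
    by (rule matrix_eq[THEN iffD2]) (simp add: matrix_vector_mul_assoc[symmetric] Bv gg)
  ultimately show ?thesis by blast
qed

lemma sym_pos_def_matrix_inv:
  fixes A :: "real ^ 'n ^ 'n"
  assumes A: "sym_pos_def A"
  shows "sym_pos_def (matrix_inv A)"
proof -
  have "v = 0" if "A *v v = 0" for v
    using A that by (auto simp: sym_pos_def_def dest!: spec[of _ v])
  then have inv: "invertible A"
    by (metis invertible_left_inverse matrix_left_invertible_ker)
  have "A ** matrix_inv A = mat 1 \<and> matrix_inv A ** A = mat 1"
    unfolding matrix_inv_def by (rule someI_ex) (use inv in \<open>simp add: invertible_def\<close>)
  then have right: "A ** matrix_inv A = mat 1" by simp
  have "transpose (A ** matrix_inv A) = mat 1"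
    unfolding right by (rule transpose_mat)
  then have left: "transpose (matrix_inv A) ** A = mat 1"
    using A by (simp add: matrix_transpose_mul sym_pos_def_def)
  have "transpose (matrix_inv A) = transpose (matrix_inv A) ** (A ** matrix_inv A)"
    by (simp add: right)
  also have "\<dots> = matrix_inv A" by (simp add: matrix_mul_assoc left)
  finally have tr: "transpose (matrix_inv A) = matrix_inv A" .
  have AA: "A *v (matrix_inv A *v v) = v" for v
    by (simp add: matrix_vector_mul_assoc right)
  have "0 < v \<bullet> (matrix_inv A *v v)" if "v \<noteq> 0" for v
  proof -
    let ?w = "matrix_inv A *v v"
    have "?w \<noteq> 0" using AA[of v] that by auto
    then have "0 < ?w \<bullet> (A *v ?w)" using A by (simp add: sym_pos_def_def)
    then show ?thesis by (simp add: AA inner_commute)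
  qed
  with tr show ?thesis by (simp add: sym_pos_def_def)
qed

text \<open>
  Existence of the positive definite root makes the choice in \<open>inv_sqrt\<close> meaningful, and so identifies
  the misfit \<open>\<Phi>\<close> with the exponent of the noise density.
\<close>
lemma norm_inv_sqrt:
  assumes "sym_pos_def \<Gamma>"
  shows "(norm (inv_sqrt \<Gamma> *v v))\<^sup>2 = v \<bullet> (matrix_inv \<Gamma> *v v)"
proof -
  have "sym_pos_def (inv_sqrt \<Gamma>) \<and> inv_sqrt \<Gamma> ** inv_sqrt \<Gamma> = matrix_inv \<Gamma>"
    unfolding inv_sqrt_def
    by (rule someI_ex) (rule sym_pos_def_sqrt_exists[OF sym_pos_def_matrix_inv[OF assms]])
  then show ?thesis
    by (metis matrix_vector_mul_assoc power2_norm_eq_inner sym_pos_def_def symmetric_matrix_inner)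
qed

section \<open>Bayes' formula for additive noise\<close>

text \<open>
  Observation of \<open>h u\<close> with independent additive noise of density \<open>c exp (- Q)\<close>. The constant \<open>c\<close> is a
  parameter rather than a formula in \<open>Q\<close> because it cancels from the posterior.
\<close>
locale additive_noise_model = prob_space P for P :: "'w measure" +
  fixes M :: "'a measure" and u :: "'w \<Rightarrow> 'a" and \<eta> y :: "'w \<Rightarrow> 'b::euclidean_space"
    and h :: "'a \<Rightarrow> 'b" and Q :: "'b \<Rightarrow> real" and c :: real
  assumes u [measurable]: "u \<in> measurable P M" and \<eta> [measurable]: "\<eta> \<in> borel_measurable P"
    and indep: "indep_set (sets (vimage_algebra (space P) u M)) (sets (vimage_algebra (space P) \<eta> borel))"
    and h [measurable]: "h \<in> borel_measurable M"
    and Q [measurable]: "Q \<in> borel_measurable borel" and Q_nonneg: "\<And>v. 0 \<le> Q v"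
    and noise: "distr P borel \<eta> = density lborel (\<lambda>v. ennreal (c * exp (- Q v)))"
    and y: "\<And>\<omega>. \<omega> \<in> space P \<Longrightarrow> y \<omega> = h (u \<omega>) + \<eta> \<omega>"
begin

lemma y_measurable [measurable]: "y \<in> borel_measurable P"
  by (subst measurable_cong[OF y]) auto

abbreviation \<mu> where "\<mu> \<equiv> distr P M u"

sublocale \<mu>: prob_space \<mu>
  by (rule prob_space_distr) simp

definition likelihood :: "'b \<Rightarrow> 'a \<Rightarrow> real" where "likelihood t v = exp (- Q (t - h v))"

lemma likelihood_bounds: "0 < likelihood t v" "likelihood t v \<le> 1"
  using Q_nonneg by (auto simp: likelihood_def)

lemma likelihood_measurable [measurable]: "(\<lambda>(t, v). likelihood t v) \<in> borel_measurable (borel \<Otimes>\<^sub>M M)"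
  unfolding likelihood_def by measurable

lemma likelihood_section [measurable]: "likelihood t \<in> borel_measurable M"
  unfolding likelihood_def by measurable

definition evidence :: "'b \<Rightarrow> real" where "evidence t = (LINT v|\<mu>. likelihood t v)"

lemma likelihood_integrable: "integrable \<mu> (likelihood t)"
  by (rule \<mu>.integrable_const_bound[where B=1]) (auto simp: likelihood_bounds less_imp_le)

lemma evidence_pos: "0 < evidence t"
proof -
  have "evidence t \<noteq> 0"
  proof
    assume "evidence t = 0"
    then have "AE v in \<mu>. likelihood t v = 0"
      unfolding evidence_def using likelihood_integrable
      by (subst (asm) integral_nonneg_eq_0_iff_AE) (auto simp: likelihood_bounds less_imp_le)
    then have "AE v in \<mu>. False"
      by eventually_elim (metis likelihood_bounds(1) less_irrefl)
    then show False by simp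
  qed
  moreover have "0 \<le> evidence t"
    unfolding evidence_def by (intro integral_nonneg_AE) (auto simp: likelihood_bounds less_imp_le)
  ultimately show ?thesis by simp
qed

lemma nn_evidence: "(\<integral>\<^sup>+ v. ennreal (likelihood t v) \<partial>\<mu>) = ennreal (evidence t)"
  unfolding evidence_def using likelihood_integrable
  by (intro nn_integral_eq_integral) (auto simp: likelihood_bounds less_imp_le)

lemma evidence_measurable [measurable]: "evidence \<in> borel_measurable borel"
  unfolding evidence_def by measurable

text \<open>
  For \<open>c \<le> 0\<close> the density would vanish identically, but the law of \<open>\<eta>\<close> has mass one. For Gaussian noise
  this replaces the evaluation of the Gaussian integral.
\<close>
lemma noise_constant_pos: "0 < c"
proof (rule ccontr)
  assume "\<not> 0 < c"
  then have "c * exp (- Q v) \<le> 0" for v by (simp add: mult_le_0_iff)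
  then have "ennreal (c * exp (- Q v)) = 0" for v by (simp add: ennreal_neg)
  then have "emeasure (distr P borel \<eta>) UNIV = 0" unfolding noise by (simp add: emeasure_density)
  moreover have "prob_space (distr P borel \<eta>)" by (rule prob_space_distr) simp
  then have "emeasure (distr P borel \<eta>) UNIV = 1"
    using prob_space.emeasure_space_1 by fastforce
  ultimately show False by simp
qed

lemma product_law: "\<mu> \<Otimes>\<^sub>M distr P borel \<eta> = distr P (M \<Otimes>\<^sub>M borel) (\<lambda>\<omega>. (u \<omega>, \<eta> \<omega>))"
proof (rule pair_measure_eqI)
  interpret \<nu>: prob_space "distr P borel \<eta>" by (rule prob_space_distr) simp
  show "sigma_finite_measure \<mu>" by (rule \<mu>.sigma_finite_measure_axioms)
  show "sigma_finite_measure (distr P borel \<eta>)" by (rule \<nu>.sigma_finite_measure_axioms)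
  fix A and B :: "'b set" assume "A \<in> sets \<mu>" "B \<in> sets (distr P borel \<eta>)"
  then have [measurable]: "A \<in> sets M" "B \<in> sets borel" by simp_all
  have "prob (u -` A \<inter> space P \<inter> (\<eta> -` B \<inter> space P)) = prob (u -` A \<inter> space P) * prob (\<eta> -` B \<inter> space P)"
    by (rule indep_setD[OF indep]) (auto intro: in_vimage_algebra)
  moreover have "u -` A \<inter> space P \<inter> (\<eta> -` B \<inter> space P) = (\<lambda>\<omega>. (u \<omega>, \<eta> \<omega>)) -` (A \<times> B) \<inter> space P"
    by auto
  ultimately show "emeasure \<mu> A * emeasure (distr P borel \<eta>) B =
      emeasure (distr P (M \<Otimes>\<^sub>M borel) (\<lambda>\<omega>. (u \<omega>, \<eta> \<omega>))) (A \<times> B)"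
    by (simp add: emeasure_distr emeasure_eq_measure ennreal_mult'')
qed (simp cong: sets_pair_measure_cong)

text \<open>
  Given \<open>u = v\<close>, the observation is the noise translated by \<open>h v\<close>, so that its density at \<open>t\<close> is
  \<open>c exp (- Q (t - h v))\<close>; the order of integration is then exchanged.
\<close>
lemma joint_law:
  assumes [measurable]: "A \<in> sets M" "B \<in> sets borel"
  shows "emeasure P {\<omega> \<in> space P. u \<omega> \<in> A \<and> y \<omega> \<in> B} =
    (\<integral>\<^sup>+ t. ennreal c * (\<integral>\<^sup>+ v. ennreal (likelihood t v) * indicator A v \<partial>\<mu>) * indicator B t \<partial>lborel)"
proof -
  let ?\<nu> = "distr P borel \<eta>"
  interpret \<nu>: prob_space ?\<nu> by (rule prob_space_distr) simp
  interpret \<mu>l: pair_sigma_finite \<mu> "lborel :: 'b measure"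
    by (simp add: pair_sigma_finite_def \<mu>.sigma_finite_measure_axioms sigma_finite_lborel)
  define S where "S = {w \<in> space (M \<Otimes>\<^sub>M borel). fst w \<in> A \<and> h (fst w) + snd w \<in> B}"
  have S [measurable]: "S \<in> sets (M \<Otimes>\<^sub>M borel)" unfolding S_def by measurable
  have "{\<omega> \<in> space P. u \<omega> \<in> A \<and> y \<omega> \<in> B} = (\<lambda>\<omega>. (u \<omega>, \<eta> \<omega>)) -` S \<inter> space P"
    using measurable_space[OF u] by (auto simp: S_def y space_pair_measure)
  then have "emeasure P {\<omega> \<in> space P. u \<omega> \<in> A \<and> y \<omega> \<in> B} =
      emeasure (distr P (M \<Otimes>\<^sub>M borel) (\<lambda>\<omega>. (u \<omega>, \<eta> \<omega>))) S"
    by (simp add: emeasure_distr)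
  also have "\<dots> = emeasure (\<mu> \<Otimes>\<^sub>M ?\<nu>) S"
    by (simp add: product_law)
  also have "\<dots> = (\<integral>\<^sup>+ v. emeasure ?\<nu> (Pair v -` S) \<partial>\<mu>)"
    by (rule \<nu>.emeasure_pair_measure_alt) (simp add: S_def)
  also have "\<dots> = (\<integral>\<^sup>+ v. (\<integral>\<^sup>+ t. ennreal c * ennreal (likelihood t v) * indicator A v * indicator B t \<partial>lborel) \<partial>\<mu>)"
  proof (rule nn_integral_cong)
    fix v assume "v \<in> space \<mu>"
    then have v: "v \<in> space M" by simp
    have [measurable]: "Pair v -` S \<in> sets borel" by (rule sets_Pair1[OF S])
    have "emeasure ?\<nu> (Pair v -` S) = (\<integral>\<^sup>+ e. ennreal (c * exp (- Q e)) * indicator (Pair v -` S) e \<partial>lborel)"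
      unfolding noise by (subst emeasure_density) auto
    also have "\<dots> = (\<integral>\<^sup>+ e. ennreal (c * exp (- Q ((h v + e) - h v))) * indicator A v * indicator B (h v + e) \<partial>lborel)"
      using v by (intro nn_integral_cong) (auto simp: S_def space_pair_measure split: split_indicator)
    also have "\<dots> = (\<integral>\<^sup>+ t. ennreal (c * exp (- Q (t - h v))) * indicator A v * indicator B t \<partial>(distr lborel borel ((+) (h v))))"
      by (subst nn_integral_distr) auto
    also have "\<dots> = (\<integral>\<^sup>+ t. ennreal c * ennreal (likelihood t v) * indicator A v * indicator B t \<partial>lborel)"
      unfolding lborel_distr_plus likelihood_def using noise_constant_pos by (simp add: ennreal_mult')
    finally show "emeasure ?\<nu> (Pair v -` S) = \<dots>" .
  qed
  also have "\<dots> = (\<integral>\<^sup>+ t. (\<integral>\<^sup>+ v. ennreal c * ennreal (likelihood t v) * indicator A v * indicator B t \<partial>\<mu>) \<partial>lborel)"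
    by (rule \<mu>l.Fubini'[symmetric]) (simp add: split_beta', measurable)
  also have "\<dots> = (\<integral>\<^sup>+ t. ennreal c * (\<integral>\<^sup>+ v. ennreal (likelihood t v) * indicator A v \<partial>\<mu>) * indicator B t \<partial>lborel)"
    by (intro nn_integral_cong) (subst nn_integral_multc, simp, simp add: nn_integral_cmult mult.assoc)
  finally show ?thesis .
qed

lemma law_y: "distr P borel y = density lborel (\<lambda>t. ennreal (c * evidence t))"
proof (rule measure_eqI)
  fix B assume "B \<in> sets (distr P borel y)"
  then have B [measurable]: "B \<in> sets borel" by simp
  have "emeasure (distr P borel y) B = emeasure P {\<omega> \<in> space P. u \<omega> \<in> space M \<and> y \<omega> \<in> B}"
    using measurable_space[OF u] by (subst emeasure_distr) (auto intro!: arg_cong[where f="emeasure P"])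
  also have "\<dots> = (\<integral>\<^sup>+ t. ennreal c * (\<integral>\<^sup>+ v. ennreal (likelihood t v) * indicator (space M) v \<partial>\<mu>) * indicator B t \<partial>lborel)"
    by (rule joint_law) auto
  also have "\<dots> = (\<integral>\<^sup>+ t. ennreal c * (\<integral>\<^sup>+ v. ennreal (likelihood t v) \<partial>\<mu>) * indicator B t \<partial>lborel)"
    by (intro nn_integral_cong arg_cong2[where f="(*)"] refl) auto
  also have "\<dots> = emeasure (density lborel (\<lambda>t. ennreal (c * evidence t))) B"
    unfolding nn_evidence using noise_constant_pos evidence_pos
    by (subst emeasure_density) (auto simp: ennreal_mult' less_imp_le)
  finally show "emeasure (distr P borel y) B = \<dots>" .
qed simp

definition posterior :: "'b \<Rightarrow> 'a measure" where
  "posterior t = density \<mu> (\<lambda>v. ennreal (1 / evidence t * likelihood t v))"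

lemma emeasure_posterior:
  assumes [measurable]: "A \<in> sets M"
  shows "emeasure (posterior t) A =
    ennreal (1 / evidence t) * (\<integral>\<^sup>+ v. ennreal (likelihood t v) * indicator A v \<partial>\<mu>)"
proof -
  have "emeasure (posterior t) A =
      (\<integral>\<^sup>+ v. ennreal (1 / evidence t) * (ennreal (likelihood t v) * indicator A v) \<partial>\<mu>)"
    unfolding posterior_def using evidence_pos[of t]
    by (subst emeasure_density) (auto simp: ennreal_mult'[symmetric] mult.assoc[symmetric])
  then show ?thesis by (simp add: nn_integral_cmult)
qed

lemma prob_space_posterior: "prob_space (posterior t)"
proof
  have "emeasure (posterior t) (space M) = ennreal (1 / evidence t) * ennreal (evidence t)"
    by (subst emeasure_posterior) (auto simp: nn_evidence[symmetric] intro!: arg_cong2[where f="(*)"] nn_integral_cong)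
  also have "\<dots> = 1" using evidence_pos[of t] by (simp add: ennreal_mult'[symmetric])
  finally show "emeasure (posterior t) (space (posterior t)) = 1" by (simp add: posterior_def)
qed

lemma posterior_measurable: "posterior \<in> measurable borel (prob_algebra M)"
proof (intro measurable_prob_algebraI measurable_subprob_algebra)
  show "prob_space (posterior t)" for t by (rule prob_space_posterior)
  then show "subprob_space (posterior t)" for t by (rule prob_space_imp_subprob_space)
  show "sets (posterior t) = sets M" for t by (simp add: posterior_def)
  show "(\<lambda>t. emeasure (posterior t) A) \<in> borel_measurable borel" if [measurable]: "A \<in> sets M" for A
  proof -
    have [measurable]: "(\<lambda>(t, v). ennreal (likelihood t v) * indicator A v) \<in> borel_measurable (borel \<Otimes>\<^sub>M \<mu>)"
      by (simp add: split_beta', measurable)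
    show ?thesis unfolding emeasure_posterior[OF that] by measurable
  qed
qed

text \<open>
  The density \<open>c * evidence t\<close> of the observation cancels the normalisation of the posterior, which
  leaves the joint law.
\<close>
theorem posterior_regular_conditional_distribution:
  "regular_conditional_distribution P M u borel y posterior"
  unfolding regular_conditional_distribution_def
proof (intro conjI ballI u y_measurable posterior_measurable)
  fix A and B :: "'b set" assume A [measurable]: "A \<in> sets M" and B [measurable]: "B \<in> sets borel"
  have [measurable]: "(\<lambda>t. emeasure (posterior t) A) \<in> borel_measurable borel"
    using measurable_prob_algebraD[OF posterior_measurable] by measurable
  have "(\<integral>\<^sup>+ t\<in>B. emeasure (posterior t) A \<partial>distr P borel y) =
      (\<integral>\<^sup>+ t. ennreal (c * evidence t) * (emeasure (posterior t) A * indicator B t) \<partial>lborel)"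
    unfolding law_y by (subst nn_integral_density) auto
  also have "\<dots> = (\<integral>\<^sup>+ t. ennreal c * (\<integral>\<^sup>+ v. ennreal (likelihood t v) * indicator A v \<partial>\<mu>) * indicator B t \<partial>lborel)"
  proof (rule nn_integral_cong)
    fix t
    have "ennreal (c * evidence t) * ennreal (1 / evidence t) = ennreal c"
      using evidence_pos[of t] noise_constant_pos by (simp add: ennreal_mult'[symmetric])
    then show "ennreal (c * evidence t) * (emeasure (posterior t) A * indicator B t) =
        ennreal c * (\<integral>\<^sup>+ v. ennreal (likelihood t v) * indicator A v \<partial>\<mu>) * indicator B t"
      by (simp add: emeasure_posterior mult.assoc[symmetric])
  qed
  finally show "emeasure P {\<omega> \<in> space P. u \<omega> \<in> A \<and> y \<omega> \<in> B} =
      (\<integral>\<^sup>+ t\<in>B. emeasure (posterior t) A \<partial>distr P borel y)"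
    by (simp add: joint_law)
qed

lemma posterior_absolutely_continuous: "absolutely_continuous \<mu> (posterior t)"
  unfolding posterior_def by (rule absolutely_continuousI_density) simp

lemma RN_deriv_posterior:
  "AE v in \<mu>. RN_deriv \<mu> (posterior t) v = ennreal (1 / evidence t * likelihood t v)"
  using \<mu>.RN_deriv_unique[OF _ posterior_def[symmetric], of t] by auto

end

section \<open>The posterior distribution of the layer model\<close>

theorem theorem3p4:
  fixes n :: nat
    and f :: "(real \<times> real \<Rightarrow> real) \<Rightarrow> real"
    and l :: "'J::finite \<Rightarrow> (real \<times> real \<Rightarrow> real) \<Rightarrow> real"
    and \<Gamma> :: "real ^ 'J ^ 'J"
    and cstar :: real
    and \<mu> :: "'n::{finite,linorder} \<Rightarrow> (Dbar \<Rightarrow>\<^sub>C real) measure"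
    and m :: "'n \<Rightarrow> (Dbar \<Rightarrow>\<^sub>C real)"
    and C :: "'n \<Rightarrow> ((Dbar \<Rightarrow>\<^sub>C real) \<Rightarrow>\<^sub>L real) \<Rightarrow> (Dbar \<Rightarrow>\<^sub>C real)"
    and \<mu>0 :: "('m::{finite,linorder}, 'n) params measure"
    and P :: "'w measure"
    and u :: "'w \<Rightarrow> ('m, 'n) params"
    and \<eta> y :: "'w \<Rightarrow> real ^ 'J"
  assumes "n \<ge> 2" and "CARD('n) = n" and "CARD('m) = n - 1"
    and "f \<in> V_dual" and "\<And>j. l j \<in> V_dual"
    and "sym_pos_def \<Gamma>"
    and "cstar > 0"
    and "\<And>i. gaussian (\<mu> i) (m i) (C i)"
    and "\<mu>0 = prior cstar \<mu>"
    and "prob_space P"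
    and "u \<in> measurable P (restrict_space borel (U cstar))"
    and "\<eta> \<in> measurable P borel"
    and "distr P (restrict_space borel (U cstar)) u = \<mu>0"
    and "distr P borel \<eta> = noise_law \<Gamma>"
    and "prob_space.indep_set P
           (sets (vimage_algebra (space P) u (restrict_space borel (U cstar))))
           (sets (vimage_algebra (space P) \<eta> borel))"
    and "\<And>\<omega>. \<omega> \<in> space P \<Longrightarrow> y \<omega> = forward_map f l (u \<omega>) + \<eta> \<omega>"
  shows "\<exists>\<mu>post.
       regular_conditional_distribution P (restrict_space borel (U cstar)) u borel y \<mu>post \<and>
       (\<forall>t. Z f l \<Gamma> \<mu>0 t > 0 \<and>
            absolutely_continuous \<mu>0 (\<mu>post t) \<and>
            (AE v in \<mu>0. RN_deriv \<mu>0 (\<mu>post t) v =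
               ennreal (1 / Z f l \<Gamma> \<mu>0 t * exp (- \<Phi> f l \<Gamma> v t))))"
proof -
  have card: "CARD('n) = CARD('m) + 1" using assms(1-3) by simp
  define Q where "Q v = 1/2 * (v \<bullet> (matrix_inv \<Gamma> *v v))" for v :: "real ^ 'J"
  define c where "c = 1 / sqrt ((2 * pi) ^ CARD('J) * det \<Gamma>)"
  have \<Phi>: "\<Phi> f l \<Gamma> v t = Q (t - forward_map f l v)" for v :: "('m, 'n) params" and t
    by (simp add: \<Phi>_def Q_def norm_inv_sqrt[OF assms(6)])
  have noise: "noise_law \<Gamma> = density lborel (\<lambda>v. ennreal (c * exp (- Q v)))"
    by (simp add: noise_law_def c_def Q_def)
  interpret additive_noise_model P "restrict_space borel (U cstar)" u \<eta> y "forward_map f l" Q c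
  proof (intro additive_noise_model.intro additive_noise_model_axioms.intro)
    show "forward_map f l \<in> borel_measurable (restrict_space borel (U cstar) :: ('m, 'n) params measure)"
      by (rule measurable_restrict_space1[OF forward_map_borel[OF card assms(4,5)]])
    have "continuous_on UNIV Q"
      unfolding Q_def by (intro continuous_intros linear_continuous_on_compose[OF _ matrix_vector_mul_linear])
    then show "Q \<in> borel_measurable borel" by (rule borel_measurable_continuous_onI)
    show "0 \<le> Q v" for v unfolding Q_def norm_inv_sqrt[OF assms(6), symmetric] by simp
    show "distr P borel \<eta> = density lborel (\<lambda>v. ennreal (c * exp (- Q v)))"
      unfolding noise[symmetric] by (rule assms(14))
  qed (fact assms)+
  have likelihood: "likelihood t v = exp (- \<Phi> f l \<Gamma> v t)" for t v
    by (simp add: likelihood_def \<Phi>)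
  have Z: "Z f l \<Gamma> \<mu>0 t = evidence t" for t
    unfolding Z_def evidence_def likelihood assms(13) ..
  show ?thesis
  proof (intro exI[of _ posterior] conjI allI)
    show "regular_conditional_distribution P (restrict_space borel (U cstar)) u borel y posterior"
      by (rule posterior_regular_conditional_distribution)
    fix t
    show "Z f l \<Gamma> \<mu>0 t > 0" unfolding Z by (rule evidence_pos)
    show "absolutely_continuous \<mu>0 (posterior t)"
      using posterior_absolutely_continuous unfolding assms(13) .
    show "AE v in \<mu>0. RN_deriv \<mu>0 (posterior t) v = ennreal (1 / Z f l \<Gamma> \<mu>0 t * exp (- \<Phi> f l \<Gamma> v t))"
      using RN_deriv_posterior[of t] unfolding assms(13) Z likelihood .
  qed
qed

end
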